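(* Let $a\in(0,1)$, $d_1=a$, $d_2=1-a$, $a_1>0$, $a_2,H,\omega_1\in\mathbb{C}$, let $q_2\in L^2(0,d_2)$ be complex-valued, and let $\{\mu_{0,n}\}_{n\ge0}$, $\{\mu_{1,n}\}_{n\ge0}$ be given sequences of complex numbers. Call a pair $(q_1,h)$, with complex-valued $q_1\in L^2(0,a)$ and $h\in\mathbb{C}$, a solution of the inverse problem if $h+\frac12\int_0^a q_1(x)\,dx=\omega_1$ and, for $i=0,1$, $\{\mu_{i,n}\}_{n\ge 0}$ is a subspectrum of the problem $B_i$, where $B_1=B(d_1,d_2,q_1,q_2,h,H,a_1,a_2)$ and $B_0=B(d_1,d_2,q_1,q_2,h,\infty,a_1,a_2)$. Assume that the inverse problem has at least one solution. If the system $\{c_n^i(t)\}_{n\ge0,\,i=0,1}$ is complete in $L^2(0,2a)$, then the solution is unique.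
   Context: Boundary value problem. For complex-valued $q_j\in L^2(0,d_j)$ ($j=1,2$), $h,a_2\in\mathbb{C}$, $a_1>0$ and $H\in\mathbb{C}\cup\{\infty\}$, $B(d_1,d_2,q_1,q_2,h,H,a_1,a_2)$ denotes the problem $-y_j''(x)+q_j(x)y_j(x)=\lambda y_j(x)$, $0<x<d_j$, $j=1,2$; $\ y_1'(0)-hy_1(0)=0$; $\ y_2'(0)-Hy_2(0)=0$ (replaced by $y_2(0)=0$ if $H=\infty$); $\ y_1(d_1)-a_1^{-1}y_2(d_2)=0$, $\ y_1'(d_1)+a_1y_2'(d_2)+a_2y_2(d_2)=0$. Characteristic functions. Let $\varphi(x,\lambda)$ solve $-y''+q_1y=\lambda y$ with $\varphi(0,\lambda)=1$, $\varphi'(0,\lambda)=h$; let $\psi_0,\psi_1$ solve $-y''+q_2y=\lambda y$ with $\psi_0(0,\lambda)=0$, $\psi_0'(0,\lambda)=1$, $\psi_1(0,\lambda)=1$, $\psi_1'(0,\lambda)=H$. Put $\varphi_0(\lambda)=\varphi(a,\lambda)$, $\varphi_1(\lambda)=\varphi'(a,\lambda)$, $g_{i,0}(\lambda)=-a_1^{-1}\psi_i(d_2,\lambda)$, $g_{i,1}(\lambda)=a_1\psi_i'(d_2,\lambda)+a_2\psi_i(d_2,\lambda)$. The eigenvalues of $B_i$, counted with multiplicities, are the zeros of the entire function $\Delta_i(\lambda)=\varphi_0(\lambda)g_{i,1}(\lambda)-\varphi_1(\lambda)g_{i,0}(\lambda)$, $i=0,1$. A subspectrum of $B_i$ is a subsequence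 of the sequence of eigenvalues counted with multiplicities (so a value occurring $m$ times in it is a zero of $\Delta_i$ of multiplicity at least $m$); it may be finite or empty, in which case the index $n$ ranges over the corresponding finite set. The system $c_n^i$. Each sequence is ordered so that $|\mu_{i,n+1}|\ge|\mu_{i,n}|$ and equal values are adjacent. $m_n^i$ is the multiplicity (number of occurrences) of the value $\mu_{i,n}$ in $\{\mu_{i,k}\}_{k\ge0}$, and $\mathcal{S}_i=\{0\}\cup\{n\ge1:\mu_{i,n}\ne\mu_{i,n-1}\}$. With $\lambda=\rho^2$, put $c_{n+\nu}^i(t)=\frac{1}{\nu!}\frac{\partial^\nu\cos\rho t}{\partial\lambda^\nu}\Big|_{\lambda=\mu_{i,n}}$ for $n\in\mathcal{S}_i$, $\nu=0,\dots,m_n^i-1$. *)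

theory Defs
  imports "HOL-Analysis.Analysis"
begin

definition L2_on :: "real set \<Rightarrow> (real \<Rightarrow> complex) \<Rightarrow> bool" where
  "L2_on S f \<longleftrightarrow>
     f \<in> borel_measurable (lebesgue_on S) \<and> integrable (lebesgue_on S) (\<lambda>x. (norm (f x))\<^sup>2)"

text \<open>
  \<open>has_ac_deriv d f g\<close>: on \<open>[0, d]\<close> the function \<open>f\<close> is absolutely continuous with derivative
  \<open>g\<close> almost everywhere, i.e. \<open>f\<close> is an indefinite Lebesgue integral of \<open>g \<in> L\<^sup>1(0, d)\<close>.
\<close>

definition has_ac_deriv :: "real \<Rightarrow> (real \<Rightarrow> complex) \<Rightarrow> (real \<Rightarrow> complex) \<Rightarrow> bool" where
  "has_ac_deriv d f g \<longleftrightarrow>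
     integrable (lebesgue_on {0<..<d}) g \<and>
     (\<forall>x\<in>{0..d}. f x = f 0 + (LINT t|lebesgue_on {0<..<x}. g t))"

text \<open>
  Since the potential is only square integrable, \<open>- y'' + q y = \<lambda> y\<close> is understood in the usual
  (Caratheodory) sense: \<open>y\<close> and \<open>y'\<close> are absolutely continuous on \<open>[0, d]\<close> and the equation
  holds almost everywhere.  The pair \<open>(y, y')\<close> is carried along, so that \<open>y'\<close> has a value at
  the end points.
\<close>

definition sl_solution ::
  "real \<Rightarrow> (real \<Rightarrow> complex) \<Rightarrow> complex \<Rightarrow> (real \<Rightarrow> complex) \<Rightarrow> (real \<Rightarrow> complex) \<Rightarrow> bool" where
  "sl_solution d q lam y y' \<longleftrightarrow>
     (\<exists>y''. has_ac_deriv d y y' \<and> has_ac_deriv d y' y'' \<and>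
        (AE x in lebesgue_on {0<..<d}. - y'' x + q x * y x = lam * y x))"

text \<open>
  Value at \<open>x \<in> [0, d]\<close> of the solution with \<open>y(0) = u\<close>, \<open>y'(0) = v\<close>, and of its derivative.
  For \<open>q \<in> L\<^sup>2(0, d)\<close> this initial value problem is uniquely solvable on \<open>[0, d]\<close>, so the
  descriptions below are proper.
\<close>

definition sl_sol ::
  "real \<Rightarrow> (real \<Rightarrow> complex) \<Rightarrow> complex \<Rightarrow> complex \<Rightarrow> complex \<Rightarrow> real \<Rightarrow> complex" where
  "sl_sol d q lam u v x =
     (THE w. \<exists>y y'. sl_solution d q lam y y' \<and> y 0 = u \<and> y' 0 = v \<and> w = y x)"

definition sl_sol_deriv ::
  "real \<Rightarrow> (real \<Rightarrow> complex) \<Rightarrow> complex \<Rightarrow> complex \<Rightarrow> complex \<Rightarrow> real \<Rightarrow> complex" where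
  "sl_sol_deriv d q lam u v x =
     (THE w. \<exists>y y'. sl_solution d q lam y y' \<and> y 0 = u \<and> y' 0 = v \<and> w = y' x)"

text \<open>
  The boundary condition for \<open>y\<^sub>2\<close> at \<open>0\<close>: \<open>Robin H\<close> is \<open>y\<^sub>2'(0) - H y\<^sub>2(0) = 0\<close> with
  \<open>H\<close> complex, and \<open>Dirichlet\<close> is \<open>y\<^sub>2(0) = 0\<close>, the case \<open>H = \<infinity>\<close>.  \<open>init_val\<close> and
  \<open>init_deriv\<close> are the initial data of the normalised solution satisfying it
  (\<open>\<psi>\<^sub>1\<close> and \<open>\<psi>\<^sub>0\<close>, respectively).
\<close>

datatype end_cond = Robin complex | Dirichlet

fun init_val :: "end_cond \<Rightarrow> complex" where
  "init_val (Robin H) = 1"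
| "init_val Dirichlet = 0"

fun init_deriv :: "end_cond \<Rightarrow> complex" where
  "init_deriv (Robin H) = H"
| "init_deriv Dirichlet = 1"

text \<open>
  Characteristic function of the problem \<open>B(d\<^sub>1, d\<^sub>2, q\<^sub>1, q\<^sub>2, h, H, a\<^sub>1, a\<^sub>2)\<close>
  \<open>- y\<^sub>j'' + q\<^sub>j y\<^sub>j = \<lambda> y\<^sub>j\<close> on \<open>(0, d\<^sub>j)\<close>, \<open>y\<^sub>1'(0) - h y\<^sub>1(0) = 0\<close>, the end condition for
  \<open>y\<^sub>2\<close> at \<open>0\<close>, and the matching conditions
  \<open>y\<^sub>1(d\<^sub>1) - y\<^sub>2(d\<^sub>2) / a\<^sub>1 = 0\<close>, \<open>y\<^sub>1'(d\<^sub>1) + a\<^sub>1 y\<^sub>2'(d\<^sub>2) + a\<^sub>2 y\<^sub>2(d\<^sub>2) = 0\<close>: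
  it is the determinant of the matching conditions for the normalised solutions of the two
  equations.  The eigenvalues with multiplicities are its zeros.
\<close>

definition char_fun ::
  "real \<Rightarrow> real \<Rightarrow> (real \<Rightarrow> complex) \<Rightarrow> (real \<Rightarrow> complex) \<Rightarrow> complex \<Rightarrow> end_cond \<Rightarrow> real \<Rightarrow> complex
     \<Rightarrow> complex \<Rightarrow> complex" where
  "char_fun d1 d2 q1 q2 h bc a1 a2 lam =
     (let \<phi>0 = sl_sol d1 q1 lam 1 h d1;
          \<phi>1 = sl_sol_deriv d1 q1 lam 1 h d1;
          \<psi> = sl_sol d2 q2 lam (init_val bc) (init_deriv bc) d2;
          \<psi>' = sl_sol_deriv d2 q2 lam (init_val bc) (init_deriv bc) d2;
          g0 = - inverse (of_real a1) * \<psi>;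
          g1 = of_real a1 * \<psi>' + a2 * \<psi>
      in \<phi>0 * g1 - \<phi>1 * g0)"

text \<open>
  A finite or infinite sequence is given by its length \<open>N :: enat\<close> and a function \<open>\<mu>\<close> of which
  only the values at indices \<open>n\<close> with \<open>enat n < N\<close> matter.  \<open>occurrences N \<mu> z\<close> is the set of
  indices at which the value \<open>z\<close> is taken.
\<close>

definition occurrences :: "enat \<Rightarrow> (nat \<Rightarrow> complex) \<Rightarrow> complex \<Rightarrow> nat set" where
  "occurrences N \<mu> z = {k. enat k < N \<and> \<mu> k = z}"

definition ordered_seq :: "enat \<Rightarrow> (nat \<Rightarrow> complex) \<Rightarrow> bool" where
  "ordered_seq N \<mu> \<longleftrightarrow>
     (\<forall>n. enat (Suc n) < N \<longrightarrow> norm (\<mu> n) \<le> norm (\<mu> (Suc n))) \<and>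
     (\<forall>j k l. j \<le> k \<and> k \<le> l \<and> enat l < N \<and> \<mu> j = \<mu> l \<longrightarrow> \<mu> k = \<mu> j)"

text \<open>
  The sequence is a subsequence of the zeros of \<open>\<Delta>\<close> counted with multiplicities: a value
  occurring \<open>m\<close> times is a zero of multiplicity at least \<open>m\<close>.  Finiteness is stated because
  \<open>card\<close> of an infinite set is \<open>0\<close>.
\<close>

definition subsequence_of_zeros :: "enat \<Rightarrow> (nat \<Rightarrow> complex) \<Rightarrow> (complex \<Rightarrow> complex) \<Rightarrow> bool" where
  "subsequence_of_zeros N \<mu> \<Delta> \<longleftrightarrow>
     (\<forall>z. finite (occurrences N \<mu> z) \<and>
          (\<forall>j < card (occurrences N \<mu> z). (deriv ^^ j) \<Delta> z = 0))"

definition is_subspectrum ::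
  "enat \<Rightarrow> (nat \<Rightarrow> complex) \<Rightarrow> real \<Rightarrow> real \<Rightarrow> (real \<Rightarrow> complex) \<Rightarrow> (real \<Rightarrow> complex) \<Rightarrow> complex
     \<Rightarrow> end_cond \<Rightarrow> real \<Rightarrow> complex \<Rightarrow> bool" where
  "is_subspectrum N \<mu> d1 d2 q1 q2 h bc a1 a2 \<longleftrightarrow>
     subsequence_of_zeros N \<mu> (char_fun d1 d2 q1 q2 h bc a1 a2)"

definition inverse_problem_solution ::
  "real \<Rightarrow> real \<Rightarrow> (real \<Rightarrow> complex) \<Rightarrow> complex \<Rightarrow> real \<Rightarrow> complex \<Rightarrow> complex
     \<Rightarrow> enat \<Rightarrow> (nat \<Rightarrow> complex) \<Rightarrow> enat \<Rightarrow> (nat \<Rightarrow> complex) \<Rightarrow> (real \<Rightarrow> complex) \<Rightarrow> complex \<Rightarrow> bool" where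
  "inverse_problem_solution d1 d2 q2 H a1 a2 \<omega>1 N0 \<mu>0 N1 \<mu>1 q1 h \<longleftrightarrow>
     L2_on {0<..<d1} q1 \<and>
     h + (1/2) * (LINT x|lebesgue_on {0<..<d1}. q1 x) = \<omega>1 \<and>
     is_subspectrum N0 \<mu>0 d1 d2 q1 q2 h Dirichlet a1 a2 \<and>
     is_subspectrum N1 \<mu>1 d1 d2 q1 q2 h (Robin H) a1 a2"

text \<open>
  \<open>cos_coeff \<mu> \<nu> t\<close> is \<open>(1 / \<nu>!) \<partial>\<^sup>\<nu> cos(\<rho> t) / \<partial>\<lambda>\<^sup>\<nu>\<close> at \<open>\<lambda> = \<mu>\<close>, where \<open>\<lambda> = \<rho>\<^sup>2\<close>.
  As cosine is even, \<open>\<lambda> \<mapsto> cos(\<rho> t)\<close> does not depend on the choice of the square root and is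
  entire, so the branch cut of \<open>csqrt\<close> is harmless.
\<close>

definition cos_coeff :: "complex \<Rightarrow> nat \<Rightarrow> real \<Rightarrow> complex" where
  "cos_coeff \<mu> \<nu> t = (deriv ^^ \<nu>) (\<lambda>lam. cos (csqrt lam * of_real t)) \<mu> / fact \<nu>"

text \<open>
  The functions \<open>c\<^bsub>n+\<nu>\<^esub>\<close> with \<open>n\<close> the first index of a block of equal values and \<open>\<nu>\<close> below
  the length of the block.
\<close>

definition block_starts :: "enat \<Rightarrow> (nat \<Rightarrow> complex) \<Rightarrow> nat set" where
  "block_starts N \<mu> = {n. enat n < N \<and> (n = 0 \<or> \<mu> n \<noteq> \<mu> (n - 1))}"

definition cos_system :: "enat \<Rightarrow> (nat \<Rightarrow> complex) \<Rightarrow> (real \<Rightarrow> complex) set" where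
  "cos_system N \<mu> =
     {cos_coeff (\<mu> n) \<nu> | n \<nu>. n \<in> block_starts N \<mu> \<and> \<nu> < card (occurrences N \<mu> (\<mu> n))}"

text \<open>Completeness: the complex linear span is dense in \<open>L\<^sup>2(S)\<close>.\<close>

definition complete_in_L2 :: "real set \<Rightarrow> (real \<Rightarrow> complex) set \<Rightarrow> bool" where
  "complete_in_L2 S C \<longleftrightarrow>
     (\<forall>c\<in>C. L2_on S c) \<and>
     (\<forall>f. L2_on S f \<longrightarrow> (\<forall>\<epsilon>>0. \<exists>F \<alpha>. finite F \<and> F \<subseteq> C \<and>
        (LINT t|lebesgue_on S. (norm (f t - (\<Sum>c\<in>F. \<alpha> c * c t)))\<^sup>2) < \<epsilon>))"

end

theory Submission
  imports Defs "HOL-Complex_Analysis.Complex_Analysis"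
begin

text \<open>
  Let \<open>\<phi>\<close>, \<open>\<chi>\<close> be the normalised solutions on \<open>[0, a]\<close> belonging to two solutions \<open>(q, h)\<close>,
  \<open>(q', h')\<close> of the inverse problem.  As \<open>(g\<^sub>0, g\<^sub>1)\<close> has no zeros, the Wronskian
  \<open>W = \<phi> \<chi>' - \<phi>' \<chi>\<close> at \<open>a\<close> vanishes at the given eigenvalues with their multiplicities.  On the other hand
  \<open>W = h' - h + \<integral> (q' - q) \<phi> \<chi>\<close>, and the transmutation representation of \<open>\<phi>\<close> and \<open>\<chi>\<close> turns this
  into \<open>\<integral> w(t) cos \<rho>t dt\<close> over \<open>(0, 2a)\<close>, the constant term being killed by the prescribed
  \<open>\<omega>\<^sub>1\<close>.  Completeness forces \<open>w = 0\<close>, which is a homogeneous Volterra equation for \<open>q' - q\<close>.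
\<close>

section \<open>Borel representatives of square integrable potentials\<close>

text \<open>The transmutation kernel is sought on the whole cone |t| < x. There sin(rho r)/rho times
  cos(rho s) is half the integral of cos(rho t) over the window |t - s| < r, so the variation of
  constants formula becomes a fixed point equation for a bounded density, free of derivatives of the
  kernel and of smoothness of q. Only measurability, an exponential bound and the support of the
  kernel are kept; since the cosine is even, the density can be folded to t > 0 at the end. The
  Volterra structure comes from supports: at x the product of the two solutions is the transform of
  an atom at 0, an atom at 2x and a bounded density in between, each atom of weight 1/2. The atom at
  0 yields half the integral of q' - q, the atom at 2x yields the leading term of w, and the density
  at t collects only x > t/2, so q' - q is determined backwards from a. Potentials are given up to
  null sets and are merely Lebesgue measurable, whereas Fubini arguments here want Borel functions;
  hence representatives extended by zero, and a separate bridge to \<open>sl_sol\<close>.\<close>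

lemma integrable_norm_bound:
  fixes f :: "'a \<Rightarrow> 'b::{banach,second_countable_topology}" and g :: "'a \<Rightarrow> real"
  assumes "integrable M g" "f \<in> borel_measurable M" "\<And>x. norm (f x) \<le> g x"
  shows "integrable M f"
  by (rule Bochner_Integration.integrable_bound[OF assms(1,2)])
    (use assms(3) in \<open>auto intro: order_trans[OF _ abs_ge_self]\<close>)

lemma norm_add_square_le:
  fixes x y :: "'a::real_normed_vector"
  shows "(norm (x + y))\<^sup>2 \<le> 2 * (norm x)\<^sup>2 + 2 * (norm y)\<^sup>2"
proof -
  have "(norm (x + y))\<^sup>2 \<le> (norm x + norm y)\<^sup>2" by (intro power_mono norm_triangle_ineq) auto
  also have "\<dots> \<le> 2 * (norm x)\<^sup>2 + 2 * (norm y)\<^sup>2"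
    using sum_squares_bound[of "norm x" "norm y"] by (simp add: power2_sum)
  finally show ?thesis .
qed

text \<open>Extension by zero lets integrals run over the whole line, and a Borel function defined
  everywhere makes joint measurability on products available. The bounded support turns square
  integrability into integrability.\<close>

definition potential :: "real \<Rightarrow> (real \<Rightarrow> complex) \<Rightarrow> bool" where
  "potential d q \<longleftrightarrow> q \<in> borel_measurable borel \<and> integrable lborel (\<lambda>x. (norm (q x))\<^sup>2) \<and>
     (\<forall>x. x \<notin> {0<..<d} \<longrightarrow> q x = 0)"

lemma potentialD:
  assumes "potential d q"
  shows "q \<in> borel_measurable borel" "integrable lborel (\<lambda>x. (norm (q x))\<^sup>2)"
    "x \<notin> {0<..<d} \<Longrightarrow> q x = 0" "x \<le> 0 \<Longrightarrow> q x = 0" "x \<ge> d \<Longrightarrow> q x = 0"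
  using assms by (auto simp: potential_def)

lemma integrable_indicator_interval [simp]:
  "integrable lborel (indicator {a<..<b::real} :: real \<Rightarrow> real)"
  by (cases "a \<le> b") (auto simp: integrable_indicator_iff)

lemma potential_integrable:
  assumes "potential d q"
  shows "integrable lborel q"
proof (rule integrable_norm_bound)
  show "integrable lborel (\<lambda>x. (norm (q x))\<^sup>2 + indicator {0<..<d} x)"
    using potentialD(2)[OF assms] by (intro Bochner_Integration.integrable_add) auto
  show "q \<in> borel_measurable lborel" using potentialD(1)[OF assms] by simp
  show "norm (q x) \<le> (norm (q x))\<^sup>2 + indicator {0<..<d} x" for x
  proof (cases "x \<in> {0<..<d}")
    case True
    have "0 \<le> (norm (q x) - 1)\<^sup>2" by simp
    then have "2 * norm (q x) \<le> (norm (q x))\<^sup>2 + 1" by (simp add: power2_eq_square algebra_simps)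
    moreover have "0 \<le> norm (q x)" by simp
    ultimately have "norm (q x) \<le> (norm (q x))\<^sup>2 + 1" by linarith
    then show ?thesis using True by simp
  next
    case False
    then show ?thesis using potentialD(3)[OF assms, of x] by simp
  qed
qed

text \<open>Lebesgue measure is the completion of \<open>lborel\<close>, so a measurable function
  agrees almost everywhere with a Borel one; real and imaginary parts are treated separately and
  recombined.\<close>

lemma lebesgue_on_borel_representative:
  fixes g :: "real \<Rightarrow> complex"
  assumes g: "g \<in> borel_measurable (lebesgue_on S)" and S: "S \<in> sets borel"
  obtains g' where "g' \<in> borel_measurable borel" "\<And>x. x \<notin> S \<Longrightarrow> g' x = 0"
    "AE x in lebesgue_on S. g x = g' x"
proof -
  have [measurable]: "S \<in> sets lebesgue" using S by simp
  let ?G = "\<lambda>x. indicator S x *\<^sub>R g x"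
  have G: "?G \<in> borel_measurable lebesgue"
    using g by (simp add: borel_measurable_restrict_space_iff[of S lebesgue])
  have "(\<lambda>x. Re (?G x)) \<in> borel_measurable lebesgue" "(\<lambda>x. Im (?G x)) \<in> borel_measurable lebesgue"
    by (rule measurable_compose[OF G], simp)+
  then obtain r i where ri: "r \<in> borel_measurable lborel" "AE x in lborel. Re (?G x) = r x"
      "i \<in> borel_measurable lborel" "AE x in lborel. Im (?G x) = i x"
    by (blast dest: completion_ex_borel_measurable_real)
  let ?g = "\<lambda>x. indicator S x *\<^sub>R Complex (r x) (i x)"
  have "?g = (\<lambda>x. indicator S x *\<^sub>R (of_real (r x) + \<i> * of_real (i x)))"
    by (simp add: Complex_eq)
  then have "?g \<in> borel_measurable borel" using ri S by simp
  moreover have "?g x = 0" if "x \<notin> S" for x using that by simp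
  moreover have "AE x in lborel. x \<in> S \<longrightarrow> g x = ?g x"
    using ri(2,4) by eventually_elim (auto simp: complex_eq_iff)
  then have "AE x in lebesgue_on S. g x = ?g x"
    by (subst AE_restrict_space_iff) (auto simp: AE_completion_iff)
  ultimately show ?thesis by (rule that)
qed

lemma AE_lebesgue_on_iff:
  "S \<in> sets borel \<Longrightarrow> (AE x in lebesgue_on S. P x) \<longleftrightarrow> (AE x in lborel. x \<in> S \<longrightarrow> P (x::real))"
  by (subst AE_restrict_space_iff) (auto simp: AE_completion_iff)

text \<open>A measure and its completion give the same integral to functions that are measurable
  before completion. Borel measurability is demanded of the truncation alone, since \<open>g\<close>
  may be arbitrary outside \<open>S\<close>.\<close>

lemma lebesgue_on_iff_lborel:
  fixes g :: "real \<Rightarrow> 'a::{banach,second_countable_topology}"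
  assumes "S \<in> sets borel" and "(\<lambda>x. indicator S x *\<^sub>R g x) \<in> borel_measurable borel"
  shows "integrable (lebesgue_on S) g \<longleftrightarrow> set_integrable lborel S g"
    and "(LINT x|lebesgue_on S. g x) = (LINT x:S|lborel. g x)"
proof -
  have "S \<in> sets lebesgue" using assms(1) by simp
  then show "integrable (lebesgue_on S) g \<longleftrightarrow> set_integrable lborel S g"
    and "(LINT x|lebesgue_on S. g x) = (LINT x:S|lborel. g x)"
    using assms(2)
    by (simp_all add: integrable_restrict_space integral_restrict_space set_integrable_def
        set_lebesgue_integral_def integrable_completion integral_completion)
qed

lemma L2_on_potential:
  assumes "L2_on {0<..<d} q"
  obtains p where "potential d p" "AE x in lebesgue_on {0<..<d}. q x = p x"
proof -
  from assms have q: "q \<in> borel_measurable (lebesgue_on {0<..<d})"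
    "integrable (lebesgue_on {0<..<d}) (\<lambda>x. (norm (q x))\<^sup>2)" by (auto simp: L2_on_def)
  obtain p where p: "p \<in> borel_measurable borel" "\<And>x. x \<notin> {0<..<d} \<Longrightarrow> p x = 0"
    "AE x in lebesgue_on {0<..<d}. q x = p x"
    using lebesgue_on_borel_representative[OF q(1)] by auto
  note [measurable] = p(1)
  have "integrable (lebesgue_on {0<..<d}) (\<lambda>x. (norm (p x))\<^sup>2)"
  proof (rule integrable_cong_AE_imp[OF q(2)])
    have "p \<in> borel_measurable (lebesgue_on {0<..<d})"
      by (intro measurable_restrict_space1 measurable_completion) (use p in simp)
    then show "(\<lambda>x. (norm (p x))\<^sup>2) \<in> borel_measurable (lebesgue_on {0<..<d})" by measurable
    show "AE x in lebesgue_on {0<..<d}. (norm (q x))\<^sup>2 = (norm (p x))\<^sup>2"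
      using p(3) by eventually_elim simp
  qed
  then have "set_integrable lborel {0<..<d} (\<lambda>x. (norm (p x))\<^sup>2)"
    by (subst (asm) lebesgue_on_iff_lborel) auto
  moreover have "(\<lambda>x. indicator {0<..<d} x *\<^sub>R (norm (p x))\<^sup>2) = (\<lambda>x. (norm (p x))\<^sup>2)"
    by (rule ext, rename_tac x, case_tac "x \<in> {0<..<d}") (use p(2) in auto)
  ultimately have "integrable lborel (\<lambda>x. (norm (p x))\<^sup>2)" by (simp add: set_integrable_def)
  then have "potential d p" using p by (auto simp: potential_def)
  then show ?thesis using p(3) by (rule that)
qed

section \<open>Exponential weights for Volterra integrals\<close>

lemma integral_exp_interval:
  fixes s x :: real
  assumes "s > 0" "0 \<le> x"
  shows "(LINT r:{0<..<x}|lborel. exp (s * r)) \<le> exp (s * x) / s"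
    and "set_integrable lborel {0<..<x} (\<lambda>r. exp (s * r))"
proof -
  have D: "((\<lambda>r. exp (s * r) / s) has_real_derivative exp (s * r)) (at r)" for r
    using assms by (auto intro!: derivative_eq_intros)
  have c: "isCont (\<lambda>r. exp (s * r)) r" for r by (intro continuous_intros)
  have "has_bochner_integral lborel (\<lambda>r. exp (s * r) * indicator {0..x} r) (exp (s * x) / s - exp (s * 0) / s)"
    by (rule has_bochner_integral_FTC_Icc_real[OF assms(2) D c])
  then have i: "integrable lborel (\<lambda>r. exp (s * r) * indicator {0..x} r)"
    and e: "(LINT r|lborel. exp (s * r) * indicator {0..x} r) = exp (s * x) / s - 1 / s"
    by (auto simp: has_bochner_integral_iff)
  show si: "set_integrable lborel {0<..<x} (\<lambda>r. exp (s * r))"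
    unfolding set_integrable_def
    by (rule Bochner_Integration.integrable_bound[OF i]) (auto simp: indicator_def)
  have "(LINT r:{0<..<x}|lborel. exp (s * r)) \<le> (LINT r|lborel. exp (s * r) * indicator {0..x} r)"
    unfolding set_lebesgue_integral_def
    by (rule integral_mono[OF si[unfolded set_integrable_def] i]) (auto simp: indicator_def)
  also have "\<dots> \<le> exp (s * x) / s" using e assms by simp
  finally show "(LINT r:{0<..<x}|lborel. exp (s * r)) \<le> exp (s * x) / s" .
qed

lemma set_integrable_mult_exp:
  fixes q :: "real \<Rightarrow> 'a::{banach,second_countable_topology}"
  assumes "integrable lborel q"
  shows "set_integrable lborel {0<..<x} (\<lambda>s. norm (q s) * exp (c * s))"
  unfolding set_integrable_def
proof (rule Bochner_Integration.integrable_bound)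
  show "integrable lborel (\<lambda>s. norm (q s) * exp (\<bar>c\<bar> * \<bar>x\<bar>))" using assms by simp
  show "(\<lambda>s. indicator {0<..<x} s *\<^sub>R (norm (q s) * exp (c * s))) \<in> borel_measurable lborel"
    using assms by simp
  have "exp (c * s) \<le> exp (\<bar>c\<bar> * \<bar>x\<bar>)" if "0 < s" "s < x" for s
    using that by (metis abs_ge_self abs_mult abs_of_pos exp_le_cancel_iff less_imp_le mult_mono order_trans abs_ge_zero)
  then show "AE s in lborel. norm (indicator {0<..<x} s *\<^sub>R (norm (q s) * exp (c * s)))
      \<le> norm (norm (q s) * exp (\<bar>c\<bar> * \<bar>x\<bar>))"
    by (auto simp: indicator_def intro!: mult_left_mono)
qed

text \<open>The weight \<open>exp (\<sigma> x)\<close> makes all Volterra operators below contractions.\<close>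

lemma volterra_weight:
  assumes q: "potential d q" and e: "\<epsilon> > 0"
  obtains c0 where "c0 > 0"
    "\<And>c x. c \<ge> c0 \<Longrightarrow> 0 \<le> x \<Longrightarrow> (LINT s:{0<..<x}|lborel. norm (q s) * exp (c * s)) \<le> \<epsilon> * exp (c * x)"
proof -
  define N where "N = (LINT s|lborel. (norm (q s))\<^sup>2)"
  \<comment> \<open>\<open>K\<close> is so large that
    \<open>N / (2 * K) \<le> \<epsilon> / 2\<close>, and the \<open>+ 1\<close> keeps it positive
    when q = 0. The threshold \<open>K / (2 * \<epsilon>)\<close> for \<open>c\<close> then bounds
    the other half, \<open>K / (4 * c)\<close>.\<close>
  define K where "K = (N + 1) / \<epsilon>"
  have N: "N \<ge> 0" unfolding N_def by simp
  have K: "K > 0" using N e by (simp add: K_def)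
  have "(LINT s:{0<..<x}|lborel. norm (q s) * exp (c * s)) \<le> \<epsilon> * exp (c * x)"
    if c: "c \<ge> K / (2 * \<epsilon>)" and x: "0 \<le> x" for c x
  proof -
    have cp: "c > 0" using c K e by (smt (verit) divide_pos_pos)
    \<comment> \<open>Parameter of a weighted inequality between arithmetic and geometric mean: with
      it both the L2 norm of q and the integral of \<open>exp (2 * c * s)\<close> contribute
      multiples of \<open>exp (c * x)\<close>.\<close>
    define \<delta> where "\<delta> = exp (c * x) / K"
    have d: "\<delta> > 0" using K by (simp add: \<delta>_def)
    have pt: "norm (q s) * exp (c * s) \<le> \<delta> / 2 * (norm (q s))\<^sup>2 + 1 / (2 * \<delta>) * exp (2 * c * s)" for s
    proof -
      have "0 \<le> (\<delta> * norm (q s) - exp (c * s))\<^sup>2" by simp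
      then have "2 * \<delta> * (norm (q s) * exp (c * s)) \<le> \<delta>\<^sup>2 * (norm (q s))\<^sup>2 + (exp (c * s))\<^sup>2"
        by (simp add: power2_eq_square algebra_simps)
      then show ?thesis using d by (simp add: field_simps power2_eq_square exp_add[symmetric])
    qed
    note I1 = set_integrable_mult_exp[OF potential_integrable[OF q], of x c]
    note I2 = integral_exp_interval(2)[of "2 * c" x]
    have I3: "set_integrable lborel {0<..<x} (\<lambda>s. (norm (q s))\<^sup>2)"
      unfolding set_integrable_def using potentialD(1,2)[OF q]
      by (intro integrable_mult_indicator) auto
    have N': "(LINT s:{0<..<x}|lborel. (norm (q s))\<^sup>2) \<le> N"
      unfolding N_def set_lebesgue_integral_def
      by (rule integral_mono[OF I3[unfolded set_integrable_def] potentialD(2)[OF q]])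
        (auto simp: indicator_def)
    have "(LINT s:{0<..<x}|lborel. norm (q s) * exp (c * s))
        \<le> (LINT s:{0<..<x}|lborel. \<delta> / 2 * (norm (q s))\<^sup>2 + 1 / (2 * \<delta>) * exp (2 * c * s))"
      using I1 I2 I3 cp x pt by (intro set_integral_mono set_integral_add set_integrable_mult_right) auto
    also have "\<dots> = \<delta> / 2 * (LINT s:{0<..<x}|lborel. (norm (q s))\<^sup>2)
        + 1 / (2 * \<delta>) * (LINT s:{0<..<x}|lborel. exp (2 * c * s))"
      using I2 I3 cp x by (subst set_integral_add) auto
    also have "\<dots> \<le> \<delta> / 2 * N + 1 / (2 * \<delta>) * (exp (2 * c * x) / (2 * c))"
      using N' integral_exp_interval(1)[of "2 * c" x] cp x d
      by (intro add_mono mult_left_mono) auto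
    also have "\<dots> = exp (c * x) * (N / (2 * K) + K / (4 * c))"
      using K cp by (simp add: \<delta>_def field_simps exp_add[symmetric])
    also have "\<dots> \<le> exp (c * x) * (\<epsilon> / 2 + \<epsilon> / 2)"
    proof (intro mult_left_mono add_mono)
      show "N / (2 * K) \<le> \<epsilon> / 2" using e N by (simp add: K_def field_simps)
      show "K / (4 * c) \<le> \<epsilon> / 2" using c cp e by (simp add: field_simps)
    qed auto
    finally show ?thesis by (simp add: mult.commute)
  qed
  moreover have "K / (2 * \<epsilon>) > 0" using K e by simp
  ultimately show ?thesis by (rule that[rotated])
qed

section \<open>Cosine and sine in the spectral parameter\<close>

lemma has_bochner_integral_FTC_Ioo:
  fixes F f :: "real \<Rightarrow> complex"
  assumes ab: "a \<le> b" and F: "\<And>x. (F has_vector_derivative f x) (at x)" and f: "continuous_on UNIV f"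
  shows "set_integrable lborel {a<..<b} f" "(LINT x:{a<..<b}|lborel. f x) = F b - F a"
proof -
  have [measurable]: "f \<in> borel_measurable borel" using f by (rule borel_measurable_continuous_onI)
  have I: "has_bochner_integral lborel (\<lambda>x. indicator {a..b} x *\<^sub>R f x) (F b - F a)"
    by (rule has_bochner_integral_FTC_Icc[OF ab])
      (use F f in \<open>auto intro: has_vector_derivative_at_within continuous_on_subset\<close>)
  have "AE x in lborel. x \<noteq> a" "AE x in lborel. x \<noteq> b" by (rule AE_lborel_singleton)+
  then have A: "AE x in lborel. indicator {a..b} x *\<^sub>R f x = indicator {a<..<b} x *\<^sub>R f x"
    by eventually_elim (auto simp: indicator_def)
  have "integrable lborel (\<lambda>x. indicator {a..b} x *\<^sub>R f x)" using I by (simp add: has_bochner_integral_iff)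
  then show "set_integrable lborel {a<..<b} f"
    unfolding set_integrable_def by (rule integrable_cong_AE_imp) (use A in \<open>auto elim: eventually_mono\<close>)
  have "(LINT x:{a<..<b}|lborel. f x) = (LINT x|lborel. indicator {a..b} x *\<^sub>R f x)"
    unfolding set_lebesgue_integral_def by (rule integral_cong_AE) (use A in \<open>auto elim: eventually_mono\<close>)
  then show "(LINT x:{a<..<b}|lborel. f x) = F b - F a" using I by (simp add: has_bochner_integral_iff)
qed

definition cosl :: "complex \<Rightarrow> real \<Rightarrow> complex" where
  "cosl lam t = cos (csqrt lam * of_real t)"

text \<open>This is sin(rho t)/rho with its limit at \<open>lam = 0\<close>, so for every
  \<open>lam\<close> it is the primitive of \<open>cosl lam\<close> vanishing at 0.\<close>

definition sinl :: "complex \<Rightarrow> real \<Rightarrow> complex" where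
  "sinl lam t = (if lam = 0 then of_real t else sin (csqrt lam * of_real t) / csqrt lam)"

lemma cosl_0 [simp]: "cosl lam 0 = 1" and sinl_0 [simp]: "sinl lam 0 = 0"
  by (auto simp: cosl_def sinl_def)

lemma cosl_minus [simp]: "cosl lam (- t) = cosl lam t"
  by (simp add: cosl_def)

lemma sinl_minus [simp]: "sinl lam (- t) = - sinl lam t"
  by (simp add: sinl_def)

lemma cosl_has_vector_derivative:
  "(cosl lam has_vector_derivative - lam * sinl lam t) (at t)"
proof -
  have "((\<lambda>z. cos (csqrt lam * z)) has_field_derivative - sin (csqrt lam * of_real t) * csqrt lam) (at (of_real t))"
    by (auto intro!: derivative_eq_intros)
  then have "((\<lambda>t. cos (csqrt lam * of_real t)) has_vector_derivative - sin (csqrt lam * of_real t) * csqrt lam) (at t)"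
    by (rule has_vector_derivative_real_field)
  moreover have "lam * sinl lam t = sin (csqrt lam * of_real t) * csqrt lam"
  proof (cases "lam = 0")
    case False
    have "lam * sinl lam t = (csqrt lam)\<^sup>2 * sinl lam t" by simp
    also have "\<dots> = sin (csqrt lam * of_real t) * csqrt lam"
      using False by (simp add: sinl_def power2_eq_square del: power2_csqrt)
    finally show ?thesis .
  qed (simp add: sinl_def)
  ultimately show ?thesis by (simp add: cosl_def[abs_def])
qed

lemma sinl_has_vector_derivative:
  "(sinl lam has_vector_derivative cosl lam t) (at t)"
proof (cases "lam = 0")
  case True
  have "((\<lambda>z::complex. z) has_field_derivative 1) (at (of_real t))" by (auto intro!: derivative_eq_intros)
  then have "((\<lambda>t. of_real t :: complex) has_vector_derivative 1) (at t)"
    by (rule has_vector_derivative_real_field)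
  then show ?thesis using True by (simp add: cosl_def sinl_def[abs_def])
next
  case False
  have "((\<lambda>z. sin (csqrt lam * z) / csqrt lam) has_field_derivative cos (csqrt lam * of_real t)) (at (of_real t))"
    using False by (auto intro!: derivative_eq_intros)
  then have "((\<lambda>t. sin (csqrt lam * of_real t) / csqrt lam) has_vector_derivative cos (csqrt lam * of_real t)) (at t)"
    by (rule has_vector_derivative_real_field)
  then show ?thesis using False by (simp add: cosl_def sinl_def[abs_def])
qed

lemma continuous_on_cosl [continuous_intros]:
  fixes f :: "'a::t2_space \<Rightarrow> real"
  assumes "continuous_on S f"
  shows "continuous_on S (\<lambda>x. cosl lam (f x))"
proof -
  have "continuous_on S (\<lambda>x. cos (c * of_real (f x)))" for c :: complex
    using assms by (intro continuous_intros)
  then show ?thesis by (simp add: cosl_def)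
qed

lemma continuous_on_sinl [continuous_intros]:
  fixes f :: "'a::t2_space \<Rightarrow> real"
  assumes "continuous_on S f"
  shows "continuous_on S (\<lambda>x. sinl lam (f x))"
proof -
  have "c \<noteq> 0 \<Longrightarrow> continuous_on S (\<lambda>x. sin (c * of_real (f x)) / c)" for c :: complex
    using assms by (intro continuous_intros) auto
  moreover have "continuous_on S (\<lambda>x. of_real (f x) :: complex)"
    using assms by (intro continuous_intros)
  ultimately show ?thesis by (cases "lam = 0") (simp_all add: sinl_def)
qed

lemma borel_measurable_cosl [measurable]: "cosl lam \<in> borel_measurable borel"
  by (rule borel_measurable_continuous_onI) (intro continuous_intros)

lemma borel_measurable_sinl [measurable]: "sinl lam \<in> borel_measurable borel"
  by (rule borel_measurable_continuous_onI) (intro continuous_intros)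

lemma cosl_times_cosl: "cosl lam s * cosl lam t = (cosl lam (s + t) + cosl lam (s - t)) / 2"
  by (simp add: cosl_def algebra_simps cos_add cos_diff)

lemma sinl_times_cosl: "sinl lam r * cosl lam t = (sinl lam (t + r) - sinl lam (t - r)) / 2"
  by (simp add: cosl_def sinl_def algebra_simps sin_add sin_diff diff_divide_distrib add_divide_distrib)

lemma integral_cosl:
  assumes "a \<le> b"
  shows "set_integrable lborel {a<..<b} (cosl lam)"
    and "(LINT t:{a<..<b}|lborel. cosl lam t) = sinl lam b - sinl lam a"
  by (rule has_bochner_integral_FTC_Ioo[OF assms sinl_has_vector_derivative];
      intro continuous_intros)+

lemma integral_sinl:
  assumes "a \<le> b"
  shows "set_integrable lborel {a<..<b} (\<lambda>t. - lam * sinl lam t)"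
    and "(LINT t:{a<..<b}|lborel. - lam * sinl lam t) = cosl lam b - cosl lam a"
  by (rule has_bochner_integral_FTC_Ioo[OF assms cosl_has_vector_derivative];
      intro continuous_intros)+

lemma norm_cos_le_exp: "norm (cos z) \<le> exp (norm (z::complex))"
proof -
  have "norm (cos z) \<le> (norm (exp (\<i> * z)) + norm (exp (- (\<i> * z)))) / 2"
    unfolding cos_exp_eq using norm_triangle_ineq[of "exp (\<i> * z)" "exp (- (\<i> * z))"]
    by (simp add: norm_divide)
  also have "\<dots> \<le> (exp (norm z) + exp (norm z)) / 2"
    using norm_exp[of "\<i> * z"] norm_exp[of "- (\<i> * z)"]
    by (intro divide_right_mono add_mono) (simp_all add: norm_mult del: norm_exp_eq_Re)
  finally show ?thesis by simp
qed

lemma norm_csqrt: "norm (csqrt z) = sqrt (norm z)"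
proof -
  have "(norm (csqrt z))\<^sup>2 = norm z" by (metis norm_power power2_csqrt)
  then show ?thesis by (metis norm_ge_zero real_sqrt_unique)
qed

text \<open>Uniform for \<open>lam\<close> in a disc, which supplies the majorants for integrals
  depending holomorphically on \<open>lam\<close>.\<close>

lemma norm_cosl_le:
  assumes "norm lam \<le> R" "\<bar>t\<bar> \<le> d"
  shows "norm (cosl lam t) \<le> exp (sqrt R * d)"
proof -
  have "0 \<le> R" using assms(1) norm_ge_zero order_trans by blast
  have "norm (csqrt lam * of_real t) \<le> sqrt R * d"
    using assms \<open>0 \<le> R\<close> by (simp add: norm_mult norm_csqrt mult_mono)
  then show ?thesis unfolding cosl_def using norm_cos_le_exp[of "csqrt lam * of_real t"]
    by (smt (verit) exp_le_cancel_iff)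
qed

text \<open>\<open>csqrt\<close> jumps across the negative axis, but near that axis
  \<open>\<i> * csqrt (- lam)\<close> is a holomorphic square root of \<open>lam\<close>, and the
  even cosine does not distinguish the two roots. The remaining point 0 is removable by
  continuity.\<close>

lemma holomorphic_cosl [holomorphic_intros]: "(\<lambda>lam. cosl lam t) holomorphic_on S"
proof -
  have nz: "(\<lambda>lam. cosl lam t) field_differentiable at z" if z: "z \<noteq> 0" for z
  proof (cases "z \<in> \<real>\<^sub>\<le>\<^sub>0")
    case True
    then have "- z \<notin> \<real>\<^sub>\<le>\<^sub>0" using z
      by (auto simp: complex_nonpos_Reals_iff complex_eq_iff)
    then have "((\<lambda>lam. cos (\<i> * csqrt (- lam) * of_real t)) has_field_derivative
        - sin (\<i> * csqrt (- z) * of_real t) * (\<i> * (inverse (2 * csqrt (- z)) * -1) * of_real t)) (at z)"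
      by (auto intro!: derivative_eq_intros simp: field_simps)
    moreover have "cos (\<i> * csqrt (- lam) * of_real t) = cosl lam t" for lam
    proof -
      have "(\<i> * csqrt (- lam))\<^sup>2 = (csqrt lam)\<^sup>2" by (simp add: power_mult_distrib)
      then have "\<i> * csqrt (- lam) = csqrt lam \<or> \<i> * csqrt (- lam) = - csqrt lam"
        by (simp only: power2_eq_iff)
      then show ?thesis by (auto simp: cosl_def)
    qed
    ultimately show ?thesis by (auto simp: field_differentiable_def)
  next
    case False
    then have "((\<lambda>lam. cos (csqrt lam * of_real t)) has_field_derivative
        - sin (csqrt z * of_real t) * (inverse (2 * csqrt z) * of_real t)) (at z)"
      by (auto intro!: derivative_eq_intros simp: field_simps)
    then show ?thesis unfolding cosl_def by (auto simp: field_differentiable_def)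
  qed
  have "(\<lambda>lam. cosl lam t) holomorphic_on UNIV"
  proof (rule no_isolated_singularity[where K = "{0}"])
    have "isCont (\<lambda>lam. cosl lam t) 0"
    proof -
      have "(csqrt \<longlongrightarrow> 0) (at 0)"
      proof (rule tendsto_norm_zero_cancel)
        have "((\<lambda>x::complex. sqrt (norm x)) \<longlongrightarrow> sqrt (norm (0::complex))) (at 0)" by (intro tendsto_intros)
        then show "((\<lambda>x. norm (csqrt x)) \<longlongrightarrow> 0) (at 0)" by (simp add: norm_csqrt)
      qed
      then have "((\<lambda>lam. cos (csqrt lam * of_real t)) \<longlongrightarrow> cos (0 * of_real t)) (at 0)"
        by (rule tendsto_cos[OF tendsto_mult_right])
      then show ?thesis by (simp add: isCont_def cosl_def)
    qed
    then show "continuous_on UNIV (\<lambda>lam. cosl lam t)"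
      using field_differentiable_imp_continuous_at[OF nz]
      by (intro continuous_at_imp_continuous_on) metis
    show "(\<lambda>lam. cosl lam t) holomorphic_on UNIV - {0}"
      unfolding holomorphic_on_def using nz by (auto intro: field_differentiable_at_within)
  qed auto
  then show ?thesis by (rule holomorphic_on_subset) simp
qed

section \<open>The transmutation kernel\<close>

lemma (in pair_sigma_finite) integrable_mult_product:
  fixes f :: "'a \<Rightarrow> 'c::{real_normed_field,banach,second_countable_topology}"
  assumes f: "integrable M1 f" and g: "integrable M2 g"
  shows "integrable (M1 \<Otimes>\<^sub>M M2) (\<lambda>(x, y). f x * g y)"
proof (rule Fubini_integrable)
  have [measurable]: "f \<in> borel_measurable M1" "g \<in> borel_measurable M2" using f g by auto
  show "(\<lambda>(x, y). f x * g y) \<in> borel_measurable (M1 \<Otimes>\<^sub>M M2)" by measurable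
  show "integrable M1 (\<lambda>x. LINT y|M2. norm (case (x, y) of (x, y) \<Rightarrow> f x * g y))"
    using f by (simp add: norm_mult)
  show "AE x in M1. integrable M2 (\<lambda>y. case (x, y) of (x, y) \<Rightarrow> f x * g y)"
    using g by simp
qed

lemma (in pair_sigma_finite) integral_mult_product:
  fixes f :: "'a \<Rightarrow> 'c::{real_normed_field,banach,second_countable_topology}"
  assumes f: "integrable M1 f" and g: "integrable M2 g"
  shows "(LINT z|(M1 \<Otimes>\<^sub>M M2). f (fst z) * g (snd z)) = (LINT x|M1. f x) * (LINT y|M2. g y)"
  using integral_fst'[OF integrable_mult_product[OF f g]] by (simp add: split_def)

text \<open>With p = (x, t) and w = (s, r), sin(rho (x - s))/rho times cos(rho r) is half the
  integral of cos(rho t) over |t - r| < x - s. So this is the Volterra operator of the variation of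
  constants formula, acting on densities; the domain of integration is the backward light cone of
  (x, t).\<close>

definition volterra_op :: "(real \<Rightarrow> complex) \<Rightarrow> (real \<times> real \<Rightarrow> complex) \<Rightarrow> real \<times> real \<Rightarrow> complex" where
  "volterra_op q f p = (LINT w|(lborel \<Otimes>\<^sub>M lborel).
     (if \<bar>snd p - snd w\<bar> < fst p - fst w then q (fst w) * f w else 0)) / 2"

text \<open>The plateau is the density of \<open>v * sinl lam x\<close>. The integral is the first
  Volterra iterate of \<open>u * cosl\<close>, obtained from the operator by placing an atom of
  weight \<open>u\<close> at t = s.\<close>

definition volterra_start :: "(real \<Rightarrow> complex) \<Rightarrow> complex \<Rightarrow> complex \<Rightarrow> real \<times> real \<Rightarrow> complex" where
  "volterra_start q u v p = (if \<bar>snd p\<bar> < fst p then v / 2 else 0) +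
     (LINT s|lborel. (if \<bar>snd p - s\<bar> < fst p - s then u * q s else 0)) / 2"

text \<open>The space of the fixed point argument: a weighted sup norm together with finite
  propagation speed, the support in |t| < x.\<close>

definition kernel_bound :: "real \<Rightarrow> real \<Rightarrow> (real \<times> real \<Rightarrow> complex) \<Rightarrow> bool" where
  "kernel_bound B c f \<longleftrightarrow> f \<in> borel_measurable (borel \<Otimes>\<^sub>M borel) \<and>
     (\<forall>x t. norm (f (x, t)) \<le> B * exp (c * x)) \<and> (\<forall>x t. x \<le> \<bar>t\<bar> \<longrightarrow> f (x, t) = 0)"

lemma kernel_boundD:
  assumes "kernel_bound B c f"
  shows "f \<in> borel_measurable (borel \<Otimes>\<^sub>M borel)" "norm (f p) \<le> B * exp (c * fst p)"
    "fst p \<le> \<bar>snd p\<bar> \<Longrightarrow> f p = 0" "norm (f (x, t)) \<le> B * exp (c * x)"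
    "x \<le> \<bar>t\<bar> \<Longrightarrow> f (x, t) = 0" "B \<ge> 0"
proof -
  show "f \<in> borel_measurable (borel \<Otimes>\<^sub>M borel)" "norm (f p) \<le> B * exp (c * fst p)"
    "fst p \<le> \<bar>snd p\<bar> \<Longrightarrow> f p = 0" "norm (f (x, t)) \<le> B * exp (c * x)"
    "x \<le> \<bar>t\<bar> \<Longrightarrow> f (x, t) = 0"
    using assms by (cases p; simp add: kernel_bound_def)+
  have "norm (f (0, 0)) \<le> B * exp (c * 0)" using assms unfolding kernel_bound_def by blast
  then show "B \<ge> 0" using norm_ge_zero[of "f (0, 0)"] by (simp del: norm_ge_zero)
qed

text \<open>An integrable majorant independent of t: the potential vanishes for s >= d and kernels
  vanish outside |r| < s, so the second variable may be confined to (-d, d).\<close>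

definition volterra_dom :: "real \<Rightarrow> (real \<Rightarrow> complex) \<Rightarrow> real \<Rightarrow> real \<Rightarrow> real \<times> real \<Rightarrow> real" where
  "volterra_dom d q c x w =
     (indicator {0<..<x} (fst w) *\<^sub>R (norm (q (fst w)) * exp (c * fst w))) * indicator {-d<..<d} (snd w)"

lemma volterra_dom:
  assumes q: "potential d q" and d: "d > 0"
  shows "integrable (lborel \<Otimes>\<^sub>M lborel) (volterra_dom d q c x)"
    and "(LINT w|(lborel \<Otimes>\<^sub>M lborel). volterra_dom d q c x w)
      = 2 * d * (LINT s:{0<..<x}|lborel. norm (q s) * exp (c * s))"
proof -
  note i = set_integrable_mult_exp[OF potential_integrable[OF q], of x c, unfolded set_integrable_def]
  show "integrable (lborel \<Otimes>\<^sub>M lborel) (volterra_dom d q c x)"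
    using lborel_pair.integrable_mult_product[OF i integrable_indicator_interval[of "-d" d]]
    by (simp add: volterra_dom_def[abs_def] split_def)
  show "(LINT w|(lborel \<Otimes>\<^sub>M lborel). volterra_dom d q c x w)
      = 2 * d * (LINT s:{0<..<x}|lborel. norm (q s) * exp (c * s))"
    using lborel_pair.integral_mult_product[OF i integrable_indicator_interval[of "-d" d]] d
    by (simp add: volterra_dom_def[abs_def] set_lebesgue_integral_def)
qed

lemma volterra_integrand_le:
  assumes q: "potential d q" and f: "kernel_bound B c f"
  shows "norm (if \<bar>t - snd w\<bar> < x - fst w then q (fst w) * f w else 0) \<le> B * volterra_dom d q c x w"
proof (cases "\<bar>t - snd w\<bar> < x - fst w \<and> q (fst w) \<noteq> 0 \<and> f w \<noteq> 0")
  case True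
  then have "0 < fst w" "fst w < d" "fst w < x" "\<bar>snd w\<bar> < fst w"
    using potentialD(4,5)[OF q, of "fst w"] kernel_boundD(3)[OF f, of w] by fastforce+
  then have "snd w \<in> {-d<..<d}" by auto
  with \<open>0 < fst w\<close> \<open>fst w < x\<close> show ?thesis
    using True kernel_boundD(2)[OF f, of w] mult_left_mono[of "norm (f w)" "B * exp (c * fst w)" "norm (q (fst w))"]
    by (auto simp: volterra_dom_def norm_mult mult_ac)
next
  case False
  then show ?thesis using kernel_boundD(6)[OF f] by (auto simp: volterra_dom_def)
qed

lemma volterra_integrand_measurable:
  fixes q :: "real \<Rightarrow> complex" and f :: "real \<times> real \<Rightarrow> complex"
  assumes [measurable]: "q \<in> borel_measurable borel" "f \<in> borel_measurable (borel \<Otimes>\<^sub>M borel)"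
  shows "(\<lambda>w. if \<bar>t - snd w\<bar> < x - fst w then q (fst w) * f w else 0) \<in> borel_measurable (lborel \<Otimes>\<^sub>M lborel)"
  by measurable

lemma volterra_integrand_integrable:
  assumes q: "potential d q" and d: "d > 0" and f: "kernel_bound B c f"
  shows "integrable (lborel \<Otimes>\<^sub>M lborel) (\<lambda>w. if \<bar>t - snd w\<bar> < x - fst w then q (fst w) * f w else 0)"
proof (rule integrable_norm_bound)
  show "integrable (lborel \<Otimes>\<^sub>M lborel) (\<lambda>w. B * volterra_dom d q c x w)"
    using volterra_dom(1)[OF q d] by simp
  show "norm (if \<bar>t - snd w\<bar> < x - fst w then q (fst w) * f w else 0) \<le> B * volterra_dom d q c x w" for w
    by (rule volterra_integrand_le[OF q f])
qed (rule volterra_integrand_measurable[OF potentialD(1)[OF q] kernel_boundD(1)[OF f]])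

lemma volterra_op_measurable:
  assumes [measurable]: "q \<in> borel_measurable borel" "f \<in> borel_measurable (borel \<Otimes>\<^sub>M borel)"
  shows "volterra_op q f \<in> borel_measurable (borel \<Otimes>\<^sub>M borel)"
proof -
  interpret sigma_finite_measure "lborel \<Otimes>\<^sub>M lborel :: (real \<times> real) measure" 
    unfolding lborel_prod by (rule lborel.sigma_finite_measure_axioms)
  show ?thesis unfolding volterra_op_def[abs_def] by measurable
qed

text \<open>The strip (-d, d) contributes a factor 2d, which the hypothesis on the weight cancels;
  the 1/2 in \<open>volterra_op\<close> remains as contraction constant. The cone is preserved
  because |t - r| < x - s and |r| < s give |t| < x.\<close>

lemma volterra_op_bound:
  assumes q: "potential d q" and d: "d > 0" and f: "kernel_bound B c f"
    and w: "\<And>x. 0 \<le> x \<Longrightarrow> (LINT s:{0<..<x}|lborel. norm (q s) * exp (c * s)) \<le> 1 / (2 * d) * exp (c * x)"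
  shows "kernel_bound (B / 2) c (volterra_op q f)"
  unfolding kernel_bound_def
proof (intro conjI allI impI)
  show "volterra_op q f \<in> borel_measurable (borel \<Otimes>\<^sub>M borel)"
    by (rule volterra_op_measurable[OF potentialD(1)[OF q] kernel_boundD(1)[OF f]])
  show z: "volterra_op q f (x, t) = 0" if "x \<le> \<bar>t\<bar>" for x t
  proof -
    have "(if \<bar>t - snd w\<bar> < x - fst w then q (fst w) * f w else 0) = 0" for w
      using that kernel_boundD(3)[OF f, of w] by auto
    then show ?thesis by (simp add: volterra_op_def)
  qed
  show "norm (volterra_op q f (x, t)) \<le> B / 2 * exp (c * x)" for x t
  proof (cases "x \<le> 0")
    case True
    then show ?thesis using z[of x t] kernel_boundD(6)[OF f] by simp
  next
    case False
    have "norm (LINT w|(lborel \<Otimes>\<^sub>M lborel). (if \<bar>t - snd w\<bar> < x - fst w then q (fst w) * f w else 0))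
      \<le> (LINT w|(lborel \<Otimes>\<^sub>M lborel). B * volterra_dom d q c x w)"
      using volterra_dom(1)[OF q d] volterra_integrand_le[OF q f]
      by (intro Bochner_Integration.integral_norm_bound_integral volterra_integrand_integrable[OF q d f] AE_I2 integrable_mult_right) auto
    also have "\<dots> = B * (2 * d * (LINT s:{0<..<x}|lborel. norm (q s) * exp (c * s)))"
      by (simp add: volterra_dom(2)[OF q d])
    also have "\<dots> \<le> B * (2 * d * (1 / (2 * d) * exp (c * x)))"
      using False d kernel_boundD(6)[OF f] w[of x] by (intro mult_left_mono) auto
    also have "\<dots> = B * exp (c * x)" using d by simp
    finally show ?thesis by (simp add: volterra_op_def norm_divide)
  qed
qed

lemma volterra_start_bound:
  assumes q: "potential d q" and c: "c \<ge> 0"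
  obtains B where "kernel_bound B c (volterra_start q u v)"
proof
  note [measurable] = potentialD(1)[OF q]
  let ?B = "norm v / 2 + (LINT s|lborel. norm (u * q s)) / 2"
  have B: "?B \<ge> 0" by simp
  show "kernel_bound ?B c (volterra_start q u v)"
    unfolding kernel_bound_def
  proof (intro conjI allI impI)
    show "volterra_start q u v \<in> borel_measurable (borel \<Otimes>\<^sub>M borel)"
      unfolding volterra_start_def[abs_def] by measurable
    show z: "volterra_start q u v (x, t) = 0" if "x \<le> \<bar>t\<bar>" for x t
    proof -
      have "(if \<bar>t - s\<bar> < x - s then u * q s else 0) = 0" for s
        using that potentialD(4)[OF q, of s] by auto
      then show ?thesis using that by (simp add: volterra_start_def)
    qed
    show "norm (volterra_start q u v (x, t)) \<le> ?B * exp (c * x)" for x t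
    proof (cases "x \<le> 0")
      case True
      then show ?thesis using z[of x t] B by simp
    next
      case False
      have "norm (LINT s|lborel. (if \<bar>t - s\<bar> < x - s then u * q s else 0)) \<le> (LINT s|lborel. norm (u * q s))"
      proof (rule Bochner_Integration.integral_norm_bound_integral)
        show i: "integrable lborel (\<lambda>s. norm (u * q s))" using potential_integrable[OF q] by simp
        show "integrable lborel (\<lambda>s. if \<bar>t - s\<bar> < x - s then u * q s else 0)"
          by (rule Bochner_Integration.integrable_bound[OF i]) auto
      qed auto
      then have "norm (volterra_start q u v (x, t)) \<le> ?B"
        unfolding volterra_start_def
        by (intro norm_triangle_le add_mono) (auto simp: norm_divide)
      also have "?B \<le> ?B * exp (c * x)"
        using mult_left_mono[OF _ B, of 1 "exp (c * x)"] c False by simp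
      finally show ?thesis .
    qed
  qed
qed

definition transmutation_kernel :: "(real \<Rightarrow> complex) \<Rightarrow> complex \<Rightarrow> complex \<Rightarrow> (real \<times> real \<Rightarrow> complex) \<Rightarrow> bool" where
  "transmutation_kernel q u v F \<longleftrightarrow> (\<exists>B c. c \<ge> 0 \<and> kernel_bound B c F) \<and>
     (\<forall>p. F p = volterra_start q u v p + volterra_op q F p)"

text \<open>Neumann series: the iterates decay like (1/2)^k in the weighted norm, so the sum has
  bound \<open>2 * B\<close>, and the majorant \<open>volterra_dom\<close> permits exchanging the
  sum with the operator.\<close>

lemma transmutation_kernel_exists:
  assumes q: "potential d q" and d: "d > 0"
  obtains F where "transmutation_kernel q u v F"
proof -
  obtain c0 where c0: "c0 > 0"
    "\<And>c x. c \<ge> c0 \<Longrightarrow> 0 \<le> x \<Longrightarrow> (LINT s:{0<..<x}|lborel. norm (q s) * exp (c * s)) \<le> 1 / (2 * d) * exp (c * x)"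
    using volterra_weight[OF q, of "1 / (2 * d)"] d by auto
  obtain B where B: "kernel_bound B c0 (volterra_start q u v)"
    using volterra_start_bound[OF q] c0(1) by (metis less_imp_le)
  define f where "f k = (volterra_op q ^^ k) (volterra_start q u v)" for k
  have f: "kernel_bound (B * (1/2) ^ k) c0 (f k)" for k
  proof (induction k)
    case (Suc k)
    have "kernel_bound (B * (1/2) ^ k / 2) c0 (volterra_op q (f k))"
      by (rule volterra_op_bound[OF q d Suc]) (use c0(2) in simp)
    then show ?case by (simp add: f_def)
  qed (use B in \<open>simp add: f_def\<close>)
  have fs: "norm (f k p) \<le> B * exp (c0 * fst p) * (1/2) ^ k" for k p
    using kernel_boundD(2)[OF f, of k p] by (simp add: mult_ac)
  have gs: "summable (\<lambda>k. B * exp (c0 * fst p) * (1/2) ^ k)" for p :: "real \<times> real"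
    by (intro summable_mult summable_geometric) auto
  have sn: "summable (\<lambda>k. norm (f k p))" for p
    by (rule summable_comparison_test'[OF gs[of p], of 0]) (use fs in auto)
  then have s: "summable (\<lambda>k. f k p)" for p by (rule summable_norm_cancel)
  define F where "F p = (\<Sum>k. f k p)" for p
  have F: "kernel_bound (2 * B) c0 F"
    unfolding kernel_bound_def
  proof (intro conjI allI impI)
    have [measurable]: "f k \<in> borel_measurable (borel \<Otimes>\<^sub>M borel)" for k using kernel_boundD(1)[OF f] .
    show "F \<in> borel_measurable (borel \<Otimes>\<^sub>M borel)" unfolding F_def[abs_def] by measurable
    show "norm (F (x, t)) \<le> 2 * B * exp (c0 * x)" for x t
    proof -
      have "norm (F (x, t)) \<le> (\<Sum>k. norm (f k (x, t)))" unfolding F_def by (rule summable_norm[OF sn])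
      also have "\<dots> \<le> (\<Sum>k. B * exp (c0 * fst (x, t)) * (1/2) ^ k)"
        by (rule suminf_le[OF fs sn gs])
      also have "\<dots> = 2 * B * exp (c0 * x)"
        by (subst suminf_mult) (auto simp: suminf_geometric summable_geometric)
      finally show ?thesis .
    qed
    show "F (x, t) = 0" if "x \<le> \<bar>t\<bar>" for x t
      using kernel_boundD(5)[OF f that] by (simp add: F_def)
  qed
  have "F p = volterra_start q u v p + volterra_op q F p" for p
  proof -
    let ?g = "\<lambda>k w. if \<bar>snd p - snd w\<bar> < fst p - fst w then q (fst w) * f k w else 0"
    let ?D = "\<lambda>w. volterra_dom d q c0 (fst p) w"
    have gi: "integrable (lborel \<Otimes>\<^sub>M lborel) (?g k)" for k
      by (rule volterra_integrand_integrable[OF q d f])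
    have gD: "norm (?g k w) \<le> B * (1/2) ^ k * ?D w" for k w
      by (rule volterra_integrand_le[OF q f])
    have "(\<lambda>k. LINT w|(lborel \<Otimes>\<^sub>M lborel). ?g k w) sums (LINT w|(lborel \<Otimes>\<^sub>M lborel). (\<Sum>k. ?g k w))"
    proof (rule sums_integral[OF gi])
      have "summable (\<lambda>k. norm (?g k w))" for w
        by (rule summable_comparison_test'[of "\<lambda>k. B * (1/2) ^ k * ?D w" 0])
          (use gD in \<open>auto intro!: summable_mult summable_mult2 summable_geometric\<close>)
      then show "AE w in lborel \<Otimes>\<^sub>M lborel. summable (\<lambda>k. norm (?g k w))" by simp
      have "(LINT w|(lborel \<Otimes>\<^sub>M lborel). norm (?g k w)) \<le> (LINT w|(lborel \<Otimes>\<^sub>M lborel). B * (1/2) ^ k * ?D w)" for k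
        by (rule integral_mono) (use gi gD volterra_dom(1)[OF q d] in auto)
      then have le: "(LINT w|(lborel \<Otimes>\<^sub>M lborel). norm (?g k w)) \<le> B * (1/2) ^ k * (LINT w|(lborel \<Otimes>\<^sub>M lborel). ?D w)" for k
        by simp
      show "summable (\<lambda>k. LINT w|(lborel \<Otimes>\<^sub>M lborel). norm (?g k w))"
        by (rule summable_comparison_test'[of "\<lambda>k. B * (1/2) ^ k * (LINT w|(lborel \<Otimes>\<^sub>M lborel). ?D w)" 0])
          (use le in \<open>auto intro!: summable_mult summable_mult2 summable_geometric\<close>)
    qed
    moreover have "(\<Sum>k. ?g k w) = (if \<bar>snd p - snd w\<bar> < fst p - fst w then q (fst w) * F w else 0)" for w
      by (simp add: F_def suminf_mult[OF s])
    ultimately have "(\<lambda>k. (LINT w|(lborel \<Otimes>\<^sub>M lborel). ?g k w) / 2) sums volterra_op q F p"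
      unfolding volterra_op_def by (auto intro: sums_divide)
    moreover have "f (Suc k) p = (LINT w|(lborel \<Otimes>\<^sub>M lborel). ?g k w) / 2" for k
      by (simp only: f_def funpow.simps o_apply) (simp only: volterra_op_def)
    ultimately have "(\<lambda>k. f (Suc k) p) sums volterra_op q F p" by presburger
    then have "(\<lambda>k. f k p) sums (volterra_op q F p + f 0 p)" by (rule sums_Suc)
    then show ?thesis by (simp add: F_def f_def sums_iff)
  qed
  then show ?thesis using F c0(1) that[of F] unfolding transmutation_kernel_def by (metis less_imp_le)
qed

section \<open>From the kernel to the variation of constants formula\<close>

lemma norm_sinl_le:
  assumes "norm lam \<le> R" "\<bar>t\<bar> \<le> d"
  shows "norm (sinl lam t) \<le> d * exp (sqrt R * d)"
proof -
  have *: "norm (sinl lam t) \<le> d * exp (sqrt R * d)" if t: "0 \<le> t" "t \<le> d" for t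
  proof -
    have i: "integrable lborel (\<lambda>s. indicator {0<..<t} s *\<^sub>R cosl lam s)"
      using integral_cosl(1)[OF t(1)] by (simp add: set_integrable_def)
    \<comment> \<open>Estimating \<open>sinl\<close> as an integral of \<open>cosl\<close> avoids
      dividing by a small square root and covers \<open>lam = 0\<close>.\<close>
    have "norm (sinl lam t) = norm (LINT s|lborel. indicator {0<..<t} s *\<^sub>R cosl lam s)"
      using integral_cosl(2)[OF t(1), of lam] by (simp add: set_lebesgue_integral_def)
    also have "\<dots> \<le> (LINT s|lborel. exp (sqrt R * d) * indicator {0<..<t} s)"
    proof (rule Bochner_Integration.integral_norm_bound_integral[OF i])
      show "norm (indicator {0<..<t} s *\<^sub>R cosl lam s) \<le> exp (sqrt R * d) * indicator {0<..<t} s" for s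
        using norm_cosl_le[OF assms(1), of s d] t by (auto simp: indicator_def)
    qed simp
    also have "\<dots> = t * exp (sqrt R * d)" using t by simp
    also have "\<dots> \<le> d * exp (sqrt R * d)" using t by simp
    finally show ?thesis .
  qed
  show ?thesis
  proof (cases "0 \<le> t")
    case False
    then show ?thesis using *[of "-t"] assms(2) by simp
  qed (use * assms(2) in auto)
qed

text \<open>The integral over \<open>t\<close> of \<open>cosl\<close> on a window of centre \<open>\<sigma> w\<close> and radius \<open>r w\<close> is a
  product, which turns kernels of the form below into the variation of constants formula.\<close>

lemma (in sigma_finite_measure) integral_window_cosl:
  fixes g :: "'a \<Rightarrow> complex" and \<sigma> r :: "'a \<Rightarrow> real"
  assumes g: "integrable M g" and [measurable]: "\<sigma> \<in> borel_measurable M" "r \<in> borel_measurable M"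
    and R: "\<And>w. g w \<noteq> 0 \<Longrightarrow> \<bar>\<sigma> w\<bar> + \<bar>r w\<bar> \<le> R"
  shows "(LINT t|lborel. (LINT w|M. (if \<bar>t - \<sigma> w\<bar> < r w then g w else 0)) / 2 * cosl lam t)
    = (LINT w|M. (if 0 < r w then g w * (sinl lam (r w) * cosl lam (\<sigma> w)) else 0))"
proof -
  interpret pair_sigma_finite M lborel ..
  have [measurable]: "g \<in> borel_measurable M" using g by simp
  let ?h = "\<lambda>w t. if \<bar>t - \<sigma> w\<bar> < r w then g w * cosl lam t else 0"
  \<comment> \<open>Every window on which the integrand is nonzero lies in (-R, R), where the cosine
    is at most \<open>?E\<close>; this gives the majorant for Fubini.\<close>
  let ?E = "exp (sqrt (norm lam) * R)"
  have "integrable (M \<Otimes>\<^sub>M lborel) (\<lambda>(w, t). norm (g w) * (?E * indicator {-R<..<R} t))"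
    using g by (intro integrable_mult_product) auto
  then have hi: "integrable (M \<Otimes>\<^sub>M lborel) (\<lambda>(w, t). ?h w t)"
  proof (rule integrable_norm_bound)
    have "norm (?h w t) \<le> norm (g w) * (?E * indicator {-R<..<R} t)" for w t
    proof (cases "\<bar>t - \<sigma> w\<bar> < r w \<and> g w \<noteq> 0")
      case True
      then have "\<bar>t\<bar> < R" using R[of w] by auto
      then have "t \<in> {-R<..<R}" "\<bar>t\<bar> \<le> R" by auto
      then show ?thesis using norm_cosl_le[of lam "norm lam" t R]
        by (simp add: norm_mult mult_left_mono)
    qed auto
    then show "norm (case z of (w, t) \<Rightarrow> ?h w t)
         \<le> (case z of (w, t) \<Rightarrow> norm (g w) * (?E * indicator {-R<..<R} t))" for z
      by (cases z) (simp only: prod.case)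
  qed measurable
  have inner: "(LINT t|lborel. ?h w t / 2) = (if 0 < r w then g w * (sinl lam (r w) * cosl lam (\<sigma> w)) else 0)" for w
  proof (cases "0 < r w")
    case True
    have "(LINT t|lborel. ?h w t / 2) = (LINT t:{\<sigma> w - r w<..<\<sigma> w + r w}|lborel. g w / 2 * cosl lam t)"
      unfolding set_lebesgue_integral_def by (intro Bochner_Integration.integral_cong) (auto simp: indicator_def)
    also have "\<dots> = g w / 2 * (sinl lam (\<sigma> w + r w) - sinl lam (\<sigma> w - r w))"
      using integral_cosl(2)[of "\<sigma> w - r w" "\<sigma> w + r w" lam] True by (simp only: set_integral_mult_right)
    also have "\<dots> = g w * (sinl lam (r w) * cosl lam (\<sigma> w))" by (simp add: sinl_times_cosl)
    finally show ?thesis using True by simp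
  next
    case False
    then have "\<not> \<bar>t - \<sigma> w\<bar> < r w" for t by auto
    then show ?thesis using False by simp
  qed
  have "(LINT t|lborel. (LINT w|M. (if \<bar>t - \<sigma> w\<bar> < r w then g w else 0)) / 2 * cosl lam t)
     = (LINT t|lborel. (LINT w|M. ?h w t / 2))"
  proof (intro Bochner_Integration.integral_cong refl)
    fix t
    have "?h w t / 2 = (if \<bar>t - \<sigma> w\<bar> < r w then g w else 0) * (cosl lam t / 2)" for w by simp
    then show "(LINT w|M. (if \<bar>t - \<sigma> w\<bar> < r w then g w else 0)) / 2 * cosl lam t = (LINT w|M. ?h w t / 2)"
      by (simp only: integral_mult_left_zero) simp
  qed
  also have "\<dots> = (LINT w|M. (LINT t|lborel. ?h w t / 2))"
    using hi by (intro Fubini_integral) (simp add: split_def)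
  finally show ?thesis by (simp only: inner)
qed

lemma sigma_finite_lborel_pair: "sigma_finite_measure (lborel \<Otimes>\<^sub>M lborel :: (real \<times> real) measure)"
  unfolding lborel_prod by (rule lborel.sigma_finite_measure_axioms)

lemma kernel_cosl_integrable:
  assumes F: "kernel_bound B c F"
  shows "integrable lborel (\<lambda>t. F (x, t) * cosl lam t)"
    and "norm (LINT t|lborel. F (x, t) * cosl lam t) \<le> 2 * B * exp (c * x) * \<bar>x\<bar> * exp (sqrt (norm lam) * \<bar>x\<bar>)"
proof -
  note [measurable] = kernel_boundD(1)[OF F]
  let ?E = "B * exp (c * x) * exp (sqrt (norm lam) * \<bar>x\<bar>)"
  have i: "integrable lborel (\<lambda>t. ?E * indicator {-\<bar>x\<bar><..<\<bar>x\<bar>} t)" by simp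
  have b: "norm (F (x, t) * cosl lam t) \<le> ?E * indicator {-\<bar>x\<bar><..<\<bar>x\<bar>} t" for t
  proof (cases "\<bar>t\<bar> < x")
    case True
    then have "t \<in> {-\<bar>x\<bar><..<\<bar>x\<bar>}" "\<bar>t\<bar> \<le> \<bar>x\<bar>" by auto
    then show ?thesis
      using kernel_boundD(4)[OF F, of x t] norm_cosl_le[of lam "norm lam" t "\<bar>x\<bar>"] kernel_boundD(6)[OF F]
      by (simp add: norm_mult mult_mono)
  next
    case False
    then show ?thesis using kernel_boundD(5,6)[OF F] by simp
  qed
  show i2: "integrable lborel (\<lambda>t. F (x, t) * cosl lam t)"
    by (rule integrable_norm_bound[OF i _ b]) measurable
  have "norm (LINT t|lborel. F (x, t) * cosl lam t) \<le> (LINT t|lborel. ?E * indicator {-\<bar>x\<bar><..<\<bar>x\<bar>} t)"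
    by (rule Bochner_Integration.integral_norm_bound_integral[OF i2 i b])
  then show "norm (LINT t|lborel. F (x, t) * cosl lam t) \<le> 2 * B * exp (c * x) * \<bar>x\<bar> * exp (sqrt (norm lam) * \<bar>x\<bar>)"
    by (simp add: mult_ac)
qed

definition kernel_sol :: "complex \<Rightarrow> (real \<times> real \<Rightarrow> complex) \<Rightarrow> complex \<Rightarrow> real \<Rightarrow> complex" where
  "kernel_sol u F lam x = u * cosl lam x + (LINT t|lborel. F (x, t) * cosl lam t)"

lemma kernel_sol_measurable:
  assumes "kernel_bound B c F"
  shows "kernel_sol u F lam \<in> borel_measurable borel"
proof -
  note [measurable] = kernel_boundD(1)[OF assms]
  show ?thesis unfolding kernel_sol_def[abs_def] by measurable
qed

lemma kernel_sol_bound: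
  assumes F: "kernel_bound B c F" and c: "c \<ge> 0" and x: "0 \<le> x" "x \<le> d" and R: "norm lam \<le> R"
  shows "norm (kernel_sol u F lam x) \<le> (norm u + 2 * B * exp (c * d) * d) * exp (sqrt R * d)"
proof -
  have B: "B \<ge> 0" by (rule kernel_boundD(6)[OF F])
  have R0: "R \<ge> 0" using R norm_ge_zero order_trans by blast
  have "norm (kernel_sol u F lam x) \<le> norm u * exp (sqrt R * d)
      + 2 * B * exp (c * x) * \<bar>x\<bar> * exp (sqrt (norm lam) * \<bar>x\<bar>)"
    unfolding kernel_sol_def
    using kernel_cosl_integrable(2)[OF F, of x lam] norm_cosl_le[OF R, of x d] x
    by (intro norm_triangle_le add_mono) (auto simp: norm_mult mult_left_mono)
  also have "\<dots> \<le> norm u * exp (sqrt R * d) + 2 * B * exp (c * d) * d * exp (sqrt R * d)"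
    using x c B R R0 by (intro add_mono mult_mono order_refl) (auto intro!: mult_mono)
  finally show ?thesis by (simp add: algebra_simps)
qed

text \<open>The kernel equation is integrated against \<open>cosl\<close>. By the window identity
  the plateau yields \<open>v * sinl lam x\<close>, the integral in \<open>volterra_start\<close>
  the contribution of \<open>u * cosl\<close> to the Volterra integral, and
  \<open>volterra_op\<close> that of the transform of F; the last two add up to
  \<open>kernel_sol\<close> under the integral sign.\<close>

lemma kernel_sol_integral_equation:
  assumes q: "potential d q" and d: "d > 0" and F: "transmutation_kernel q u v F" and x: "0 \<le> x"
  shows "kernel_sol u F lam x = u * cosl lam x + v * sinl lam x
     + (LINT s:{0<..<x}|lborel. sinl lam (x - s) * (q s * kernel_sol u F lam s))"
proof -
  obtain B c where c: "c \<ge> 0" and B: "kernel_bound B c F"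
    and eq: "\<And>p. F p = volterra_start q u v p + volterra_op q F p"
    using F by (auto simp: transmutation_kernel_def)
  note [measurable] = potentialD(1)[OF q] kernel_boundD(1)[OF B]
  obtain B' where B': "kernel_bound B' c (volterra_start q u v)"
    using volterra_start_bound[OF q c] .
  \<comment> \<open>The product is integrable over the plane even without the window: q confines s
    to (0, d), and the cone confines the second variable.\<close>
  have qF: "integrable (lborel \<Otimes>\<^sub>M lborel) (\<lambda>w. q (fst w) * F w)"
  proof (rule integrable_norm_bound)
    show "integrable (lborel \<Otimes>\<^sub>M lborel) (\<lambda>w. B * volterra_dom d q c d w)"
      using volterra_dom(1)[OF q d] by simp
    show "norm (q (fst w) * F w) \<le> B * volterra_dom d q c d w" for w
    proof (cases "q (fst w) = 0 \<or> F w = 0")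
      case False
      then have "0 < fst w" "fst w < d" "\<bar>snd w\<bar> < fst w"
        using potentialD(4,5)[OF q, of "fst w"] kernel_boundD(3)[OF B, of w] by fastforce+
      then have "snd w \<in> {-d<..<d}" "fst w \<in> {0<..<d}" by auto
      then show ?thesis
        using kernel_boundD(2)[OF B, of w] mult_left_mono[of "norm (F w)" "B * exp (c * fst w)" "norm (q (fst w))"]
        by (auto simp: volterra_dom_def norm_mult mult_ac)
    next
      case True
      then show ?thesis using kernel_boundD(6)[OF B] by (auto simp: volterra_dom_def)
    qed
  qed measurable
  have I1: "integrable lborel (\<lambda>t. (if \<bar>t\<bar> < x then v / 2 else 0) * cosl lam t)"
    and E1: "(LINT t|lborel. (if \<bar>t\<bar> < x then v / 2 else 0) * cosl lam t) = v * sinl lam x"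
  proof -
    have e: "(\<lambda>t. (if \<bar>t\<bar> < x then v / 2 else 0) * cosl lam t) = (\<lambda>t. v / 2 * (indicator {-x<..<x} t *\<^sub>R cosl lam t))"
      by (auto simp: indicator_def fun_eq_iff)
    show "integrable lborel (\<lambda>t. (if \<bar>t\<bar> < x then v / 2 else 0) * cosl lam t)"
      unfolding e using integral_cosl(1)[of "-x" x lam] x
      by (intro integrable_mult_right) (simp add: set_integrable_def)
    show "(LINT t|lborel. (if \<bar>t\<bar> < x then v / 2 else 0) * cosl lam t) = v * sinl lam x"
      unfolding e integral_mult_right_zero using integral_cosl(2)[of "-x" x lam] x
      by (simp add: set_lebesgue_integral_def)
  qed
  have E2: "(LINT t|lborel. (LINT s|lborel. (if \<bar>t - s\<bar> < x - s then u * q s else 0)) / 2 * cosl lam t)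
     = (LINT s|lborel. (if 0 < x - s then (u * q s) * (sinl lam (x - s) * cosl lam s) else 0))"
  proof (rule lborel.integral_window_cosl[where R = "d + (\<bar>x\<bar> + d)"])
    show "integrable lborel (\<lambda>s. u * q s)" using potential_integrable[OF q] by simp
    fix s :: real
    assume "u * q s \<noteq> 0"
    then have "0 < s" "s < d" using potentialD(4,5)[OF q, of s] by fastforce+
    then show "\<bar>s\<bar> + \<bar>x - s\<bar> \<le> d + (\<bar>x\<bar> + d)" by linarith
  qed measurable
  have I12: "integrable lborel (\<lambda>t. volterra_start q u v (x, t) * cosl lam t)"
    by (rule kernel_cosl_integrable(1)[OF B'])
  \<comment> \<open>Integrability of the two remaining pieces follows by subtraction, from the start
    term and the kernel, whose products with \<open>cosl\<close> are already integrable.\<close>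
  have I2: "integrable lborel (\<lambda>t. (LINT s|lborel. (if \<bar>t - s\<bar> < x - s then u * q s else 0)) / 2 * cosl lam t)"
    using Bochner_Integration.integrable_diff[OF I12 I1] by (simp add: volterra_start_def algebra_simps)
  have I3: "integrable lborel (\<lambda>t. volterra_op q F (x, t) * cosl lam t)"
    using Bochner_Integration.integrable_diff[OF kernel_cosl_integrable(1)[OF B, of x lam] I12]
    by (simp add: eq[of "(x, _)"] algebra_simps)
  have "(LINT t|lborel. volterra_op q F (x, t) * cosl lam t)
     = (LINT t|lborel. (LINT w|(lborel \<Otimes>\<^sub>M lborel). (if \<bar>t - snd w\<bar> < x - fst w then q (fst w) * F w else 0)) / 2 * cosl lam t)"
    by (simp add: volterra_op_def)
  also have "\<dots> = (LINT w|(lborel \<Otimes>\<^sub>M lborel). (if 0 < x - fst w then (q (fst w) * F w) * (sinl lam (x - fst w) * cosl lam (snd w)) else 0))"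
  proof (rule sigma_finite_measure.integral_window_cosl[OF sigma_finite_lborel_pair qF, where R = "d + (\<bar>x\<bar> + d)"])
    fix w :: "real \<times> real"
    assume "q (fst w) * F w \<noteq> 0"
    then have "0 < fst w" "fst w < d" "\<bar>snd w\<bar> < fst w"
      using potentialD(4,5)[OF q, of "fst w"] kernel_boundD(3)[OF B, of w] by fastforce+
    then show "\<bar>snd w\<bar> + \<bar>x - fst w\<bar> \<le> d + (\<bar>x\<bar> + d)" by linarith
  qed measurable
  also have "\<dots> = (LINT s|lborel. LINT t|lborel. (if 0 < x - s then (q s * F (s, t)) * (sinl lam (x - s) * cosl lam t) else 0))"
  proof -
    let ?f = "\<lambda>w. if 0 < x - fst w then (q (fst w) * F w) * (sinl lam (x - fst w) * cosl lam (snd w)) else 0"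
    let ?E = "(x * exp (sqrt (norm lam) * x)) * exp (sqrt (norm lam) * x)"
    have "integrable (lborel \<Otimes>\<^sub>M lborel) ?f"
    proof (rule integrable_norm_bound)
      show "integrable (lborel \<Otimes>\<^sub>M lborel) (\<lambda>w. norm (q (fst w) * F w) * ?E)"
        using qF by simp
      show "norm (?f w) \<le> norm (q (fst w) * F w) * ?E" for w
      proof (cases "0 < x - fst w \<and> q (fst w) * F w \<noteq> 0")
        case True
        then have "0 < fst w" "\<bar>snd w\<bar> < fst w" "fst w < x"
          using potentialD(4,5)[OF q, of "fst w"] kernel_boundD(3)[OF B, of w] by fastforce+
        then have "norm (sinl lam (x - fst w)) \<le> x * exp (sqrt (norm lam) * x)"
          "norm (cosl lam (snd w)) \<le> exp (sqrt (norm lam) * x)"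
          by (auto intro!: norm_sinl_le norm_cosl_le)
        then have "norm (sinl lam (x - fst w) * cosl lam (snd w)) \<le> ?E"
          unfolding norm_mult using x by (intro mult_mono) auto
        then show ?thesis
          using True by (simp add: norm_mult[of "q (fst w) * F w"] mult_left_mono del: norm_mult)
      qed (use x in auto)
    qed measurable
    from lborel_pair.integral_fst'[OF this] show ?thesis by (simp only: fst_conv snd_conv)
  qed
  also have "\<dots> = (LINT s|lborel. (if 0 < x - s then q s * sinl lam (x - s) * (LINT t|lborel. F (s, t) * cosl lam t) else 0))"
  proof (intro Bochner_Integration.integral_cong refl)
    fix s
    have "(LINT t|lborel. (q s * F (s, t)) * (sinl lam (x - s) * cosl lam t))
       = (LINT t|lborel. (q s * sinl lam (x - s)) * (F (s, t) * cosl lam t))"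
      by (intro Bochner_Integration.integral_cong refl) (simp add: mult_ac)
    then show "(LINT t|lborel. (if 0 < x - s then (q s * F (s, t)) * (sinl lam (x - s) * cosl lam t) else 0))
      = (if 0 < x - s then q s * sinl lam (x - s) * (LINT t|lborel. F (s, t) * cosl lam t) else 0)"
      by simp
  qed
  finally have E3: "(LINT t|lborel. volterra_op q F (x, t) * cosl lam t) = \<dots>" .
  have "(LINT t|lborel. F (x, t) * cosl lam t) =
     (LINT t|lborel. (if \<bar>t\<bar> < x then v / 2 else 0) * cosl lam t
       + (LINT s|lborel. (if \<bar>t - s\<bar> < x - s then u * q s else 0)) / 2 * cosl lam t
       + volterra_op q F (x, t) * cosl lam t)"
    by (intro Bochner_Integration.integral_cong refl)
      (simp add: eq[of "(x, _)"] volterra_start_def algebra_simps)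
  also have "\<dots> = v * sinl lam x
      + (LINT s|lborel. (if 0 < x - s then (u * q s) * (sinl lam (x - s) * cosl lam s) else 0))
      + (LINT s|lborel. (if 0 < x - s then q s * sinl lam (x - s) * (LINT t|lborel. F (s, t) * cosl lam t) else 0))"
    using I1 I2 I3 by (simp only: Bochner_Integration.integral_add Bochner_Integration.integrable_add E1 E2 E3)
  also have "\<dots> = v * sinl lam x + ((LINT s|lborel. (if 0 < x - s then (u * q s) * (sinl lam (x - s) * cosl lam s) else 0))
      + (LINT s|lborel. (if 0 < x - s then q s * sinl lam (x - s) * (LINT t|lborel. F (s, t) * cosl lam t) else 0)))"
    by simp
  also have "\<dots> = v * sinl lam x + (LINT s|lborel. (if 0 < x - s then (u * q s) * (sinl lam (x - s) * cosl lam s) else 0)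
      + (if 0 < x - s then q s * sinl lam (x - s) * (LINT t|lborel. F (s, t) * cosl lam t) else 0))"
  proof -
    have b1: "norm (sinl lam (x - s) * cosl lam s) \<le> (x * exp (sqrt (norm lam) * x)) * exp (sqrt (norm lam) * x)"
      if "0 < s" "s < x" for s
      unfolding norm_mult using that x by (intro mult_mono norm_sinl_le norm_cosl_le) auto
    have J1: "integrable lborel (\<lambda>s. if 0 < x - s then (u * q s) * (sinl lam (x - s) * cosl lam s) else 0)"
    proof (rule integrable_norm_bound)
      let ?E = "(x * exp (sqrt (norm lam) * x)) * exp (sqrt (norm lam) * x)"
      show "integrable lborel (\<lambda>s. norm (u * q s) * ?E)" using potential_integrable[OF q] by simp
      show "norm (if 0 < x - s then (u * q s) * (sinl lam (x - s) * cosl lam s) else 0) \<le> norm (u * q s) * ?E" for s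
      proof (cases "0 < s \<and> s < x")
        case True
        then have "norm ((u * q s) * (sinl lam (x - s) * cosl lam s)) \<le> norm (u * q s) * ?E"
          unfolding norm_mult[of "u * q s"] using b1[of s] by (intro mult_left_mono) auto
        then show ?thesis using True by simp
      qed (use potentialD(4)[OF q, of s] x in auto)
    qed measurable
    have b2: "norm (sinl lam (x - s) * (LINT t|lborel. F (s, t) * cosl lam t))
      \<le> (x * exp (sqrt (norm lam) * x)) * (2 * B * exp (c * x) * x * exp (sqrt (norm lam) * x))"
      if "0 < s" "s < x" for s
    proof -
      have "norm (LINT t|lborel. F (s, t) * cosl lam t) \<le> 2 * B * exp (c * s) * \<bar>s\<bar> * exp (sqrt (norm lam) * \<bar>s\<bar>)"
        by (rule kernel_cosl_integrable(2)[OF B])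
      also have "\<dots> \<le> 2 * B * exp (c * x) * x * exp (sqrt (norm lam) * x)"
        using that c kernel_boundD(6)[OF B] by (intro mult_mono) (auto intro!: mult_mono)
      finally show ?thesis unfolding norm_mult using that x by (intro mult_mono norm_sinl_le) auto
    qed
    have J2: "integrable lborel (\<lambda>s. if 0 < x - s then q s * sinl lam (x - s) * (LINT t|lborel. F (s, t) * cosl lam t) else 0)"
    proof (rule integrable_norm_bound)
      let ?E = "(x * exp (sqrt (norm lam) * x)) * (2 * B * exp (c * x) * x * exp (sqrt (norm lam) * x))"
      show "integrable lborel (\<lambda>s. norm (q s) * ?E)" using potential_integrable[OF q] by simp
      show "norm (if 0 < x - s then q s * sinl lam (x - s) * (LINT t|lborel. F (s, t) * cosl lam t) else 0) \<le> norm (q s) * ?E" for s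
      proof (cases "0 < s \<and> s < x")
        case True
        then have "norm (q s * (sinl lam (x - s) * (LINT t|lborel. F (s, t) * cosl lam t))) \<le> norm (q s) * ?E"
          unfolding norm_mult[of "q s"] using b2[of s] by (intro mult_left_mono) auto
        then show ?thesis using True by (simp add: mult.assoc)
      qed (use potentialD(4)[OF q, of s] x kernel_boundD(6)[OF B] in auto)
    qed measurable
    show ?thesis by (simp only: Bochner_Integration.integral_add[OF J1 J2])
  qed
  \<comment> \<open>The potential vanishes for s <= 0, so the condition 0 < x - s amounts to 0 < s <
    x.\<close>
  also have "\<dots> = v * sinl lam x + (LINT s:{0<..<x}|lborel. sinl lam (x - s) * (q s * kernel_sol u F lam s))"
    unfolding set_lebesgue_integral_def kernel_sol_def
    by (intro arg_cong2[of _ _ _ _ "(+)"] Bochner_Integration.integral_cong refl)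
      (auto simp: indicator_def algebra_simps potentialD(4)[OF q])
  finally show ?thesis by (simp add: kernel_sol_def)
qed

section \<open>The initial value problem\<close>

lemma set_integrable_bounded_mult:
  fixes g k :: "real \<Rightarrow> complex"
  assumes g: "integrable lborel g" and [measurable]: "k \<in> borel_measurable borel" "S \<in> sets borel"
    and K: "\<And>s. s \<in> S \<Longrightarrow> norm (k s) \<le> K"
  shows "set_integrable lborel S (\<lambda>s. k s * g s)"
proof -
  have [measurable]: "g \<in> borel_measurable borel" using g by simp
  show ?thesis
    unfolding set_integrable_def
  proof (rule integrable_norm_bound)
    show "integrable lborel (\<lambda>s. \<bar>K\<bar> * norm (g s))" using g by simp
    show "norm (indicator S s *\<^sub>R (k s * g s)) \<le> \<bar>K\<bar> * norm (g s)" for s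
      using K[of s] by (auto simp: indicator_def norm_mult intro!: mult_right_mono)
  qed measurable
qed

text \<open>Fubini on the triangle 0 < s < r < x. It permits checking integrated equations, instead
  of differentiating a convolution whose factor g is merely integrable.\<close>

lemma convolution_Fubini:
  fixes k K g :: "real \<Rightarrow> complex"
  assumes g: "integrable lborel g" and k: "continuous_on UNIV k"
    and K: "\<And>x. (K has_vector_derivative k x) (at x)" and x: "0 \<le> x"
  shows "set_integrable lborel {0<..<x} (\<lambda>r. LINT s:{0<..<r}|lborel. k (r - s) * g s)"
    and "(LINT r:{0<..<x}|lborel. (LINT s:{0<..<r}|lborel. k (r - s) * g s))
       = (LINT s:{0<..<x}|lborel. (K (x - s) - K 0) * g s)"
proof -
  have [measurable]: "g \<in> borel_measurable borel" "k \<in> borel_measurable borel"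
    using g k by (auto intro: borel_measurable_continuous_onI)
  obtain b where b: "\<And>t. t \<in> {0..x} \<Longrightarrow> norm (k t) \<le> b"
  proof -
    have "bounded (k ` {0..x})"
      by (intro compact_imp_bounded compact_continuous_image continuous_on_subset[OF k]) auto
    then obtain b where "\<forall>t\<in>{0..x}. norm (k t) \<le> b" by (auto simp: bounded_iff)
    then show ?thesis using that by blast
  qed
  let ?h = "\<lambda>s r. if 0 < s \<and> s < r \<and> r < x then k (r - s) * g s else 0"
  have "integrable (lborel \<Otimes>\<^sub>M lborel) (\<lambda>(s, r). norm (g s) * (\<bar>b\<bar> * indicator {0<..<x} r))"
    using g by (intro lborel_pair.integrable_mult_product) auto
  then have hi: "integrable (lborel \<Otimes>\<^sub>M lborel) (\<lambda>(s, r). ?h s r)"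
  proof (rule integrable_norm_bound)
    have "norm (?h s r) \<le> norm (g s) * (\<bar>b\<bar> * indicator {0<..<x} r)" for s r
    proof (cases "0 < s \<and> s < r \<and> r < x")
      case True
      then have "norm (k (r - s)) \<le> \<bar>b\<bar>" using b[of "r - s"] by force
      then show ?thesis using True by (simp add: norm_mult mult.commute[of "norm (k _)"] mult_left_mono)
    qed auto
    then show "norm (case z of (s, r) \<Rightarrow> ?h s r)
         \<le> (case z of (s, r) \<Rightarrow> norm (g s) * (\<bar>b\<bar> * indicator {0<..<x} r))" for z
      by (cases z) (simp only: prod.case)
  qed measurable
  have r: "indicator {0<..<x} r *\<^sub>R (LINT s:{0<..<r}|lborel. k (r - s) * g s) = (LINT s|lborel. ?h s r)" for r
  proof (cases "0 < r \<and> r < x")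
    case True
    then show ?thesis unfolding set_lebesgue_integral_def
      by (auto simp: indicator_def intro!: Bochner_Integration.integral_cong)
  next
    case False
    then have "?h s r = 0" for s by auto
    then have "(LINT s|lborel. ?h s r) = 0" by (simp only: Bochner_Integration.integral_zero)
    then show ?thesis using False by simp
  qed
  have s: "(LINT r|lborel. ?h s r) = indicator {0<..<x} s *\<^sub>R ((K (x - s) - K 0) * g s)" for s
  proof (cases "0 < s \<and> s < x")
    case True
    have D: "((\<lambda>r. K (r - s)) has_vector_derivative k (r - s)) (at r)" for r
    proof -
      have "((\<lambda>r. r - s) has_vector_derivative 1) (at r)"
        unfolding has_real_derivative_iff_has_vector_derivative[symmetric] by (auto intro!: derivative_eq_intros)
      from vector_diff_chain_at[OF this K] show ?thesis by (simp add: o_def)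
    qed
    have "continuous_on UNIV (\<lambda>r. k (r - s))"
      by (rule continuous_on_compose2[OF k]) (auto intro!: continuous_intros)
    then have "(LINT r:{s<..<x}|lborel. k (r - s)) = K (x - s) - K (s - s)"
      using True by (intro has_bochner_integral_FTC_Ioo(2) D) auto
    then have "(LINT r:{s<..<x}|lborel. k (r - s) * g s) = (K (x - s) - K 0) * g s" by simp
    moreover have "(LINT r|lborel. ?h s r) = (LINT r:{s<..<x}|lborel. k (r - s) * g s)"
      unfolding set_lebesgue_integral_def
      using True by (intro Bochner_Integration.integral_cong) (auto simp: indicator_def)
    ultimately show ?thesis using True by simp
  next
    case False
    then have "?h s r = 0" for r by auto
    then have "(LINT r|lborel. ?h s r) = 0" by (simp only: Bochner_Integration.integral_zero)
    then show ?thesis using False by simp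
  qed
  have "integrable lborel (\<lambda>r. LINT s|lborel. ?h s r)"
    using lborel_pair.integrable_snd[of "\<lambda>s r. ?h s r"] hi by (simp add: split_def)
  then show "set_integrable lborel {0<..<x} (\<lambda>r. LINT s:{0<..<r}|lborel. k (r - s) * g s)"
    unfolding set_integrable_def r .
  show "(LINT r:{0<..<x}|lborel. (LINT s:{0<..<r}|lborel. k (r - s) * g s))
       = (LINT s:{0<..<x}|lborel. (K (x - s) - K 0) * g s)"
    unfolding set_lebesgue_integral_def[of lborel "{0<..<x}"] r s[symmetric]
    by (rule lborel_pair.Fubini_integral) (use hi in \<open>simp add: split_def\<close>)
qed

text \<open>The problem as an integrated first order system: equalities hold at every point of
  [0, d], the second derivative does not occur, and no exceptional null sets have to be
  tracked.\<close>

definition ivp :: "real \<Rightarrow> (real \<Rightarrow> complex) \<Rightarrow> complex \<Rightarrow> complex \<Rightarrow> complex \<Rightarrow> (real \<Rightarrow> complex) \<Rightarrow> (real \<Rightarrow> complex) \<Rightarrow> bool" where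
  "ivp d q lam u v y y' \<longleftrightarrow>
     set_integrable lborel {0<..<d} y' \<and> set_integrable lborel {0<..<d} (\<lambda>s. (q s - lam) * y s) \<and>
     (\<forall>x\<in>{0..d}. y x = u + (LINT s:{0<..<x}|lborel. y' s) \<and>
        y' x = v + (LINT s:{0<..<x}|lborel. (q s - lam) * y s))"

text \<open>Formal x-derivative of the formula in \<open>kernel_sol_integral_equation\<close>; the
  boundary term of the integral drops out because \<open>sinl lam 0 = 0\<close>.\<close>

definition kernel_dsol :: "(real \<Rightarrow> complex) \<Rightarrow> complex \<Rightarrow> complex \<Rightarrow> (real \<times> real \<Rightarrow> complex) \<Rightarrow> complex \<Rightarrow> real \<Rightarrow> complex" where
  "kernel_dsol q u v F lam x = u * (- lam * sinl lam x) + v * cosl lam x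
     + (LINT s:{0<..<x}|lborel. cosl lam (x - s) * (q s * kernel_sol u F lam s))"

lemma set_integral_cong_Ioo:
  fixes f g :: "real \<Rightarrow> complex"
  assumes "\<And>s. 0 < s \<Longrightarrow> s < x \<Longrightarrow> f s = g s"
  shows "(LINT s:{0<..<x}|lborel. f s) = (LINT s:{0<..<x}|lborel. g s)"
    and "set_integrable lborel {0<..<x} f \<longleftrightarrow> set_integrable lborel {0<..<x} g"
  unfolding set_lebesgue_integral_def set_integrable_def
  using assms by (auto simp: indicator_def intro!: Bochner_Integration.integral_cong Bochner_Integration.integrable_cong)

lemma integrable_potential_times_kernel_sol:
  assumes q: "potential d q" and F: "transmutation_kernel q u v F"
  shows "integrable lborel (\<lambda>s. q s * kernel_sol u F lam s)"
proof -
  obtain B c where c: "c \<ge> 0" and B: "kernel_bound B c F"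
    using F by (auto simp: transmutation_kernel_def)
  note [measurable] = kernel_sol_measurable[OF B]
  have "set_integrable lborel {0<..<d} (\<lambda>s. kernel_sol u F lam s * q s)"
    by (rule set_integrable_bounded_mult[OF potential_integrable[OF q], where
          K = "(norm u + 2 * B * exp (c * d) * d) * exp (sqrt (norm lam) * d)"])
      (use kernel_sol_bound[OF B c, of _ d lam "norm lam" u] in auto)
  moreover have "indicator {0<..<d} s *\<^sub>R (kernel_sol u F lam s * q s) = q s * kernel_sol u F lam s" for s
    using potentialD(3)[OF q, of s] by (cases "s \<in> {0<..<d}") auto
  ultimately show ?thesis by (simp add: set_integrable_def)
qed

text \<open>Both equations come from \<open>convolution_Fubini\<close>: with convolution kernel
  \<open>cosl\<close> and primitive \<open>sinl\<close> for the function, with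
  \<open>- lam * sinl\<close> and primitive \<open>cosl\<close> for its derivative.\<close>

lemma kernel_sol_ivp:
  assumes q: "potential d q" and d: "d > 0" and F: "transmutation_kernel q u v F"
  shows "ivp d q lam u v (kernel_sol u F lam) (kernel_dsol q u v F lam)"
proof -
  define g where "g s = q s * kernel_sol u F lam s" for s
  have g: "integrable lborel g" unfolding g_def[abs_def] by (rule integrable_potential_times_kernel_sol[OF q F])
  have sol: "kernel_sol u F lam x = u * cosl lam x + v * sinl lam x + (LINT s:{0<..<x}|lborel. sinl lam (x - s) * g s)" if "0 \<le> x" for x
    unfolding g_def by (rule kernel_sol_integral_equation[OF q d F that])
  have dsol: "kernel_dsol q u v F lam = (\<lambda>x. u * (- lam * sinl lam x) + v * cosl lam x + (LINT s:{0<..<x}|lborel. cosl lam (x - s) * g s))"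
    by (simp add: kernel_dsol_def g_def fun_eq_iff)
  have "continuous_on UNIV (cosl lam)" by (intro continuous_intros)
  note C = convolution_Fubini[OF g this sinl_has_vector_derivative]
  have "continuous_on UNIV (\<lambda>t. - lam * sinl lam t)" by (intro continuous_intros)
  note S = convolution_Fubini[OF g this cosl_has_vector_derivative]
  have gs: "set_integrable lborel {0<..<x} g" for x
    using g unfolding set_integrable_def by (intro integrable_mult_indicator) auto
  \<comment> \<open>Only the summand with -lam is expanded by the integral equation; the resulting
    terms are then ones whose integrals are known, while g is left as it is.\<close>
  have split: "(q s - lam) * kernel_sol u F lam s = g s +
      (u * (- lam * cosl lam s) + v * (- lam * sinl lam s) + (LINT r:{0<..<s}|lborel. - lam * sinl lam (s - r) * g r))" if "0 < s" for s
  proof -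
    have "(LINT r:{0<..<s}|lborel. - lam * sinl lam (s - r) * g r) = - lam * (LINT r:{0<..<s}|lborel. sinl lam (s - r) * g r)"
      by (simp only: set_integral_mult_right[symmetric] mult.assoc)
    then show ?thesis using that by (simp add: left_diff_distrib g_def[of s, symmetric]) (simp add: sol algebra_simps)
  qed
  have i1: "set_integrable lborel {0<..<x} (kernel_dsol q u v F lam)"
    and e1: "kernel_sol u F lam x = u + (LINT s:{0<..<x}|lborel. kernel_dsol q u v F lam s)" if x: "0 \<le> x" for x
  proof -
    note I = integral_cosl[OF x, of lam] integral_sinl[OF x, of lam] C[OF x]
    show "set_integrable lborel {0<..<x} (kernel_dsol q u v F lam)"
      unfolding dsol
      by (intro set_integral_add(1) set_integrable_mult_right[OF I(3)] set_integrable_mult_right[OF I(1)] I(5))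
    have "(LINT s:{0<..<x}|lborel. kernel_dsol q u v F lam s) = u * (cosl lam x - cosl lam 0) + v * (sinl lam x - sinl lam 0)
        + (LINT s:{0<..<x}|lborel. (sinl lam (x - s) - sinl lam 0) * g s)"
      unfolding dsol using I by (simp only: set_integral_add set_integral_mult_right set_integrable_mult_right)
    then show "kernel_sol u F lam x = u + (LINT s:{0<..<x}|lborel. kernel_dsol q u v F lam s)"
      using sol[OF x] by (simp add: algebra_simps)
  qed
  have i2: "set_integrable lborel {0<..<x} (\<lambda>s. (q s - lam) * kernel_sol u F lam s)"
    and e2: "kernel_dsol q u v F lam x = v + (LINT s:{0<..<x}|lborel. (q s - lam) * kernel_sol u F lam s)" if x: "0 \<le> x" for x
  proof -
    have lc: "set_integrable lborel {0<..<x} (\<lambda>s. - lam * cosl lam s)"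
      "(LINT s:{0<..<x}|lborel. - lam * cosl lam s) = - lam * (sinl lam x - sinl lam 0)"
      using integral_cosl[OF x, of lam] by (auto simp only: set_integral_mult_right set_integrable_mult_right)
    note I = lc integral_sinl[OF x, of lam] S[OF x] gs[of x]
    let ?R = "\<lambda>s. g s + (u * (- lam * cosl lam s) + v * (- lam * sinl lam s)
      + (LINT r:{0<..<s}|lborel. - lam * sinl lam (s - r) * g r))"
    have s1: "(LINT s:{0<..<x}|lborel. (q s - lam) * kernel_sol u F lam s) = (LINT s:{0<..<x}|lborel. ?R s)"
      by (rule set_integral_cong_Ioo(1)) (rule split)
    have s2: "set_integrable lborel {0<..<x} (\<lambda>s. (q s - lam) * kernel_sol u F lam s) \<longleftrightarrow> set_integrable lborel {0<..<x} ?R"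
      by (rule set_integral_cong_Ioo(2)) (rule split)
    show "set_integrable lborel {0<..<x} (\<lambda>s. (q s - lam) * kernel_sol u F lam s)"
      unfolding s2
      by (intro set_integral_add(1) set_integrable_mult_right[OF I(1)] set_integrable_mult_right[OF I(3)] I(5,7))
    have "(LINT s:{0<..<x}|lborel. (q s - lam) * kernel_sol u F lam s) = (LINT s:{0<..<x}|lborel. g s)
       + (u * (- lam * (sinl lam x - sinl lam 0)) + v * (cosl lam x - cosl lam 0)
       + (LINT s:{0<..<x}|lborel. (cosl lam (x - s) - cosl lam 0) * g s))"
      unfolding s1
      using I by (simp only: set_integral_add set_integral_mult_right set_integrable_mult_right)
    also have "\<dots> = u * (- lam * sinl lam x) + v * (cosl lam x - 1) + ((LINT s:{0<..<x}|lborel. g s)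
       + (LINT s:{0<..<x}|lborel. (cosl lam (x - s) - 1) * g s))" by simp
    \<comment> \<open>The primitive \<open>cosl\<close> takes the value 1 at 0, which contributes -1
      to the factor of g; the separate integral of g compensates it.\<close>
    also have "(LINT s:{0<..<x}|lborel. g s) + (LINT s:{0<..<x}|lborel. (cosl lam (x - s) - 1) * g s)
       = (LINT s:{0<..<x}|lborel. g s + (cosl lam (x - s) - 1) * g s)"
    proof (rule set_integral_add(2)[symmetric, OF gs])
      show "set_integrable lborel {0<..<x} (\<lambda>s. (cosl lam (x - s) - 1) * g s)"
      proof (rule set_integrable_bounded_mult[OF g])
        show "norm (cosl lam (x - s) - 1) \<le> exp (sqrt (norm lam) * x) + 1" if "s \<in> {0<..<x}" for s
          using norm_triangle_ineq4[of "cosl lam (x - s)" 1] norm_cosl_le[of lam "norm lam" "x - s" x] that by auto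
      qed measurable
    qed
    also have "\<dots> = (LINT s:{0<..<x}|lborel. cosl lam (x - s) * g s)" by (simp add: algebra_simps)
    finally show "kernel_dsol q u v F lam x = v + (LINT s:{0<..<x}|lborel. (q s - lam) * kernel_sol u F lam s)"
      by (simp add: dsol algebra_simps)
  qed
  show ?thesis unfolding ivp_def using i1 i2 e1 e2 d by auto
qed

section \<open>Uniqueness for the initial value problem\<close>

lemma potential_shift:
  assumes q: "potential d q"
  shows "potential d (\<lambda>x. indicator {0<..<d} x *\<^sub>R (q x - lam))"
  unfolding potential_def
proof (intro conjI allI impI)
  note [measurable] = potentialD(1)[OF q]
  show "(\<lambda>x. indicator {0<..<d} x *\<^sub>R (q x - lam)) \<in> borel_measurable borel" by measurable
  show "integrable lborel (\<lambda>x. (norm (indicator {0<..<d} x *\<^sub>R (q x - lam)))\<^sup>2)"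
  proof (rule integrable_norm_bound)
    show "integrable lborel (\<lambda>x. 2 * (norm (q x))\<^sup>2 + 2 * (norm lam)\<^sup>2 * indicator {0<..<d} x)"
      using potentialD(2)[OF q] by simp
    show "norm ((norm (indicator {0<..<d} x *\<^sub>R (q x - lam)))\<^sup>2)
        \<le> 2 * (norm (q x))\<^sup>2 + 2 * (norm lam)\<^sup>2 * indicator {0<..<d} x" for x
      using norm_add_square_le[of "q x" "- lam"] by (auto simp: indicator_def)
  qed measurable
qed auto

lemma norm_set_integral_le:
  fixes f :: "real \<Rightarrow> complex"
  assumes f: "set_integrable lborel S f" and g: "set_integrable lborel S g"
    and le: "\<And>s. s \<in> S \<Longrightarrow> norm (f s) \<le> g s"
  shows "norm (LINT s:S|lborel. f s) \<le> (LINT s:S|lborel. g s)"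
  unfolding set_lebesgue_integral_def
  by (rule Bochner_Integration.integral_norm_bound_integral)
    (use f g le in \<open>auto simp: set_integrable_def indicator_def\<close>)

lemma ivp_diff:
  assumes 1: "ivp d q lam u1 v1 y1 y1'" and 2: "ivp d q lam u2 v2 y2 y2'"
  shows "ivp d q lam (u1 - u2) (v1 - v2) (\<lambda>x. y1 x - y2 x) (\<lambda>x. y1' x - y2' x)"
  unfolding ivp_def
proof (intro conjI ballI)
  note d1 = 1[unfolded ivp_def] and d2 = 2[unfolded ivp_def]
  show i1: "set_integrable lborel {0<..<d} (\<lambda>x. y1' x - y2' x)" using d1 d2 by (intro set_integral_diff) auto
  have "set_integrable lborel {0<..<d} (\<lambda>s. (q s - lam) * y1 s - (q s - lam) * y2 s)"
    using d1 d2 by (intro set_integral_diff) auto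
  then show "set_integrable lborel {0<..<d} (\<lambda>s. (q s - lam) * (y1 s - y2 s))"
    by (simp add: right_diff_distrib)
  fix x assume x: "x \<in> {0..d}"
  have sub: "set_integrable lborel {0<..<x} f" if "set_integrable lborel {0<..<d} f" for f :: "real \<Rightarrow> complex"
    using that by (rule set_integrable_subset) (use x in auto)
  have "(LINT s:{0<..<x}|lborel. y1' s - y2' s) = (LINT s:{0<..<x}|lborel. y1' s) - (LINT s:{0<..<x}|lborel. y2' s)"
    using d1 d2 by (intro set_integral_diff sub) auto
  then show "y1 x - y2 x = u1 - u2 + (LINT s:{0<..<x}|lborel. y1' s - y2' s)"
    using d1 d2 x by simp
  have "(LINT s:{0<..<x}|lborel. (q s - lam) * y1 s - (q s - lam) * y2 s)
     = (LINT s:{0<..<x}|lborel. (q s - lam) * y1 s) - (LINT s:{0<..<x}|lborel. (q s - lam) * y2 s)"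
    using d1 d2 by (intro set_integral_diff sub) auto
  then show "y1' x - y2' x = v1 - v2 + (LINT s:{0<..<x}|lborel. (q s - lam) * (y1 s - y2 s))"
    using d1 d2 x by (simp add: right_diff_distrib)
qed

text \<open>A homogeneous Volterra system: one passage through both integrals halves the bound of y
  in the weight \<open>exp (c * x)\<close>, so iteration leaves 0. The weight absorbs the potential,
  which has no pointwise bound.\<close>

lemma ivp_zero:
  assumes q: "potential d q" and y: "ivp d q lam 0 0 y y'" and x: "x \<in> {0..d}"
  shows "y x = 0" "y' x = 0"
proof -
  define p where "p x = indicator {0<..<d} x *\<^sub>R (q x - lam)" for x
  have p: "potential d p" unfolding p_def[abs_def] by (rule potential_shift[OF q])
  have pe: "p s = q s - lam" if "s \<in> {0<..<d}" for s using that by (simp add: p_def)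
  have yi: "set_integrable lborel {0<..<d} y'" "set_integrable lborel {0<..<d} (\<lambda>s. (q s - lam) * y s)"
    using y by (simp_all add: ivp_def)
  have yb: "\<forall>x\<in>{0..d}. y x = 0 + (LINT s:{0<..<x}|lborel. y' s) \<and> y' x = 0 + (LINT s:{0<..<x}|lborel. (q s - lam) * y s)"
    using y unfolding ivp_def by (elim conjE)
  have ye: "y x = (LINT s:{0<..<x}|lborel. y' s)"
    and y'e: "y' x = (LINT s:{0<..<x}|lborel. (q s - lam) * y s)" if x: "x \<in> {0..d}" for x
  proof -
    show "y x = (LINT s:{0<..<x}|lborel. y' s)" "y' x = (LINT s:{0<..<x}|lborel. (q s - lam) * y s)"
      using bspec[OF yb x] by (simp_all only: add_0)
  qed
  have half: "(0::real) < 1 / 2" by simp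
  obtain c0 where "c0 > 0" and c0: "\<And>c x. c \<ge> c0 \<Longrightarrow> 0 \<le> x \<Longrightarrow> (LINT s:{0<..<x}|lborel. norm (p s) * exp (c * s)) \<le> 1 / 2 * exp (c * x)"
    by (rule volterra_weight[OF p half]) (rule that)
  \<comment> \<open>\<open>c0\<close> gives the factor 1/2 when \<open>y'\<close> is estimated by y;
    \<open>c \<ge> 1\<close> makes the second integration, which divides by \<open>c\<close>,
    harmless.\<close>
  define c where "c = max 1 c0"
  have c: "c \<ge> 1" "c \<ge> c0" by (auto simp: c_def)
  have sub: "set_integrable lborel {0<..<x} f" if "set_integrable lborel {0<..<d} f" "x \<in> {0..d}" for f :: "real \<Rightarrow> complex" and x
    using that(1) by (rule set_integrable_subset) (use that in auto)
  \<comment> \<open>Start of the iteration: y is bounded because \<open>y'\<close> is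
    integrable.\<close>
  define M where "M = (LINT s:{0<..<d}|lborel. norm (y' s))"
  have iy': "set_integrable lborel {0<..<d} (\<lambda>s. norm (y' s))" by (rule set_integrable_norm[OF yi(1)])
  have M: "norm (y x) \<le> M" if x: "x \<in> {0..d}" for x
  proof -
    have ix: "set_integrable lborel {0<..<x} (\<lambda>s. norm (y' s))"
      by (rule set_integrable_subset[OF iy']) (use x in auto)
    have "norm (y x) = norm (LINT s:{0<..<x}|lborel. y' s)" by (simp only: ye[OF x])
    also have "\<dots> \<le> (LINT s:{0<..<x}|lborel. norm (y' s))"
      by (rule norm_set_integral_le[OF sub[OF yi(1) x] ix]) simp
    also have "\<dots> \<le> M" unfolding M_def set_lebesgue_integral_def
    proof (rule integral_mono)
      show "integrable lborel (\<lambda>s. indicator {0<..<x} s *\<^sub>R norm (y' s))"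
        using ix by (simp only: set_integrable_def)
      show "integrable lborel (\<lambda>s. indicator {0<..<d} s *\<^sub>R norm (y' s))" using iy' by (simp only: set_integrable_def)
      show "indicator {0<..<x} s *\<^sub>R norm (y' s) \<le> indicator {0<..<d} s *\<^sub>R norm (y' s)" for s
        using x by (auto simp: indicator_def)
    qed
    finally show ?thesis .
  qed
  have it: "norm (y x) \<le> M * (1/2) ^ n * exp (c * x)" if x: "x \<in> {0..d}" for n x
    using x
  proof (induction n arbitrary: x)
    case 0
    have M0: "M \<ge> 0" using M[OF 0] norm_ge_zero order_trans by blast
    have "norm (y x) \<le> M * 1" using M[OF 0] by simp
    also have "\<dots> \<le> M * exp (c * x)" using M0 c 0 by (intro mult_left_mono) auto
    finally show ?case by simp
  next
    case (Suc n)
    let ?A = "M * (1/2) ^ n"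
    have "M \<ge> 0" using M[OF Suc.prems] norm_ge_zero order_trans by blast
    then have A: "?A \<ge> 0" by simp
    have y'b: "norm (y' s) \<le> ?A / 2 * exp (c * s)" if s: "s \<in> {0..d}" for s
    proof -
      have i: "set_integrable lborel {0<..<s} (\<lambda>r. ?A * (norm (p r) * exp (c * r)))"
        by (intro set_integrable_mult_right set_integrable_mult_exp potential_integrable[OF p])
      have "norm (y' s) = norm (LINT r:{0<..<s}|lborel. (q r - lam) * y r)" by (simp only: y'e[OF s])
      also have "\<dots> \<le> (LINT r:{0<..<s}|lborel. ?A * (norm (p r) * exp (c * r)))"
      proof (rule norm_set_integral_le[OF _ i])
        show "set_integrable lborel {0<..<s} (\<lambda>r. (q r - lam) * y r)" by (rule sub[OF yi(2) s])
        fix r assume r: "r \<in> {0<..<s}"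
        then have "norm ((q r - lam) * y r) = norm (p r) * norm (y r)" using s by (simp add: pe norm_mult)
        also have "\<dots> \<le> norm (p r) * (?A * exp (c * r))" using Suc.IH[of r] r s by (intro mult_left_mono) auto
        finally show "norm ((q r - lam) * y r) \<le> ?A * (norm (p r) * exp (c * r))" by (simp add: mult_ac)
      qed
      also have "\<dots> = ?A * (LINT r:{0<..<s}|lborel. norm (p r) * exp (c * r))" by (rule set_integral_mult_right)
      also have "\<dots> \<le> ?A * (1 / 2 * exp (c * s))" using A c0[OF c(2), of s] s by (intro mult_left_mono) auto
      finally show ?thesis by simp
    qed
    have x: "x \<in> {0..d}" by fact
    have i: "set_integrable lborel {0<..<x} (\<lambda>r. ?A / 2 * exp (c * r))"
      using c x by (intro set_integrable_mult_right integral_exp_interval(2)) auto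
    have "norm (y x) = norm (LINT r:{0<..<x}|lborel. y' r)" by (simp only: ye[OF x])
    also have "\<dots> \<le> (LINT r:{0<..<x}|lborel. ?A / 2 * exp (c * r))"
    proof (rule norm_set_integral_le[OF _ i])
      show "set_integrable lborel {0<..<x} y'" by (rule sub[OF yi(1) x])
      show "norm (y' s) \<le> ?A / 2 * exp (c * s)" if "s \<in> {0<..<x}" for s
        by (rule y'b) (use that x in auto)
    qed
    also have "\<dots> = ?A / 2 * (LINT r:{0<..<x}|lborel. exp (c * r))" by (rule set_integral_mult_right)
    also have "\<dots> \<le> ?A / 2 * (exp (c * x) / c)" using c x A by (intro mult_left_mono integral_exp_interval(1)) auto
    also have "\<dots> \<le> ?A / 2 * exp (c * x)" using c A by (intro mult_left_mono) (auto simp: divide_le_eq)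
    finally show ?case by simp
  qed
  have y0: "y x = 0" if x: "x \<in> {0..d}" for x
  proof -
    have "(\<lambda>n. M * (1/2) ^ n * exp (c * x)) \<longlonglongrightarrow> M * 0 * exp (c * x)"
      by (intro tendsto_intros LIMSEQ_power_zero) auto
    then have "norm (y x) \<le> M * 0 * exp (c * x)"
      by (rule LIMSEQ_le_const) (use it[OF x] in blast)
    then show ?thesis by simp
  qed
  then show "y x = 0" using x .
  have "y' x = (LINT s:{0<..<x}|lborel. (q s - lam) * y s)" by (rule y'e[OF x])
  also have "\<dots> = (LINT s:{0<..<x}|lborel. 0)" by (rule set_integral_cong_Ioo(1)) (use y0 x in auto)
  finally show "y' x = 0" by (simp add: set_lebesgue_integral_def)
qed

lemma ivp_unique:
  assumes q: "potential d q" and "ivp d q lam u v y1 y1'" "ivp d q lam u v y2 y2'" and "x \<in> {0..d}"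
  shows "y1 x = y2 x" "y1' x = y2' x"
  using ivp_zero[OF q _ assms(4)] ivp_diff[OF assms(2,3)] by fastforce+

section \<open>Agreement with solutions in the Caratheodory sense\<close>

lemma integrable_lebesgue_on_Ioo_mono:
  fixes g :: "real \<Rightarrow> complex"
  assumes "integrable (lebesgue_on {0<..<d}) g" "x \<le> d"
  shows "integrable (lebesgue_on {0<..<x}) g"
proof -
  have "set_integrable lebesgue {0<..<d} g"
    using assms(1) by (simp add: integrable_restrict_space set_integrable_def)
  then have "set_integrable lebesgue {0<..<x} g"
    by (rule set_integrable_subset) (use assms(2) in auto)
  then show ?thesis by (simp add: integrable_restrict_space set_integrable_def)
qed

text \<open>Reduced to the gauge integral \<open>integral\<close>, whose indefinite integrals are
  continuous. Continuity makes the truncations of y and \<open>y'\<close> Borel, as the passage to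
  \<open>lborel\<close> requires.\<close>

lemma continuous_on_indefinite_integral:
  fixes g :: "real \<Rightarrow> complex"
  assumes g: "integrable (lebesgue_on {0<..<d}) g"
  shows "continuous_on {0..d} (\<lambda>x. LINT t|lebesgue_on {0<..<x}. g t)"
proof -
  have "g integrable_on {0<..<d}" using g by (intro integrable_on_lebesgue_on) auto
  then have "g integrable_on {0..d}" by (simp add: integrable_on_open_interval_real)
  then have c: "continuous_on {0..d} (\<lambda>x. integral {0..x} g)" by (rule indefinite_integral_continuous_1)
  show ?thesis
  proof (rule continuous_on_eq[OF c])
    fix x assume x: "x \<in> {0..d}"
    have "integrable (lebesgue_on {0<..<x}) g"
      by (rule integrable_lebesgue_on_Ioo_mono[OF g]) (use x in auto)
    then have "(LINT t|lebesgue_on {0<..<x}. g t) = integral {0<..<x} g"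
      by (intro lebesgue_integral_eq_integral) auto
    then show "integral {0..x} g = (LINT t|lebesgue_on {0<..<x}. g t)" by (simp add: integral_open_interval_real)
  qed
qed

lemma has_ac_deriv_continuous:
  "has_ac_deriv d f g \<Longrightarrow> continuous_on {0..d} f"
  using continuous_on_indefinite_integral[of d g]
  by (auto simp: has_ac_deriv_def intro!: continuous_on_eq[of "{0..d}" "\<lambda>x. f 0 + (LINT t|lebesgue_on {0<..<x}. g t)" f] continuous_intros)

lemma continuous_on_borel_indicator:
  fixes f :: "real \<Rightarrow> complex"
  assumes "continuous_on {0..d} f" "x \<le> d"
  shows "(\<lambda>s. indicator {0<..<x} s *\<^sub>R f s) \<in> borel_measurable borel"
  by (rule borel_measurable_continuous_on_indicator) (use assms in \<open>auto intro: continuous_on_subset\<close>)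

text \<open>The second derivative of a solution is only Lebesgue measurable. Almost everywhere it
  equals \<open>(p s - lam) * y s\<close>, whose truncation is Borel because y is continuous, and so
  its integrals move to \<open>lborel\<close>.\<close>

lemma sl_solution_imp_ivp:
  assumes p: "potential d p" and qp: "AE x in lebesgue_on {0<..<d}. q x = p x"
    and sl: "sl_solution d q lam y y'"
  shows "ivp d p lam (y 0) (y' 0) y y'"
proof -
  note [measurable] = potentialD(1)[OF p]
  obtain y'' where y: "has_ac_deriv d y y'" and y': "has_ac_deriv d y' y''"
    and eq: "AE x in lebesgue_on {0<..<d}. - y'' x + q x * y x = lam * y x"
    using sl by (auto simp: sl_solution_def)
  note c = has_ac_deriv_continuous[OF y] has_ac_deriv_continuous[OF y']
  have m1: "(\<lambda>s. indicator {0<..<x} s *\<^sub>R y' s) \<in> borel_measurable borel" if "x \<le> d" for x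
    using continuous_on_borel_indicator[OF c(2) that] .
  have m2: "(\<lambda>s. indicator {0<..<x} s *\<^sub>R ((p s - lam) * y s)) \<in> borel_measurable borel" if "x \<le> d" for x
  proof -
    have "(\<lambda>s. (p s - lam) * (indicator {0<..<x} s *\<^sub>R y s)) \<in> borel_measurable borel"
      by (rule borel_measurable_times[OF _ continuous_on_borel_indicator[OF c(1) that]]) measurable
    also have "(\<lambda>s. (p s - lam) * (indicator {0<..<x} s *\<^sub>R y s)) = (\<lambda>s. indicator {0<..<x} s *\<^sub>R ((p s - lam) * y s))"
      by (simp only: mult_scaleR_right)
    finally show ?thesis .
  qed
  have AEd: "AE x in lborel. x \<in> {0<..<d} \<longrightarrow> y'' x = (p x - lam) * y x"
    using qp eq unfolding AE_lebesgue_on_iff[OF borel_open[OF open_greaterThanLessThan]]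
    by eventually_elim (auto simp: algebra_simps add_eq_0_iff)
  have AEx: "AE s in lebesgue_on {0<..<x}. y'' s = (p s - lam) * y s" if "x \<le> d" for x
    unfolding AE_lebesgue_on_iff[OF borel_open[OF open_greaterThanLessThan]]
    using AEd by eventually_elim (use that in auto)
  have ix: "integrable (lebesgue_on {0<..<x}) y''" if "x \<le> d" for x
    by (rule integrable_lebesgue_on_Ioo_mono[of d]) (use y' that in \<open>auto simp: has_ac_deriv_def\<close>)
  have mx: "(\<lambda>s. (p s - lam) * y s) \<in> borel_measurable (lebesgue_on {0<..<x})" if "x \<le> d" for x
    using m2[OF that] by (subst borel_measurable_restrict_space_iff) (auto intro: measurable_completion)
  show ?thesis unfolding ivp_def
  proof (intro conjI ballI)
    show "set_integrable lborel {0<..<d} y'"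
      using y m1[of d] by (simp add: has_ac_deriv_def lebesgue_on_iff_lborel)
    have "integrable (lebesgue_on {0<..<d}) (\<lambda>s. (p s - lam) * y s)"
      by (rule integrable_cong_AE_imp[OF ix[of d] mx[of d] AEx[of d]]) auto
    then show "set_integrable lborel {0<..<d} (\<lambda>s. (p s - lam) * y s)"
      using m2[of d] by (simp add: lebesgue_on_iff_lborel)
    fix x assume x: "x \<in> {0..d}"
    have "y x = y 0 + (LINT s|lebesgue_on {0<..<x}. y' s)" using y x unfolding has_ac_deriv_def by blast
    also have "(LINT s|lebesgue_on {0<..<x}. y' s) = (LINT s:{0<..<x}|lborel. y' s)"
      using m1[of x] x by (simp add: lebesgue_on_iff_lborel)
    finally show "y x = y 0 + (LINT s:{0<..<x}|lborel. y' s)" .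
    have "y' x = y' 0 + (LINT s|lebesgue_on {0<..<x}. y'' s)" using y' x unfolding has_ac_deriv_def by blast
    also have "(LINT s|lebesgue_on {0<..<x}. y'' s) = (LINT s|lebesgue_on {0<..<x}. (p s - lam) * y s)"
      using x by (intro integral_cong_AE AEx mx borel_measurable_integrable[OF ix]) auto
    also have "\<dots> = (LINT s:{0<..<x}|lborel. (p s - lam) * y s)"
      using m2[of x] x by (simp add: lebesgue_on_iff_lborel)
    finally show "y' x = y' 0 + (LINT s:{0<..<x}|lborel. (p s - lam) * y s)" .
  qed
qed

lemma ivp_imp_sl_solution:
  assumes d: "d > 0" and qp: "AE x in lebesgue_on {0<..<d}. q x = p x"
    and ivp: "ivp d p lam u v y y'"
  shows "sl_solution d q lam y y'" "y 0 = u" "y' 0 = v"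
proof -
  note i = ivp[unfolded ivp_def]
  have "0 \<in> {0..d}" using d by simp
  then show 0: "y 0 = u" "y' 0 = v" using i by (auto simp: set_lebesgue_integral_def)
  have m: "(\<lambda>s. indicator {0<..<x} s *\<^sub>R f s) \<in> borel_measurable borel"
    if "set_integrable lborel {0<..<d} f" "x \<le> d" for x and f :: "real \<Rightarrow> complex"
  proof -
    \<comment> \<open>Measurability of f is known only after truncation to (0, d), so the smaller
      truncation is applied on top of that one.\<close>
    have "(\<lambda>s. indicator {0<..<x} s *\<^sub>R (indicator {0<..<d} s *\<^sub>R f s)) \<in> borel_measurable borel"
      by (rule borel_measurable_scaleR)
        (use borel_measurable_integrable[OF that(1)[unfolded set_integrable_def]] in simp_all)
    also have "(\<lambda>s. indicator {0<..<x} s *\<^sub>R (indicator {0<..<d} s *\<^sub>R f s)) = (\<lambda>s. indicator {0<..<x} s *\<^sub>R f s)"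
      using that(2) by (auto simp: indicator_def fun_eq_iff)
    finally show ?thesis .
  qed
  have ac: "has_ac_deriv d g f" if f: "set_integrable lborel {0<..<d} f"
    and g: "\<And>x. x \<in> {0..d} \<Longrightarrow> g x = g 0 + (LINT s:{0<..<x}|lborel. f s)" for f g
    unfolding has_ac_deriv_def
  proof (intro conjI ballI)
    show "integrable (lebesgue_on {0<..<d}) f" using f m[OF f, of d] by (simp add: lebesgue_on_iff_lborel)
    fix x assume x: "x \<in> {0..d}"
    have "(LINT t|lebesgue_on {0<..<x}. f t) = (LINT s:{0<..<x}|lborel. f s)"
      using m[OF f, of x] x by (simp add: lebesgue_on_iff_lborel)
    then show "g x = g 0 + (LINT t|lebesgue_on {0<..<x}. f t)" using g[OF x] by metis
  qed
  show "sl_solution d q lam y y'" unfolding sl_solution_def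
  proof (intro exI conjI)
    show "has_ac_deriv d y y'" using i 0 by (intro ac) auto
    show "has_ac_deriv d y' (\<lambda>s. (p s - lam) * y s)" using i 0 by (intro ac) auto
    show "AE x in lebesgue_on {0<..<d}. - ((p x - lam) * y x) + q x * y x = lam * y x"
      using qp by eventually_elim (simp add: algebra_simps)
  qed
qed

text \<open>This makes the definite descriptions evaluable: the \<open>ivp\<close> solution is a
  witness, and every competitor solves the same \<open>ivp\<close> and hence agrees with it on
  [0, d].\<close>

lemma sl_sol_eq:
  assumes d: "d > 0" and p: "potential d p" and qp: "AE x in lebesgue_on {0<..<d}. q x = p x"
    and ivp: "ivp d p lam u v y y'" and x: "x \<in> {0..d}"
  shows "sl_sol d q lam u v x = y x" "sl_sol_deriv d q lam u v x = y' x"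
proof -
  note ex = ivp_imp_sl_solution[OF d qp ivp]
  have un: "z x = y x \<and> z' x = y' x" if "sl_solution d q lam z z'" "z 0 = u" "z' 0 = v" for z z'
    using ivp_unique[OF p sl_solution_imp_ivp[OF p qp that(1)]] ivp x that(2,3) by blast
  show "sl_sol d q lam u v x = y x" unfolding sl_sol_def
    by (rule the_equality) (use ex un in blast)+
  show "sl_sol_deriv d q lam u v x = y' x" unfolding sl_sol_deriv_def
    by (rule the_equality) (use ex un in blast)+
qed

section \<open>Holomorphic dependence on a parameter\<close>

text \<open>A derivative is the pointwise limit of difference quotients with steps 1/(i + 1); the
  induction passes from one order to the next because z is kept arbitrary.\<close>

lemma higher_deriv_measurable:
  fixes f :: "complex \<Rightarrow> 'a \<Rightarrow> complex"
  assumes hol: "\<And>s. (\<lambda>l. f l s) holomorphic_on UNIV"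
    and meas: "\<And>l. f l \<in> borel_measurable M"
  shows "(\<lambda>s. (deriv ^^ n) (\<lambda>l. f l s) z) \<in> borel_measurable M"
proof (induction n arbitrary: z)
  case (Suc n)
  let ?D = "\<lambda>z s. (deriv ^^ n) (\<lambda>l. f l s) z"
  show ?case
  proof (rule borel_measurable_LIMSEQ_metric)
    show "(\<lambda>s. (?D (z + of_real (inverse (real (Suc i)))) s - ?D z s) / of_real (inverse (real (Suc i)))) \<in> borel_measurable M" for i
      using Suc.IH by (intro borel_measurable_divide borel_measurable_diff) auto
    fix s
    have "(\<lambda>l. ?D l s) holomorphic_on UNIV" using hol by (intro holomorphic_higher_deriv) auto
    then have "((\<lambda>l. ?D l s) has_field_derivative deriv (\<lambda>l. ?D l s) z) (at z)"
      by (rule holomorphic_derivI) auto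
    then have "((\<lambda>h. (?D (z + h) s - ?D z s) / h) \<longlongrightarrow> deriv (\<lambda>l. ?D l s) z) (at 0)"
      by (simp add: DERIV_def)
    moreover have "filterlim (\<lambda>i. of_real (inverse (real (Suc i))) :: complex) (at 0) sequentially"
    proof (rule filterlim_atI)
      show "(\<lambda>i. of_real (inverse (real (Suc i))) :: complex) \<longlonglongrightarrow> 0"
        using tendsto_of_real[OF LIMSEQ_inverse_real_of_nat, where 'a = complex] by (simp only: of_real_0)
    qed (simp del: of_nat_Suc)
    ultimately have "(\<lambda>i. (?D (z + of_real (inverse (real (Suc i)))) s - ?D z s) / of_real (inverse (real (Suc i)))) \<longlonglongrightarrow> deriv (\<lambda>l. ?D l s) z"
      by (rule filterlim_compose)
    then show "(\<lambda>i. (?D (z + of_real (inverse (real (Suc i)))) s - ?D z s) / of_real (inverse (real (Suc i)))) \<longlonglongrightarrow> (deriv ^^ Suc n) (\<lambda>l. f l s) z"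
      by simp
  qed
qed (use meas in simp)

text \<open>Each integrand is expanded around z. Domination on the circle of radius 2 and Cauchy's
  inequality bound the terms by g (1/2)^n on the unit ball, so the series may be integrated term by
  term. This gives holomorphy and, by uniqueness of power series coefficients, the
  derivatives.\<close>

lemma parameter_integral:
  fixes f :: "complex \<Rightarrow> 'a \<Rightarrow> complex"
  assumes hol: "\<And>s. (\<lambda>l. f l s) holomorphic_on UNIV"
    and meas: "\<And>l. f l \<in> borel_measurable M"
    and bound: "\<And>R. \<exists>g. integrable M g \<and> (\<forall>l s. norm l \<le> R \<longrightarrow> norm (f l s) \<le> g s)"
  shows parameter_integral_holomorphic: "(\<lambda>l. LINT s|M. f l s) holomorphic_on UNIV"
    and parameter_integral_higher_deriv:
      "(deriv ^^ n) (\<lambda>l. LINT s|M. f l s) z = (LINT s|M. (deriv ^^ n) (\<lambda>l. f l s) z)"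
proof -
  define D where "D n z s = (deriv ^^ n) (\<lambda>l. f l s) z" for n z s
  define F where "F l = (LINT s|M. f l s)" for l
  have Dm: "D n z \<in> borel_measurable M" for n z
    unfolding D_def using higher_deriv_measurable[OF hol meas] .
  have sums: "(\<lambda>n. (LINT s|M. D n z s) / fact n * (w - z) ^ n) sums F w" if w: "w \<in> ball z 1" for z w
  proof -
    obtain g where g: "integrable M g" and gb: "\<And>l s. norm l \<le> norm z + 2 \<Longrightarrow> norm (f l s) \<le> g s"
      using bound[of "norm z + 2"] by auto
    have Db: "norm (D n z s) \<le> fact n * g s / 2 ^ n" for n s
      unfolding D_def
    proof (rule Cauchy_inequality)
      show "(\<lambda>l. f l s) holomorphic_on ball z 2" "continuous_on (cball z 2) (\<lambda>l. f l s)"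
        using hol[of s] by (auto intro: holomorphic_on_subset holomorphic_on_imp_continuous_on)
      show "norm (f x s) \<le> g s" if "norm (z - x) = 2" for x
        using norm_triangle_ineq4[of z "z - x"] that by (intro gb) auto
    qed auto
    let ?t = "\<lambda>n s. D n z s / fact n * (w - z) ^ n"
    have tb: "norm (?t n s) \<le> g s * (1/2) ^ n" for n s
    proof -
      have "norm (w - z) \<le> 1" using w by (simp add: dist_norm norm_minus_commute)
      then have "norm (?t n s) \<le> norm (D n z s) / fact n * 1"
        unfolding norm_mult norm_divide norm_power by (intro mult_mono) (auto simp: power_le_one)
      also have "\<dots> \<le> (fact n * g s / 2 ^ n) / fact n * 1" using Db by (intro mult_right_mono divide_right_mono) auto
      finally show ?thesis by (simp add: power_divide)
    qed
    have gs: "summable (\<lambda>n. g s * (1/2) ^ n)" for s by (intro summable_mult summable_geometric) auto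
    have ti: "integrable M (?t n)" for n
    proof (rule integrable_norm_bound)
      show "integrable M (\<lambda>s. g s * (1/2) ^ n)" using g by simp
      show "?t n \<in> borel_measurable M" using Dm[of n z] by simp
      show "norm (?t n s) \<le> g s * (1/2) ^ n" for s by (rule tb)
    qed
    have "(\<lambda>n. LINT s|M. ?t n s) sums (LINT s|M. (\<Sum>n. ?t n s))"
    proof (rule sums_integral[OF ti])
      show "AE s in M. summable (\<lambda>n. norm (?t n s))"
      proof (intro AE_I2)
        show "summable (\<lambda>n. norm (?t n s))" for s
          by (rule summable_comparison_test'[OF gs[of s], of 0]) (use tb in simp)
      qed
      have le: "(LINT s|M. norm (?t n s)) \<le> (LINT s|M. g s) * (1/2) ^ n" for n
      proof -
        have "(LINT s|M. norm (?t n s)) \<le> (LINT s|M. g s * (1/2) ^ n)"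
          by (rule integral_mono) (use ti g tb in auto)
        then show ?thesis by simp
      qed
      show "summable (\<lambda>n. LINT s|M. norm (?t n s))"
        by (rule summable_comparison_test'[of "\<lambda>n. (LINT s|M. g s) * (1/2) ^ n" 0])
          (use le in \<open>auto intro!: summable_mult summable_geometric\<close>)
    qed
    moreover have "(\<Sum>n. ?t n s) = f w s" for s
    proof -
      have "(\<lambda>n. ?t n s) sums f w s"
        unfolding D_def
        by (rule holomorphic_power_series[OF holomorphic_on_subset[OF hol] w]) auto
      then show ?thesis by (simp add: sums_iff)
    qed
    moreover have "(LINT s|M. ?t n s) = (LINT s|M. D n z s) / fact n * (w - z) ^ n" for n
      by simp
    ultimately show ?thesis by (simp only: F_def)
  qed
  have "F holomorphic_on ball z 1" for z
    by (rule power_series_holomorphic[where a = "\<lambda>n. (LINT s|M. D n z s) / fact n"]) (rule sums)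
  then have "F field_differentiable at z" for z
    by (rule holomorphic_on_imp_differentiable_at[where s = "ball z 1"]) auto
  then have hF: "F holomorphic_on UNIV" by (simp add: holomorphic_on_def)
  then show "(\<lambda>l. LINT s|M. f l s) holomorphic_on UNIV" by (simp add: F_def[abs_def])
  have near: "eventually (\<lambda>u::complex. z + u \<in> ball z 1) (nhds 0)"
    by (rule eventually_mono[OF eventually_nhds_in_open[of "ball 0 1"]]) (auto simp: dist_norm)
  have e1: "(\<lambda>u. F (z + u)) has_fps_expansion Abs_fps (\<lambda>n. (LINT s|M. D n z s) / fact n)"
  proof (rule has_fps_expansionI)
    show "\<forall>\<^sub>F u in nhds 0. (\<lambda>n. fps_nth (Abs_fps (\<lambda>n. (LINT s|M. D n z s) / fact n)) n * u ^ n) sums F (z + u)"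
      using near by eventually_elim (drule sums, simp)
  qed
  have e2: "(\<lambda>u. F (z + u)) has_fps_expansion Abs_fps (\<lambda>n. (deriv ^^ n) F z / fact n)"
  proof (rule has_fps_expansionI)
    show "\<forall>\<^sub>F u in nhds 0. (\<lambda>n. fps_nth (Abs_fps (\<lambda>n. (deriv ^^ n) F z / fact n)) n * u ^ n) sums F (z + u)"
      using near
    proof eventually_elim
      case (elim u)
      from holomorphic_power_series[OF holomorphic_on_subset[OF hF subset_UNIV] this] show ?case by simp
    qed
  qed
  have "(LINT s|M. D n z s) / fact n = (deriv ^^ n) F z / fact n"
    using fps_nth_fps_expansion[OF e1, of n] fps_nth_fps_expansion[OF e2, of n] by simp
  then show "(deriv ^^ n) (\<lambda>l. LINT s|M. f l s) z = (LINT s|M. (deriv ^^ n) (\<lambda>l. f l s) z)"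
    by (simp add: D_def F_def[abs_def])
qed

section \<open>Zeros of products and elimination of the matching data\<close>

lemma higher_deriv_mult_zero:
  assumes f: "f holomorphic_on UNIV" and g: "g holomorphic_on UNIV"
    and z: "\<And>j. j < m \<Longrightarrow> (deriv ^^ j) f z = 0" and k: "k < m"
  shows "(deriv ^^ k) (\<lambda>l. g l * f l) z = 0"
proof -
  have "(deriv ^^ k) (\<lambda>l. g l * f l) z
      = (\<Sum>i = 0..k. of_nat (k choose i) * (deriv ^^ i) g z * (deriv ^^ (k - i)) f z)"
    by (rule higher_deriv_mult[OF g f]) auto
  also have "\<dots> = 0" using z k by (intro sum.neutral) auto
  finally show ?thesis .
qed

text \<open>In Leibniz's formula every term except i = 0 contains a lower derivative of f, zero by
  induction, so \<open>g z\<close> times the kth derivative is all that remains.\<close>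

lemma higher_deriv_mult_cancel:
  assumes f: "f holomorphic_on UNIV" and g: "g holomorphic_on UNIV" and gz: "g z \<noteq> 0"
    and z: "\<And>j. j < m \<Longrightarrow> (deriv ^^ j) (\<lambda>l. g l * f l) z = 0"
  shows "k < m \<Longrightarrow> (deriv ^^ k) f z = 0"
proof (induction k rule: less_induct)
  case (less k)
  have "0 = (\<Sum>i = 0..k. of_nat (k choose i) * (deriv ^^ i) g z * (deriv ^^ (k - i)) f z)"
    using z[OF less.prems] higher_deriv_mult[OF g f, of z k] by simp
  also have "\<dots> = (\<Sum>i\<in>{0}. of_nat (k choose i) * (deriv ^^ i) g z * (deriv ^^ (k - i)) f z)"
    using less by (intro sum.mono_neutral_right) auto
  also have "\<dots> = g z * (deriv ^^ k) f z" by simp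
  finally show ?case using gz by simp
qed

text \<open>Cramer's rule: eliminating one of g0, g1 from the two characteristic functions leaves
  the Wronskian times the other one, and this combination vanishes to order m. The factor that is
  nonzero at z is then cancelled; arguing with derivatives keeps the multiplicities.\<close>

lemma higher_deriv_wronskian_zero:
  fixes \<phi>0 \<phi>1 \<chi>0 \<chi>1 g0 g1 :: "complex \<Rightarrow> complex"
  assumes hol: "\<phi>0 holomorphic_on UNIV" "\<phi>1 holomorphic_on UNIV" "\<chi>0 holomorphic_on UNIV"
      "\<chi>1 holomorphic_on UNIV" "g0 holomorphic_on UNIV" "g1 holomorphic_on UNIV"
    and g: "g0 z \<noteq> 0 \<or> g1 z \<noteq> 0"
    and z1: "\<And>j. j < m \<Longrightarrow> (deriv ^^ j) (\<lambda>l. \<phi>0 l * g1 l - \<phi>1 l * g0 l) z = 0"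
    and z2: "\<And>j. j < m \<Longrightarrow> (deriv ^^ j) (\<lambda>l. \<chi>0 l * g1 l - \<chi>1 l * g0 l) z = 0"
    and k: "k < m"
  shows "(deriv ^^ k) (\<lambda>l. \<phi>0 l * \<chi>1 l - \<phi>1 l * \<chi>0 l) z = 0"
proof -
  let ?A = "\<lambda>l. \<phi>0 l * g1 l - \<phi>1 l * g0 l" and ?B = "\<lambda>l. \<chi>0 l * g1 l - \<chi>1 l * g0 l"
  let ?W = "\<lambda>l. \<phi>0 l * \<chi>1 l - \<phi>1 l * \<chi>0 l"
  have hA: "?A holomorphic_on UNIV" and hB: "?B holomorphic_on UNIV" and hW: "?W holomorphic_on UNIV"
    using hol by (auto intro!: holomorphic_intros)
  have comb: "(deriv ^^ j) (\<lambda>l. a l * ?A l - b l * ?B l) z = 0"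
    if "j < m" "a holomorphic_on UNIV" "b holomorphic_on UNIV" for a b j
  proof -
    have "(deriv ^^ j) (\<lambda>l. a l * ?A l - b l * ?B l) z
       = (deriv ^^ j) (\<lambda>l. a l * ?A l) z - (deriv ^^ j) (\<lambda>l. b l * ?B l) z"
      by (rule higher_deriv_diff[where S = UNIV]) (use that hA hB in \<open>auto intro!: holomorphic_on_mult\<close>)
    then show ?thesis
      using higher_deriv_mult_zero[OF hA that(2) z1 that(1)] higher_deriv_mult_zero[OF hB that(3) z2 that(1)] by simp
  qed
  show ?thesis
  proof (cases "g1 z = 0")
    case False
    have "(\<lambda>l. \<chi>1 l * ?A l - \<phi>1 l * ?B l) = (\<lambda>l. g1 l * ?W l)" by (simp add: algebra_simps)
    then have "\<And>j. j < m \<Longrightarrow> (deriv ^^ j) (\<lambda>l. g1 l * ?W l) z = 0"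
      using comb[OF _ hol(4) hol(2)] by simp
    then show ?thesis using higher_deriv_mult_cancel[OF hW hol(6) False] k by blast
  next
    case True
    then have nz: "g0 z \<noteq> 0" using g by simp
    have "(\<lambda>l. \<chi>0 l * ?A l - \<phi>0 l * ?B l) = (\<lambda>l. g0 l * ?W l)" by (simp add: algebra_simps)
    then have "\<And>j. j < m \<Longrightarrow> (deriv ^^ j) (\<lambda>l. g0 l * ?W l) z = 0"
      using comb[OF _ hol(3) hol(1)] by simp
    then show ?thesis using higher_deriv_mult_cancel[OF hW hol(5) nz] k by blast
  qed
qed

section \<open>The Wronskian and products of cosine transforms\<close>

lemma integral_Ioc_eq_Ioo:
  fixes f :: "real \<Rightarrow> complex"
  assumes "f \<in> borel_measurable borel"
  shows "(LINT s:{a<..b}|lborel. f s) = (LINT s:{a<..<b}|lborel. f s)"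
  unfolding set_lebesgue_integral_def
proof (rule integral_cong_AE)
  show "AE s in lborel. indicator {a<..b} s *\<^sub>R f s = indicator {a<..<b} s *\<^sub>R f s"
    using AE_lborel_singleton[of b] by eventually_elim (auto simp: indicator_def)
qed (use assms in auto)

text \<open>The product of the total integrals is an integral over the square. Splitting the square
  along the diagonal and integrating out one variable in each half gives the two terms of the
  product rule, for functions that are only absolutely continuous.\<close>

lemma ac_product_rule:
  fixes f f' g g' :: "real \<Rightarrow> complex"
  assumes f': "set_integrable lborel {0<..<d} f'" and g': "set_integrable lborel {0<..<d} g'"
    and f: "\<And>x. x \<in> {0..d} \<Longrightarrow> f x = f0 + (LINT s:{0<..<x}|lborel. f' s)"
    and g: "\<And>x. x \<in> {0..d} \<Longrightarrow> g x = g0 + (LINT s:{0<..<x}|lborel. g' s)"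
    and d: "d \<ge> 0"
  shows "set_integrable lborel {0<..<d} (\<lambda>s. f' s * g s + f s * g' s)"
    and "f d * g d = f0 * g0 + (LINT s:{0<..<d}|lborel. f' s * g s + f s * g' s)"
proof -
  define F where "F s = indicator {0<..<d} s *\<^sub>R f' s" for s
  define G where "G s = indicator {0<..<d} s *\<^sub>R g' s" for s
  have F: "integrable lborel F" and G: "integrable lborel G"
    using f' g' by (simp_all add: set_integrable_def F_def[abs_def] G_def[abs_def])
  then have [measurable]: "F \<in> borel_measurable borel" "G \<in> borel_measurable borel" by auto
  have F0: "F s = 0" "G s = 0" if "s \<notin> {0<..<d}" for s using that by (auto simp: F_def G_def)
  have fF: "(LINT s:{0<..<x}|lborel. F s) = f x - f0" "(LINT s:{0<..<x}|lborel. G s) = g x - g0" if x: "x \<in> {0..d}" for x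
  proof -
    have "(LINT s:{0<..<x}|lborel. F s) = (LINT s:{0<..<x}|lborel. f' s)"
      by (rule set_integral_cong_Ioo(1)) (use x in \<open>auto simp: F_def\<close>)
    moreover have "(LINT s:{0<..<x}|lborel. G s) = (LINT s:{0<..<x}|lborel. g' s)"
      by (rule set_integral_cong_Ioo(1)) (use x in \<open>auto simp: G_def\<close>)
    ultimately show "(LINT s:{0<..<x}|lborel. F s) = f x - f0" "(LINT s:{0<..<x}|lborel. G s) = g x - g0"
      using f[OF x] g[OF x] by simp_all
  qed
  have P: "integrable (lborel \<Otimes>\<^sub>M lborel) (\<lambda>(s, r). F s * G r)"
    by (rule lborel_pair.integrable_mult_product[OF F G])
  let ?h = "\<lambda>s r. if s < r then F s * G r else 0"
  let ?k = "\<lambda>s r. if s < r then 0 else F s * G r"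
  have h: "integrable (lborel \<Otimes>\<^sub>M lborel) (\<lambda>(s, r). ?h s r)"
    by (rule Bochner_Integration.integrable_bound[OF P]) auto
  have k: "integrable (lborel \<Otimes>\<^sub>M lborel) (\<lambda>(s, r). ?k s r)"
    by (rule Bochner_Integration.integrable_bound[OF P]) auto
  have hr: "(LINT s|lborel. ?h s r) = (f r - f0) * G r" for r
  proof (cases "r \<in> {0<..<d}")
    case True
    have "(LINT s|lborel. ?h s r) = (LINT s:{0<..<r}|lborel. F s * G r)"
      unfolding set_lebesgue_integral_def using F0(1)
      by (intro Bochner_Integration.integral_cong) (auto simp: indicator_def)
    then show ?thesis using True fF(1)[of r] by simp
  next
    case False
    then have z: "?h s r = 0" for s by (simp add: F0)
    show ?thesis unfolding z using False by (simp add: F0)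
  qed
  have ks: "(LINT r|lborel. ?k s r) = F s * (g s - g0)" for s
  proof (cases "s \<in> {0<..<d}")
    case True
    have "(LINT r|lborel. ?k s r) = (LINT r:{0<..s}|lborel. F s * G r)"
      unfolding set_lebesgue_integral_def using F0(2)
      by (intro Bochner_Integration.integral_cong) (auto simp: indicator_def)
    also have "\<dots> = F s * (LINT r:{0<..<s}|lborel. G r)" by (simp add: integral_Ioc_eq_Ioo)
    finally show ?thesis using True fF(2)[of s] by simp
  next
    case False
    then have z: "?k s r = 0" for r by (simp add: F0)
    show ?thesis unfolding z using False by (simp add: F0)
  qed
  have ih: "integrable lborel (\<lambda>r. (f r - f0) * G r)"
    using lborel_pair.integrable_snd[of ?h] h by (simp add: split_def hr)
  have ik: "integrable lborel (\<lambda>s. F s * (g s - g0))"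
    using lborel_pair.integrable_fst[of ?k] k by (simp add: split_def ks)
  have "(LINT s|lborel. F s) * (LINT r|lborel. G r) = (LINT z|(lborel \<Otimes>\<^sub>M lborel). F (fst z) * G (snd z))"
    by (rule lborel_pair.integral_mult_product[OF F G, symmetric])
  also have "\<dots> = (LINT z|(lborel \<Otimes>\<^sub>M lborel). (case z of (s, r) \<Rightarrow> ?h s r) + (case z of (s, r) \<Rightarrow> ?k s r))"
    by (intro Bochner_Integration.integral_cong) auto
  also have "\<dots> = (LINT z|(lborel \<Otimes>\<^sub>M lborel). (case z of (s, r) \<Rightarrow> ?h s r)) + (LINT z|(lborel \<Otimes>\<^sub>M lborel). (case z of (s, r) \<Rightarrow> ?k s r))"
    by (rule Bochner_Integration.integral_add[OF h k])
  also have "(LINT z|(lborel \<Otimes>\<^sub>M lborel). (case z of (s, r) \<Rightarrow> ?h s r)) = (LINT r|lborel. (f r - f0) * G r)"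
    using lborel_pair.integral_snd[of ?h] h by (simp only: hr)
  also have "(LINT z|(lborel \<Otimes>\<^sub>M lborel). (case z of (s, r) \<Rightarrow> ?k s r)) = (LINT s|lborel. F s * (g s - g0))"
    using lborel_pair.integral_fst[of ?k] k by (simp only: ks)
  also have Fd: "(LINT s|lborel. F s) = f d - f0"
  proof -
    have "(LINT s|lborel. F s) = (LINT s:{0<..<d}|lborel. F s)"
      unfolding set_lebesgue_integral_def
      by (intro Bochner_Integration.integral_cong) (auto simp: F_def indicator_def)
    then show ?thesis using fF(1)[of d] d by simp
  qed
  also have Gd: "(LINT r|lborel. G r) = g d - g0"
  proof -
    have "(LINT s|lborel. G s) = (LINT s:{0<..<d}|lborel. G s)"
      unfolding set_lebesgue_integral_def
      by (intro Bochner_Integration.integral_cong) (auto simp: G_def indicator_def)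
    then show ?thesis using fF(2)[of d] d by simp
  qed
  finally have E: "(f d - f0) * (g d - g0) = (LINT r|lborel. (f r - f0) * G r) + (LINT s|lborel. F s * (g s - g0))" .
  have pt: "(f r - f0) * G r + F r * (g r - g0) + (f0 * G r + F r * g0)
     = indicator {0<..<d} r *\<^sub>R (f' r * g r + f r * g' r)" for r
    by (auto simp: indicator_def F_def G_def algebra_simps)
  have ia: "integrable lborel (\<lambda>r. (f r - f0) * G r + F r * (g r - g0))"
    by (rule Bochner_Integration.integrable_add[OF ih ik])
  have ib: "integrable lborel (\<lambda>r. f0 * G r + F r * g0)" using F G by simp
  show "set_integrable lborel {0<..<d} (\<lambda>s. f' s * g s + f s * g' s)"
    using Bochner_Integration.integrable_add[OF ia ib] by (simp only: pt set_integrable_def)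
  have "(LINT s:{0<..<d}|lborel. f' s * g s + f s * g' s)
     = (LINT r|lborel. (f r - f0) * G r + F r * (g r - g0)) + (LINT r|lborel. f0 * G r + F r * g0)"
    using Bochner_Integration.integral_add[OF ia ib] by (simp only: pt set_lebesgue_integral_def)
  also have "\<dots> = (f d - f0) * (g d - g0) + (f0 * (LINT r|lborel. G r) + (LINT r|lborel. F r) * g0)"
    using E F G by (simp add: Bochner_Integration.integral_add[OF ih ik])
  also have "(LINT r|lborel. G r) = g d - g0" by (rule Gd)
  also have "(LINT r|lborel. F r) = f d - f0" by (rule Fd)
  finally show "f d * g d = f0 * g0 + (LINT s:{0<..<d}|lborel. f' s * g s + f s * g' s)"
    by (simp add: algebra_simps)
qed

text \<open>Lagrange's identity: the products \<open>y' s * z' s\<close> and the spectral parameter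
  cancel. With two potentials it represents the Wronskian; with equal potentials it says that the
  Wronskian is constant.\<close>

lemma ivp_wronskian:
  assumes y: "ivp d q lam u v y y'" and z: "ivp d r lam w x z z'" and d: "d \<ge> 0"
  shows "y d * z' d - y' d * z d = u * x - v * w + (LINT s:{0<..<d}|lborel. (r s - q s) * (y s * z s))"
proof -
  have yi: "set_integrable lborel {0<..<d} y'" "set_integrable lborel {0<..<d} (\<lambda>s. (q s - lam) * y s)"
    and zi: "set_integrable lborel {0<..<d} z'" "set_integrable lborel {0<..<d} (\<lambda>s. (r s - lam) * z s)"
    using y z by (simp_all add: ivp_def)
  have yb: "\<And>x. x \<in> {0..d} \<Longrightarrow> y x = u + (LINT s:{0<..<x}|lborel. y' s)"
    "\<And>x. x \<in> {0..d} \<Longrightarrow> y' x = v + (LINT s:{0<..<x}|lborel. (q s - lam) * y s)"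
    using y unfolding ivp_def by meson+
  have zb: "\<And>t. t \<in> {0..d} \<Longrightarrow> z t = w + (LINT s:{0<..<t}|lborel. z' s)"
    "\<And>t. t \<in> {0..d} \<Longrightarrow> z' t = x + (LINT s:{0<..<t}|lborel. (r s - lam) * z s)"
    using z unfolding ivp_def by meson+
  note A = ac_product_rule[OF yi(1) zi(2) yb(1) zb(2) d]
  note B = ac_product_rule[OF yi(2) zi(1) yb(2) zb(1) d]
  have "y d * z' d - y' d * z d = u * x - v * w + ((LINT s:{0<..<d}|lborel. y' s * z' s + y s * ((r s - lam) * z s))
      - (LINT s:{0<..<d}|lborel. (q s - lam) * y s * z s + y' s * z' s))"
    using A(2) B(2) by simp
  also have "(LINT s:{0<..<d}|lborel. y' s * z' s + y s * ((r s - lam) * z s))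
      - (LINT s:{0<..<d}|lborel. (q s - lam) * y s * z s + y' s * z' s)
    = (LINT s:{0<..<d}|lborel. (y' s * z' s + y s * ((r s - lam) * z s)) - ((q s - lam) * y s * z s + y' s * z' s))"
    by (rule set_integral_diff(2)[OF A(1) B(1), symmetric])
  also have "\<dots> = (LINT s:{0<..<d}|lborel. (r s - q s) * (y s * z s))"
    by (simp add: algebra_simps)
  finally show ?thesis .
qed

section \<open>Cosine transforms of bounded densities and their products\<close>

definition bounded_support :: "real \<Rightarrow> real \<Rightarrow> (real \<Rightarrow> complex) \<Rightarrow> bool" where
  "bounded_support K R k \<longleftrightarrow> k \<in> borel_measurable borel \<and> (\<forall>t. norm (k t) \<le> K) \<and> (\<forall>t. R \<le> \<bar>t\<bar> \<longrightarrow> k t = 0)"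

lemma bounded_support_le:
  assumes "bounded_support K R k"
  shows "norm (k t) \<le> K * indicator {-R<..<R} t" "K \<ge> 0"
proof -
  show "K \<ge> 0" using assms norm_ge_zero order_trans unfolding bounded_support_def by blast
  show "norm (k t) \<le> K * indicator {-R<..<R} t"
  proof (cases "t \<in> {-R<..<R}")
    case False
    then have "R \<le> \<bar>t\<bar>" by auto
    then show ?thesis using assms False by (simp add: bounded_support_def)
  qed (use assms in \<open>simp add: bounded_support_def\<close>)
qed

lemma bounded_support_integrable:
  assumes k: "bounded_support K R k"
  shows "integrable lborel k" "integrable lborel (\<lambda>t. k t * cosl lam t)"
proof -
  have [measurable]: "k \<in> borel_measurable borel" using k by (simp add: bounded_support_def)
  show "integrable lborel k"
  proof (rule integrable_norm_bound)
    show "integrable lborel (\<lambda>t. K * indicator {-R<..<R} t :: real)" by simp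
    show "norm (k t) \<le> K * indicator {-R<..<R} t" for t by (rule bounded_support_le(1)[OF k])
  qed simp
  show "integrable lborel (\<lambda>t. k t * cosl lam t)"
  proof (rule integrable_norm_bound)
    let ?E = "exp (sqrt (norm lam) * R)"
    show "integrable lborel (\<lambda>t. (K * ?E) * indicator {-R<..<R} t :: real)" by simp
    show "norm (k t * cosl lam t) \<le> (K * ?E) * indicator {-R<..<R} t" for t
    proof (cases "t \<in> {-R<..<R}")
      case True
      then have "\<bar>t\<bar> \<le> R" by auto
      then show ?thesis
        using bounded_support_le(1)[OF k, of t] bounded_support_le(2)[OF k] True norm_cosl_le[of lam "norm lam" t R] by (simp add: norm_mult mult_mono)
    next
      case False
      then show ?thesis using bounded_support_le(1)[OF k, of t] by simp
    qed
  qed simp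
qed

text \<open>The product formula for cosines followed by a shift of variable averages the translates
  of k by x and -x; translation widens the support by |x|.\<close>

lemma cosl_times_integral:
  assumes k: "bounded_support K R k"
  shows "cosl lam x * (LINT t|lborel. k t * cosl lam t) = (LINT t|lborel. (k (t - x) + k (t + x)) / 2 * cosl lam t)"
    and "bounded_support K (R + \<bar>x\<bar>) (\<lambda>t. (k (t - x) + k (t + x)) / 2)"
proof -
  have km [measurable]: "k \<in> borel_measurable borel" using k by (simp add: bounded_support_def)
  show bs: "bounded_support K (R + \<bar>x\<bar>) (\<lambda>t. (k (t - x) + k (t + x)) / 2)"
    unfolding bounded_support_def
  proof (intro conjI allI impI)
    show "norm ((k (t - x) + k (t + x)) / 2) \<le> K" for t
    proof -
      have "norm (k (t - x)) \<le> K" "norm (k (t + x)) \<le> K" using k by (auto simp: bounded_support_def)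
      then have "norm (k (t - x) + k (t + x)) \<le> K + K" by (rule norm_triangle_mono)
      then show ?thesis by (simp add: norm_divide)
    qed
    show "(k (t - x) + k (t + x)) / 2 = 0" if "R + \<bar>x\<bar> \<le> \<bar>t\<bar>" for t
    proof -
      have "R \<le> \<bar>t - x\<bar>" "R \<le> \<bar>t + x\<bar>" using that by linarith+
      then show ?thesis using k by (simp add: bounded_support_def)
    qed
  qed measurable
  have sh: "bounded_support K (R + \<bar>y\<bar>) (\<lambda>t. k (t + y))" for y
    unfolding bounded_support_def
  proof (intro conjI allI impI)
    show "k (t + y) = 0" if "R + \<bar>y\<bar> \<le> \<bar>t\<bar>" for t
    proof -
      have "R \<le> \<bar>t + y\<bar>" using that by linarith
      then show ?thesis using k by (simp add: bounded_support_def)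
    qed
  qed (use k in \<open>auto simp: bounded_support_def\<close>)
  have tr: "(LINT t|lborel. k t * cosl lam (t - y)) = (LINT t|lborel. k (t + y) * cosl lam t)"
    "integrable lborel (\<lambda>t. k t * cosl lam (t - y))" for y
  proof -
    show "(LINT t|lborel. k t * cosl lam (t - y)) = (LINT t|lborel. k (t + y) * cosl lam t)"
      using lborel_integral_real_affine[of 1 "\<lambda>t. k t * cosl lam (t - y)" y] by (simp add: add.commute)
    have "integrable lborel (\<lambda>t. k (t + y) * cosl lam t)" by (rule bounded_support_integrable(2)[OF sh])
    then have "integrable lborel (\<lambda>t. k ((-y + 1 * t) + y) * cosl lam (-y + 1 * t))"
      by (rule lborel_integrable_real_affine) simp
    then show "integrable lborel (\<lambda>t. k t * cosl lam (t - y))" by simp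
  qed
  have "cosl lam x * (LINT t|lborel. k t * cosl lam t) = (LINT t|lborel. cosl lam x * (k t * cosl lam t))" by simp
  also have "\<dots> = (LINT t|lborel. k t * cosl lam (t - - x) / 2 + k t * cosl lam (t - x) / 2)"
  proof (intro Bochner_Integration.integral_cong refl)
    fix t
    show "cosl lam x * (k t * cosl lam t) = k t * cosl lam (t - - x) / 2 + k t * cosl lam (t - x) / 2"
    proof -
      have "cosl lam x * (k t * cosl lam t) = k t * (cosl lam t * cosl lam x)" by (simp add: mult_ac)
      also have "\<dots> = k t * cosl lam (t - - x) / 2 + k t * cosl lam (t - x) / 2"
        unfolding cosl_times_cosl by (simp add: field_simps)
      finally show ?thesis .
    qed
  qed
  also have "\<dots> = (LINT t|lborel. k (t + - x) * cosl lam t) / 2 + (LINT t|lborel. k (t + x) * cosl lam t) / 2"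
    using tr(2)[of "-x"] tr(2)[of x] by (simp only: Bochner_Integration.integral_add integral_divide_zero integrable_divide_zero tr(1) simp_thms)
  also have "\<dots> = (LINT t|lborel. k (t + - x) * cosl lam t / 2 + k (t + x) * cosl lam t / 2)"
    using bounded_support_integrable(2)[OF sh, of "-x" lam] bounded_support_integrable(2)[OF sh, of x lam]
    by (simp only: Bochner_Integration.integral_add integral_divide_zero integrable_divide_zero simp_thms)
  also have "\<dots> = (LINT t|lborel. (k (t - x) + k (t + x)) / 2 * cosl lam t)"
    by (simp add: algebra_simps add_divide_distrib)
  finally show "cosl lam x * (LINT t|lborel. k t * cosl lam t) = (LINT t|lborel. (k (t - x) + k (t + x)) / 2 * cosl lam t)" .
qed

text \<open>Superposing \<open>cosl_times_integral\<close> over s with weight l(s) gives a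
  symmetrised convolution. Its bound is \<open>K * L\<close> times the length 2R of the interval
  that carries l.\<close>

lemma integral_times_integral:
  assumes k: "bounded_support K R k" and l: "bounded_support L R l" and R: "R \<ge> 0"
  shows "(LINT t|lborel. k t * cosl lam t) * (LINT s|lborel. l s * cosl lam s)
      = (LINT t|lborel. (LINT s|lborel. (k (t - s) + k (t + s)) / 2 * l s) * cosl lam t)"
    and "bounded_support (2 * R * K * L) (2 * R) (\<lambda>t. LINT s|lborel. (k (t - s) + k (t + s)) / 2 * l s)"
proof -
  have [measurable]: "k \<in> borel_measurable borel" "l \<in> borel_measurable borel"
    using k l by (auto simp: bounded_support_def)
  note K = bounded_support_le(2)[OF k] and L = bounded_support_le(2)[OF l]
  let ?c = "\<lambda>s t. (k (t - s) + k (t + s)) / 2"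
  have cb: "norm (?c s t) \<le> K * indicator {-2*R<..<2*R} t" if s: "\<bar>s\<bar> < R" for s t
  proof (cases "t \<in> {-2*R<..<2*R}")
    case True
    then show ?thesis using cosl_times_integral(2)[OF k, of s] by (simp add: bounded_support_def)
  next
    case False
    then have "R + \<bar>s\<bar> \<le> \<bar>t\<bar>" using s by auto
    then have "?c s t = 0" using cosl_times_integral(2)[OF k, of s] by (simp only: bounded_support_def)
    then show ?thesis using False by simp
  qed
  have clb: "norm (?c s t * l s) \<le> (K * L) * indicator {-R<..<R} s * indicator {-2*R<..<2*R} t" for s t
  proof (cases "s \<in> {-R<..<R}")
    case True
    then have "norm (?c s t * l s) \<le> (K * indicator {-2*R<..<2*R} t) * L"
      unfolding norm_mult using cb[of s t] bounded_support_le(1)[OF l, of s] True K by (intro mult_mono) auto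
    then show ?thesis using True by (simp add: mult_ac)
  next
    case False
    then show ?thesis using bounded_support_le(1)[OF l, of s] by simp
  qed
  show "bounded_support (2 * R * K * L) (2 * R) (\<lambda>t. LINT s|lborel. ?c s t * l s)"
    unfolding bounded_support_def
  proof (intro conjI allI impI)
    fix t
    have i: "integrable lborel (\<lambda>s. (K * L) * indicator {-R<..<R} s :: real)" by simp
    have b: "norm (?c s t * l s) \<le> (K * L) * indicator {-R<..<R} s" for s
      by (rule order_trans[OF clb mult_left_le]) (use K L in \<open>auto simp: indicator_def\<close>)
    have "norm (LINT s|lborel. ?c s t * l s) \<le> (LINT s|lborel. (K * L) * indicator {-R<..<R} s)"
    proof (rule Bochner_Integration.integral_norm_bound_integral[OF _ i b])
      show "integrable lborel (\<lambda>s. ?c s t * l s)"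
        by (rule integrable_norm_bound[OF i _ b]) measurable
    qed
    then show "norm (LINT s|lborel. ?c s t * l s) \<le> 2 * R * K * L" using R by (simp add: mult_ac)
  next
    fix t assume t: "2 * R \<le> \<bar>t\<bar>"
    then have t': "indicator {-2*R<..<2*R} t = (0::real)" by (auto simp: indicator_def)
    have "?c s t * l s = 0" for s
      using clb[where s = s and t = t] unfolding t' by (simp only: mult_zero_right norm_le_zero_iff)
    then show "(LINT s|lborel. ?c s t * l s) = 0" by (simp only: Bochner_Integration.integral_zero)
  qed measurable
  let ?E = "exp (sqrt (norm lam) * (2 * R))"
  have "integrable (lborel \<Otimes>\<^sub>M lborel) (\<lambda>(s, t). ((K * L) * indicator {-R<..<R} s) * (?E * indicator {-2*R<..<2*R} t) :: real)"
    by (intro lborel_pair.integrable_mult_product) auto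
  then have hi: "integrable (lborel \<Otimes>\<^sub>M lborel) (\<lambda>(s, t). ?c s t * l s * cosl lam t)"
  proof (rule integrable_norm_bound)
    have "norm (?c s t * l s * cosl lam t) \<le> ((K * L) * indicator {-R<..<R} s) * (?E * indicator {-2*R<..<2*R} t)" for s t
    proof (cases "t \<in> {-2*R<..<2*R}")
      case True
      then have "\<bar>t\<bar> \<le> 2 * R" by auto
      then have "norm (cosl lam t) \<le> ?E" by (intro norm_cosl_le) auto
      then have "norm (?c s t * l s * cosl lam t) \<le> ((K * L) * indicator {-R<..<R} s * indicator {-2*R<..<2*R} t) * ?E"
        unfolding norm_mult[of "?c s t * l s"] using clb[where s = s and t = t] K L by (intro mult_mono) auto
      then show ?thesis by (simp add: mult_ac)
    next
      case False
      then show ?thesis using clb[where s = s and t = t] by simp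
    qed
    then show "norm (case z of (s, t) \<Rightarrow> ?c s t * l s * cosl lam t)
       \<le> (case z of (s, t) \<Rightarrow> ((K * L) * indicator {-R<..<R} s) * (?E * indicator {-2*R<..<2*R} t))" for z
      by (cases z) (simp only: prod.case)
  qed measurable
  have "(LINT t|lborel. k t * cosl lam t) * (LINT s|lborel. l s * cosl lam s)
      = (LINT s|lborel. l s * (cosl lam s * (LINT t|lborel. k t * cosl lam t)))"
    by (simp add: mult_ac flip: integral_mult_right_zero)
  also have "\<dots> = (LINT s|lborel. (LINT t|lborel. ?c s t * l s * cosl lam t))"
    unfolding cosl_times_integral(1)[OF k] by (simp add: mult_ac flip: integral_mult_right_zero)
  also have "\<dots> = (LINT t|lborel. (LINT s|lborel. ?c s t * l s * cosl lam t))"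
    by (rule lborel_pair.Fubini_integral[symmetric, OF hi])
  finally show "(LINT t|lborel. k t * cosl lam t) * (LINT s|lborel. l s * cosl lam s)
      = (LINT t|lborel. (LINT s|lborel. ?c s t * l s) * cosl lam t)" by simp
qed

lemma kernel_bounded_support:
  assumes F: "kernel_bound B c F" and c: "c \<ge> 0" and x: "0 \<le> x" "x \<le> d"
  shows "bounded_support (B * exp (c * d)) x (\<lambda>t. F (x, t))"
  unfolding bounded_support_def
proof (intro conjI allI impI)
  note [measurable] = kernel_boundD(1)[OF F]
  show "(\<lambda>t. F (x, t)) \<in> borel_measurable borel" by measurable
  show "norm (F (x, t)) \<le> B * exp (c * d)" for t
  proof -
    have "norm (F (x, t)) \<le> B * exp (c * x)" by (rule kernel_boundD(4)[OF F])
    also have "\<dots> \<le> B * exp (c * d)" using c x kernel_boundD(6)[OF F] by (intro mult_left_mono) (auto intro: mult_left_mono)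
    finally show ?thesis .
  qed
  show "F (x, t) = 0" if "x \<le> \<bar>t\<bar>" for t using that by (rule kernel_boundD(5)[OF F])
qed

lemma bounded_support_add:
  assumes "bounded_support K R k" "bounded_support L R l"
  shows "bounded_support (K + L) R (\<lambda>t. k t + l t)"
  using assms by (auto simp: bounded_support_def intro!: norm_triangle_mono)

lemma bounded_support_mono:
  assumes "bounded_support K R k" "K \<le> L" "R \<le> S"
  shows "bounded_support L S k"
  using assms unfolding bounded_support_def by (meson order_trans)

text \<open>Multiplying out (cos + f)(cos + g): the squared cosine carries the atoms at 0 and 2x,
  listed separately because they have no density; all the rest has a bounded density within |t| <
  2x.\<close>

lemma kernel_sol_product:
  assumes F: "kernel_bound B c F" and c: "c \<ge> 0" and G: "kernel_bound B' c' G" and c': "c' \<ge> 0"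
    and d: "d > 0"
  obtains M K where "M \<in> borel_measurable (borel \<Otimes>\<^sub>M borel)"
    "\<And>x. 0 < x \<Longrightarrow> x < d \<Longrightarrow> bounded_support K (2 * x) (\<lambda>t. M (x, t))"
    "\<And>x lam. 0 < x \<Longrightarrow> x < d \<Longrightarrow> kernel_sol 1 F lam x * kernel_sol 1 G lam x
       = 1 / 2 + cosl lam (2 * x) / 2 + (LINT t|lborel. M (x, t) * cosl lam t)"
proof
  note [measurable] = kernel_boundD(1)[OF F] kernel_boundD(1)[OF G]
  define A where "A = B * exp (c * d)"
  define A' where "A' = B' * exp (c' * d)"
  have A: "A \<ge> 0" "A' \<ge> 0" using kernel_boundD(6)[OF F] kernel_boundD(6)[OF G] by (auto simp: A_def A'_def)
  \<comment> \<open>The first summand represents the cross terms cos (f + g) by translates of F + G,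
    the integral represents f g by a symmetrised convolution.\<close>
  define M where "M p = (F (fst p, snd p - fst p) + G (fst p, snd p - fst p)
      + (F (fst p, snd p + fst p) + G (fst p, snd p + fst p))) / 2
      + (LINT s|lborel. (F (fst p, snd p - s) + F (fst p, snd p + s)) / 2 * G (fst p, s))" for p
  \<comment> \<open>Uniform in x: the factor 2x of the convolution bound is enlarged to 2d.\<close>
  define K where "K = (A + A') + 2 * d * A * A'"
  show "M \<in> borel_measurable (borel \<Otimes>\<^sub>M borel)"
    unfolding M_def[abs_def] by measurable
  have Mb: "bounded_support K (2 * x) (\<lambda>t. M (x, t)) \<and> kernel_sol 1 F lam x * kernel_sol 1 G lam x
       = 1 / 2 + cosl lam (2 * x) / 2 + (LINT t|lborel. M (x, t) * cosl lam t)" if x: "0 < x" "x < d" for x lam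
  proof -
    have f: "bounded_support A x (\<lambda>t. F (x, t))" and g: "bounded_support A' x (\<lambda>t. G (x, t))"
      using kernel_bounded_support[OF F c, of x d] kernel_bounded_support[OF G c', of x d] x
      by (auto simp: A_def A'_def)
    note fg = bounded_support_add[OF f g]
    let ?M1 = "\<lambda>t. (F (x, t - x) + G (x, t - x) + (F (x, t + x) + G (x, t + x))) / 2"
    let ?M2 = "\<lambda>t. LINT s|lborel. (F (x, t - s) + F (x, t + s)) / 2 * G (x, s)"
    have M: "(\<lambda>t. M (x, t)) = (\<lambda>t. ?M1 t + ?M2 t)" by (simp add: M_def)
    have b1: "bounded_support (A + A') (2 * x) ?M1"
      using cosl_times_integral(2)[OF fg, of x] x by simp
    have b2': "bounded_support (2 * x * A * A') (2 * x) ?M2"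
      using integral_times_integral(2)[OF f g] x by simp
    have b2: "bounded_support (2 * d * A * A') (2 * x) ?M2"
      by (rule bounded_support_mono[OF b2']) (use x A in \<open>auto intro!: mult_right_mono\<close>)
    have "bounded_support K (2 * x) (\<lambda>t. M (x, t))"
      unfolding M K_def by (rule bounded_support_add[OF b1 b2])
    moreover have "kernel_sol 1 F lam x * kernel_sol 1 G lam x
       = 1 / 2 + cosl lam (2 * x) / 2 + (LINT t|lborel. M (x, t) * cosl lam t)"
    proof -
      let ?f = "LINT t|lborel. F (x, t) * cosl lam t" and ?g = "LINT t|lborel. G (x, t) * cosl lam t"
      have "kernel_sol 1 F lam x * kernel_sol 1 G lam x = cosl lam x * cosl lam x + cosl lam x * (?f + ?g) + ?f * ?g"
        by (simp add: kernel_sol_def algebra_simps)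
      also have "cosl lam x * cosl lam x = 1 / 2 + cosl lam (2 * x) / 2"
        using cosl_times_cosl[of lam x x] by (simp add: field_simps)
      also have "?f + ?g = (LINT t|lborel. (F (x, t) + G (x, t)) * cosl lam t)"
        using bounded_support_integrable(2)[OF f, of lam] bounded_support_integrable(2)[OF g, of lam]
        by (simp add: distrib_right)
      also have "cosl lam x * \<dots> = (LINT t|lborel. ?M1 t * cosl lam t)"
        by (rule cosl_times_integral(1)[OF fg])
      also have "?f * ?g = (LINT t|lborel. ?M2 t * cosl lam t)"
        using integral_times_integral(1)[OF f g] x by simp
      also have "1 / 2 + cosl lam (2 * x) / 2 + (LINT t|lborel. ?M1 t * cosl lam t) + (LINT t|lborel. ?M2 t * cosl lam t)
        = 1 / 2 + cosl lam (2 * x) / 2 + (LINT t|lborel. M (x, t) * cosl lam t)"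
        using Bochner_Integration.integral_add[OF bounded_support_integrable(2)[OF b1, of lam] bounded_support_integrable(2)[OF b2, of lam]]
        by (simp add: M[unfolded fun_eq_iff, rule_format] distrib_right)
      finally show ?thesis .
    qed
    ultimately show ?thesis ..
  qed
  then show "\<And>x. 0 < x \<Longrightarrow> x < d \<Longrightarrow> bounded_support K (2 * x) (\<lambda>t. M (x, t))"
    and "\<And>x lam. 0 < x \<Longrightarrow> x < d \<Longrightarrow> kernel_sol 1 F lam x * kernel_sol 1 G lam x
       = 1 / 2 + cosl lam (2 * x) / 2 + (LINT t|lborel. M (x, t) * cosl lam t)"
    by blast+
qed

section \<open>The integrated product as a cosine transform\<close>

lemma integral_fold:
  fixes f :: "real \<Rightarrow> complex"
  assumes f: "integrable lborel f" and z: "\<And>t. R \<le> \<bar>t\<bar> \<Longrightarrow> f t = 0"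
  shows "(LINT t|lborel. f t) = (LINT t:{0<..<R}|lborel. f t + f (- t))"
    and "set_integrable lborel {0<..<R} (\<lambda>t. f t + f (- t))"
proof -
  have f': "integrable lborel (\<lambda>t. f (- t))"
    using lborel_integrable_real_affine[OF f, of "-1" 0] by simp
  have i1: "integrable lborel (\<lambda>t. indicator {0<..<R} t *\<^sub>R f t)" "integrable lborel (\<lambda>t. indicator {-R<..<0} t *\<^sub>R f t)"
    "integrable lborel (\<lambda>t. indicator {0<..<R} t *\<^sub>R f (- t))"
    using f f' by (auto intro!: integrable_mult_indicator)
  have "(LINT t|lborel. f t) = (LINT t|lborel. indicator {0<..<R} t *\<^sub>R f t + indicator {-R<..<0} t *\<^sub>R f t)"
  proof (rule integral_cong_AE)
    show "AE t in lborel. f t = indicator {0<..<R} t *\<^sub>R f t + indicator {-R<..<0} t *\<^sub>R f t"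
      using AE_lborel_singleton[of 0]
    proof eventually_elim
      case (elim t)
      then show ?case using z[of t] by (cases "R \<le> \<bar>t\<bar>") (auto simp: indicator_def)
    qed
    show "f \<in> borel_measurable lborel" using f by simp
    show "(\<lambda>t. indicator {0<..<R} t *\<^sub>R f t + indicator {-R<..<0} t *\<^sub>R f t) \<in> borel_measurable lborel"
      using Bochner_Integration.integrable_add[OF i1(1,2)] by simp
  qed
  also have "\<dots> = (LINT t|lborel. indicator {0<..<R} t *\<^sub>R f t) + (LINT t|lborel. indicator {-R<..<0} t *\<^sub>R f t)"
    by (rule Bochner_Integration.integral_add[OF i1(1,2)])
  also have "(LINT t|lborel. indicator {-R<..<0} t *\<^sub>R f t) = (LINT t|lborel. indicator {-R<..<0} (- t) *\<^sub>R f (- t))"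
    using lborel_integral_real_affine[of "-1" "\<lambda>t. indicator {-R<..<0} t *\<^sub>R f t" 0] by simp
  also have "\<dots> = (LINT t|lborel. indicator {0<..<R} t *\<^sub>R f (- t))"
    by (intro Bochner_Integration.integral_cong refl) (auto simp: indicator_def)
  also have "(LINT t|lborel. indicator {0<..<R} t *\<^sub>R f t) + \<dots> = (LINT t|lborel. indicator {0<..<R} t *\<^sub>R f t + indicator {0<..<R} t *\<^sub>R f (- t))"
    by (rule Bochner_Integration.integral_add[OF i1(1,3), symmetric])
  finally show "(LINT t|lborel. f t) = (LINT t:{0<..<R}|lborel. f t + f (- t))"
    by (simp add: set_lebesgue_integral_def scaleR_add_right)
  show "set_integrable lborel {0<..<R} (\<lambda>t. f t + f (- t))"
    using Bochner_Integration.integrable_add[OF i1(1,3)] by (simp add: set_integrable_def scaleR_add_right)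
qed

definition L1_tail :: "(real \<Rightarrow> complex) \<Rightarrow> real \<Rightarrow> real \<Rightarrow> real" where
  "L1_tail p d y = (LINT x:{y<..<d}|lborel. norm (p x))"

text \<open>The \<open>\<lambda>\<close>-independent part is \<open>\<integral> p / 2\<close>; the remainder is a cosine transform whose density is
  a Volterra perturbation of \<open>p (t / 2) / 4\<close>.\<close>

lemma product_integral_cosine_transform:
  assumes p: "potential d p" and d: "d > 0"
    and F: "kernel_bound B c F" and c: "c \<ge> 0" and G: "kernel_bound B' c' G" and c': "c' \<ge> 0"
  obtains N L where "N \<in> borel_measurable borel" "L \<ge> 0"
    "\<And>t. norm (N t) \<le> L * L1_tail p d (t / 2)"
    "\<And>lam. (LINT x:{0<..<d}|lborel. p x * (kernel_sol 1 F lam x * kernel_sol 1 G lam x))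
       = (LINT x|lborel. p x) / 2 + (LINT t:{0<..<2 * d}|lborel. (p (t / 2) / 4 + N t) * cosl lam t)"
proof -
  obtain M K where Mm [measurable]: "M \<in> borel_measurable (borel \<Otimes>\<^sub>M borel)"
    and Mb: "\<And>x. 0 < x \<Longrightarrow> x < d \<Longrightarrow> bounded_support K (2 * x) (\<lambda>t. M (x, t))"
    and prod: "\<And>x lam. 0 < x \<Longrightarrow> x < d \<Longrightarrow> kernel_sol 1 F lam x * kernel_sol 1 G lam x
       = 1 / 2 + cosl lam (2 * x) / 2 + (LINT t|lborel. M (x, t) * cosl lam t)"
    by (rule kernel_sol_product[OF F c G c' d]) (rule that)
  note [measurable] = potentialD(1)[OF p]
  have pi: "integrable lborel p" by (rule potential_integrable[OF p])
  have K: "K \<ge> 0" using bounded_support_le(2)[OF Mb[of "d / 2"]] d by simp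
  \<comment> \<open>Integrating over x first makes n the density of the bounded part. As
    \<open>M (x, t)\<close> vanishes unless |t| < 2x, only the values of p beyond |t|/2
    enter.\<close>
  define h where "h x t = (if 0 < x \<and> x < d then p x * M (x, t) else 0)" for x t
  define n where "n t = (LINT x|lborel. h x t)" for t
  have hm [measurable]: "(\<lambda>z. h (fst z) (snd z)) \<in> borel_measurable (borel \<Otimes>\<^sub>M borel)"
    unfolding h_def by measurable
  have hm2: "(\<lambda>x. h x t) \<in> borel_measurable borel" for t unfolding h_def by measurable
  have hb: "norm (h x t) \<le> K * (indicator {\<bar>t\<bar> / 2<..<d} x *\<^sub>R norm (p x))" for x t
  proof (cases "0 < x \<and> x < d \<and> \<bar>t\<bar> < 2 * x")
    case True
    then have "norm (M (x, t)) \<le> K" using Mb[of x] by (simp add: bounded_support_def)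
    then show ?thesis using True by (simp add: h_def norm_mult mult.commute[of K] mult_left_mono)
  next
    case False
    then have "h x t = 0" using Mb[of x] by (auto simp: h_def bounded_support_def)
    then show ?thesis using K by simp
  qed
  have ti: "integrable lborel (\<lambda>x. indicator {y<..<d} x *\<^sub>R norm (p x))" for y
    using pi by (intro integrable_mult_indicator) auto
  have nb: "norm (n t) \<le> K * L1_tail p d (\<bar>t\<bar> / 2)" for t
  proof -
    have i: "integrable lborel (\<lambda>x. K * (indicator {\<bar>t\<bar> / 2<..<d} x *\<^sub>R norm (p x)))" using ti by simp
    have "norm (n t) \<le> (LINT x|lborel. K * (indicator {\<bar>t\<bar> / 2<..<d} x *\<^sub>R norm (p x)))"
      unfolding n_def
    proof (rule Bochner_Integration.integral_norm_bound_integral[OF _ i hb])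
      show "integrable lborel (\<lambda>x. h x t)"
        by (rule integrable_norm_bound[OF i _ hb]) (use hm2 in simp)
    qed
    then show ?thesis by (simp add: L1_tail_def set_lebesgue_integral_def)
  qed
  have n0: "n t = 0" if "2 * d \<le> \<bar>t\<bar>" for t
  proof -
    have "{\<bar>t\<bar> / 2<..<d} = {}" using that by auto
    then have "L1_tail p d (\<bar>t\<bar> / 2) = 0" by (simp add: L1_tail_def set_lebesgue_integral_def)
    then show ?thesis using nb[of t] by simp
  qed
  have nm [measurable]: "n \<in> borel_measurable borel"
    unfolding n_def[abs_def] h_def by measurable
  show ?thesis
  \<comment> \<open>The cosine is even, so the values of n at t and -t are merged on (0, 2d); this
    doubles the constant.\<close>
  proof (rule that[of "\<lambda>t. n t + n (- t)" "2 * K"])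
    show "(\<lambda>t. n t + n (- t)) \<in> borel_measurable borel" by measurable
    show "2 * K \<ge> 0" using K by simp
    show "norm (n t + n (- t)) \<le> 2 * K * L1_tail p d (t / 2)" for t
    proof -
      \<comment> \<open>For negative t the tail beyond t/2 is the larger one, so the estimate holds
        for every real t.\<close>
      have tail_mono: "L1_tail p d (\<bar>t\<bar> / 2) \<le> L1_tail p d (t / 2)"
        unfolding L1_tail_def set_lebesgue_integral_def
        by (rule integral_mono[OF ti ti]) (auto simp: indicator_def)
      have "norm (n t + n (- t)) \<le> K * L1_tail p d (\<bar>t\<bar> / 2) + K * L1_tail p d (\<bar>t\<bar> / 2)"
        using nb[of t] nb[of "-t"] by (intro norm_triangle_mono) auto
      also have "\<dots> = 2 * K * L1_tail p d (\<bar>t\<bar> / 2)" by simp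
      also have "\<dots> \<le> 2 * K * L1_tail p d (t / 2)" using K tail_mono by (intro mult_left_mono) auto
      finally show ?thesis .
    qed
    fix lam :: complex
    let ?E = "exp (sqrt (norm lam) * (2 * d))"
    have "integrable (lborel \<Otimes>\<^sub>M lborel) (\<lambda>(x, t). norm (p x) * (K * ?E * indicator {-(2*d)<..<2*d} t) :: real)"
      using pi by (intro lborel_pair.integrable_mult_product) auto
    then have hi: "integrable (lborel \<Otimes>\<^sub>M lborel) (\<lambda>(x, t). h x t * cosl lam t)"
    proof (rule integrable_norm_bound)
      have "norm (h x t * cosl lam t) \<le> norm (p x) * (K * ?E * indicator {-(2*d)<..<2*d} t)" for x t
      proof (cases "t \<in> {-(2*d)<..<2*d}")
        case True
        have "norm (h x t) \<le> K * norm (p x)"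
          by (rule order_trans[OF hb]) (use K in \<open>auto simp: indicator_def\<close>)
        moreover have "norm (cosl lam t) \<le> ?E" using True by (intro norm_cosl_le) auto
        ultimately have "norm (h x t * cosl lam t) \<le> (K * norm (p x)) * ?E"
          unfolding norm_mult using K by (intro mult_mono) auto
        then show ?thesis using True by (simp add: mult_ac)
      next
        case False
        then have "{\<bar>t\<bar> / 2<..<d} = {}" by auto
        then have "h x t = 0" using hb[of x t] by simp
        then show ?thesis using False by simp
      qed
      then show "norm (case z of (x, t) \<Rightarrow> h x t * cosl lam t)
          \<le> (case z of (x, t) \<Rightarrow> norm (p x) * (K * ?E * indicator {-(2*d)<..<2*d} t))" for z
        by (cases z) (simp only: prod.case)
      show "(\<lambda>(x, t). h x t * cosl lam t) \<in> borel_measurable (lborel \<Otimes>\<^sub>M lborel)"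
        using hm unfolding split_def by measurable
    qed
    have i2: "integrable lborel (\<lambda>x. p x * (cosl lam (2 * x) / 2))"
    proof -
      have "set_integrable lborel {0<..<d} (\<lambda>x. (cosl lam (2 * x) / 2) * p x)"
      proof (rule set_integrable_bounded_mult[OF pi])
        show "norm (cosl lam (2 * x) / 2) \<le> exp (sqrt (norm lam) * (2 * d)) / 2" if "x \<in> {0<..<d}" for x
          using norm_cosl_le[of lam "norm lam" "2 * x" "2 * d"] that by (simp add: norm_divide)
      qed measurable
      moreover have "indicator {0<..<d} x *\<^sub>R ((cosl lam (2 * x) / 2) * p x) = p x * (cosl lam (2 * x) / 2)" for x
        using potentialD(3)[OF p, of x] by (cases "x \<in> {0<..<d}") auto
      ultimately show ?thesis by (simp only: set_integrable_def)
    qed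
    have i3: "integrable lborel (\<lambda>x. LINT t|lborel. h x t * cosl lam t)"
      using lborel_pair.integrable_fst[of "\<lambda>x t. h x t * cosl lam t"] hi by simp
    have i4: "integrable lborel (\<lambda>t. n t * cosl lam t)"
      using lborel_pair.integrable_snd[of "\<lambda>x t. h x t * cosl lam t"] hi by (simp add: n_def)
    have "(LINT x:{0<..<d}|lborel. p x * (kernel_sol 1 F lam x * kernel_sol 1 G lam x))
       = (LINT x|lborel. p x / 2 + p x * (cosl lam (2 * x) / 2) + (LINT t|lborel. h x t * cosl lam t))"
      unfolding set_lebesgue_integral_def
    proof (intro Bochner_Integration.integral_cong refl)
      fix x
      show "indicator {0<..<d} x *\<^sub>R (p x * (kernel_sol 1 F lam x * kernel_sol 1 G lam x))
         = p x / 2 + p x * (cosl lam (2 * x) / 2) + (LINT t|lborel. h x t * cosl lam t)"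
      proof (cases "x \<in> {0<..<d}")
        case True
        then have "(LINT t|lborel. h x t * cosl lam t) = p x * (LINT t|lborel. M (x, t) * cosl lam t)"
          by (simp add: h_def mult.assoc)
        then show ?thesis using True prod[of x lam] by (simp add: algebra_simps)
      next
        case False
        then have "(LINT t|lborel. h x t * cosl lam t) = 0" by (auto simp: h_def)
        then show ?thesis using False potentialD(3)[OF p False] by simp
      qed
    qed
    also have "\<dots> = (LINT x|lborel. p x) / 2 + (LINT x|lborel. p x * (cosl lam (2 * x) / 2))
        + (LINT x|lborel. (LINT t|lborel. h x t * cosl lam t))"
      using pi i2 i3 by (simp only: Bochner_Integration.integral_add Bochner_Integration.integrable_add
          integral_divide_zero integrable_divide_zero simp_thms)
    \<comment> \<open>Substituting x = t/2 brings a Jacobian 1/2; with the 1/2 of the squared cosine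
      it makes the quarter.\<close>
    also have "(LINT x|lborel. p x * (cosl lam (2 * x) / 2)) = (LINT t:{0<..<2 * d}|lborel. p (t / 2) / 4 * cosl lam t)"
    proof -
      have "(LINT x|lborel. p x * (cosl lam (2 * x) / 2)) = (LINT t|lborel. p (t / 2) / 4 * cosl lam t)"
        using lborel_integral_real_affine[of "1 / 2" "\<lambda>x. p x * (cosl lam (2 * x) / 2)" 0]
        by (simp add: scaleR_conv_of_real flip: integral_mult_right_zero) 
      also have "\<dots> = (LINT t:{0<..<2 * d}|lborel. p (t / 2) / 4 * cosl lam t)"
        unfolding set_lebesgue_integral_def
      proof (intro Bochner_Integration.integral_cong refl)
        fix t show "p (t / 2) / 4 * cosl lam t = indicator {0<..<2 * d} t *\<^sub>R (p (t / 2) / 4 * cosl lam t)"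
          using potentialD(3)[OF p, of "t / 2"] by (cases "t \<in> {0<..<2 * d}") auto
      qed
      finally show ?thesis .
    qed
    also have "(LINT x|lborel. (LINT t|lborel. h x t * cosl lam t)) = (LINT t|lborel. n t * cosl lam t)"
      using lborel_pair.Fubini_integral[OF hi] by (simp add: n_def)
    also have "\<dots> = (LINT t:{0<..<2 * d}|lborel. n t * cosl lam t + n (- t) * cosl lam (- t))"
      by (rule integral_fold(1)[OF i4]) (simp add: n0)
    also have "(LINT x|lborel. p x) / 2 + (LINT t:{0<..<2 * d}|lborel. p (t / 2) / 4 * cosl lam t) + \<dots>
      = (LINT x|lborel. p x) / 2 + (LINT t:{0<..<2 * d}|lborel. p (t / 2) / 4 * cosl lam t
          + (n t * cosl lam t + n (- t) * cosl lam (- t)))"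
    proof -
      have "integrable lborel (\<lambda>t. p (0 + (1/2) * t) * (cosl lam (2 * (0 + (1/2) * t)) / 2))"
        by (rule lborel_integrable_real_affine[OF i2]) simp
      then have "integrable lborel (\<lambda>t. (p (t / 2) * (cosl lam t / 2)) / 2)"
        by (intro integrable_divide_zero) simp
      then have "integrable lborel (\<lambda>t. p (t / 2) / 4 * cosl lam t)" by simp
      then have "set_integrable lborel {0<..<2 * d} (\<lambda>t. p (t / 2) / 4 * cosl lam t)"
        unfolding set_integrable_def by (intro integrable_mult_indicator) auto
      moreover have "set_integrable lborel {0<..<2 * d} (\<lambda>t. n t * cosl lam t + n (- t) * cosl lam (- t))"
        by (rule integral_fold(2)[OF i4]) (simp add: n0)
      ultimately show ?thesis by (simp only: set_integral_add(2) add.assoc)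
    qed
    finally show "(LINT x:{0<..<d}|lborel. p x * (kernel_sol 1 F lam x * kernel_sol 1 G lam x))
       = (LINT x|lborel. p x) / 2 + (LINT t:{0<..<2 * d}|lborel. (p (t / 2) / 4 + (n t + n (- t))) * cosl lam t)"
      by (simp add: algebra_simps)
  qed
qed

text \<open>The inequality looks from y towards d, hence the decreasing weight
  \<open>exp (- c * y)\<close>; each application gains the factor \<open>C / c \<le> 1 / 2\<close>.
  There is one exceptional null set for each n, countably many in all.\<close>

lemma volterra_zero:
  assumes p: "integrable lborel p" and p0: "\<And>x. x \<notin> {0<..<d} \<Longrightarrow> p x = 0" and C: "C \<ge> 0"
    and le: "AE y in lborel. y \<in> {0<..<d} \<longrightarrow> norm (p y) \<le> C * L1_tail p d y"
  shows "AE y in lborel. p y = (0::complex)"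
proof -
  \<comment> \<open>The \<open>+ 1\<close> keeps \<open>c\<close> positive when
    \<open>C = 0\<close>.\<close>
  define c where "c = 2 * C + 1"
  have c: "c > 0" "2 * C \<le> c" using C by (auto simp: c_def)
  define P where "P = (LINT x|lborel. norm (p x))"
  have P: "P \<ge> 0" by (simp add: P_def)
  have ti: "integrable lborel (\<lambda>x. indicator {y<..<d} x *\<^sub>R norm (p x))" for y
    using p by (intro integrable_mult_indicator) auto
  \<comment> \<open>\<open>exp (c * d)\<close> offsets the decay of the weight on (0, d), so that
    the case n = 0 follows from the plain bound \<open>C * P\<close>.\<close>
  let ?A = "\<lambda>n. C * P * exp (c * d) * (1/2) ^ n"
  have A: "?A n \<ge> 0" for n using C P by simp
  have it: "AE y in lborel. norm (p y) \<le> ?A n * exp (- c * y)" for n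
  proof (induction n)
    case 0
    show ?case using le
    proof eventually_elim
      case (elim y)
      show ?case
      proof (cases "y \<in> {0<..<d}")
        case True
        have "L1_tail p d y \<le> P" unfolding L1_tail_def P_def set_lebesgue_integral_def
          by (rule integral_mono[OF ti]) (use p in \<open>auto simp: indicator_def\<close>)
        then have "norm (p y) \<le> C * P" using elim True C by (meson mult_left_mono order_trans)
        also have "\<dots> \<le> C * P * exp (c * d - c * y)"
          using mult_left_mono[of 1 "exp (c * d - c * y)" "C * P"] C P c True by auto
        finally show ?thesis by (simp add: exp_diff exp_minus field_simps)
      next
        case False
        then show ?thesis using p0[OF False] C P by simp
      qed
    qed
  next
    case (Suc n)
    show ?case using le
    proof eventually_elim
      case (elim y)
      show ?case
      proof (cases "y \<in> {0<..<d}")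
        case True
        have D: "((\<lambda>x. - exp (- c * x) / c) has_real_derivative exp (- c * x)) (at x)" for x
          using c by (auto intro!: derivative_eq_intros)
        have hb: "has_bochner_integral lborel (\<lambda>x. exp (- c * x) * indicator {y..d} x) (- exp (- c * d) / c - - exp (- c * y) / c)"
          by (rule has_bochner_integral_FTC_Icc_real[OF _ D]) (use True in \<open>auto intro!: continuous_intros\<close>)
        then have ei: "integrable lborel (\<lambda>x. exp (- c * x) * indicator {y..d} x)"
          by (rule integrable.intros)
        have "L1_tail p d y \<le> (LINT x|lborel. ?A n * (exp (- c * x) * indicator {y..d} x))"
          unfolding L1_tail_def set_lebesgue_integral_def
        proof (rule integral_mono_AE[OF ti])
          show "integrable lborel (\<lambda>x. ?A n * (exp (- c * x) * indicator {y..d} x))" using ei by simp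
          show "AE x in lborel. indicator {y<..<d} x *\<^sub>R norm (p x) \<le> ?A n * (exp (- c * x) * indicator {y..d} x)"
            using Suc.IH by eventually_elim (use A[of n] in \<open>auto simp: indicator_def\<close>)
        qed
        also have "\<dots> = ?A n * (- exp (- c * d) / c - - exp (- c * y) / c)"
          using has_bochner_integral_integral_eq[OF hb] by simp
        also have "\<dots> \<le> ?A n * (exp (- c * y) / c)" using A[of n] c by (intro mult_left_mono) auto
        finally have "C * L1_tail p d y \<le> C * (?A n * (exp (- c * y) / c))" using C by (intro mult_left_mono)
        also have "\<dots> = (C / c) * (?A n * exp (- c * y))" by simp
        also have "\<dots> \<le> (1 / 2) * (?A n * exp (- c * y))"
        proof (rule mult_right_mono)
          show "C / c \<le> 1 / 2" using c by (simp add: field_simps)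
          show "0 \<le> ?A n * exp (- c * y)" by (rule mult_nonneg_nonneg[OF A]) simp
        qed
        finally have "C * L1_tail p d y \<le> ?A (Suc n) * exp (- c * y)" by simp
        then show ?thesis using elim True by auto
      next
        case False
        then show ?thesis using p0[OF False] C P by simp
      qed
    qed
  qed
  then have "AE y in lborel. \<forall>n. norm (p y) \<le> ?A n * exp (- c * y)" by (simp add: AE_all_countable)
  then show ?thesis
  proof eventually_elim
    case (elim y)
    have "(\<lambda>n. ?A n * exp (- c * y)) \<longlonglongrightarrow> C * P * exp (c * d) * 0 * exp (- c * y)"
      by (intro tendsto_intros LIMSEQ_power_zero) auto
    then have "norm (p y) \<le> C * P * exp (c * d) * 0 * exp (- c * y)"
      by (rule LIMSEQ_le_const) (use elim in blast)
    then show ?case by simp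
  qed
qed

section \<open>Completeness and zeros of the Wronskian\<close>

lemma L2_on_mult_integrable:
  assumes "L2_on S f" "L2_on S g"
  shows "integrable (lebesgue_on S) (\<lambda>t. f t * g t)"
proof (rule integrable_norm_bound)
  show "integrable (lebesgue_on S) (\<lambda>t. ((norm (f t))\<^sup>2 + (norm (g t))\<^sup>2) / 2)"
    using assms by (auto simp: L2_on_def)
  show "(\<lambda>t. f t * g t) \<in> borel_measurable (lebesgue_on S)" using assms by (auto simp: L2_on_def)
  show "norm (f t * g t) \<le> ((norm (f t))\<^sup>2 + (norm (g t))\<^sup>2) / 2" for t
    using sum_squares_bound[of "norm (f t)" "norm (g t)"] by (simp add: norm_mult)
qed

lemma L2_on_add:
  assumes "L2_on S f" "L2_on S g"
  shows "L2_on S (\<lambda>t. f t + g t)"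
  unfolding L2_on_def
proof
  have [measurable]: "f \<in> borel_measurable (lebesgue_on S)" "g \<in> borel_measurable (lebesgue_on S)"
    using assms by (auto simp: L2_on_def)
  show "(\<lambda>t. f t + g t) \<in> borel_measurable (lebesgue_on S)" by measurable
  show "integrable (lebesgue_on S) (\<lambda>t. (norm (f t + g t))\<^sup>2)"
  proof (rule integrable_norm_bound)
    show "integrable (lebesgue_on S) (\<lambda>t. 2 * (norm (f t))\<^sup>2 + 2 * (norm (g t))\<^sup>2)"
      using assms by (auto simp: L2_on_def)
    show "norm ((norm (f t + g t))\<^sup>2) \<le> 2 * (norm (f t))\<^sup>2 + 2 * (norm (g t))\<^sup>2" for t
      using norm_add_square_le[of "f t" "g t"] by simp
  qed measurable
qed

lemma L2_on_cmult: "L2_on S f \<Longrightarrow> L2_on S (\<lambda>t. a * f t)"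
  by (auto simp: L2_on_def norm_mult power_mult_distrib)

lemma L2_on_sum:
  "finite F \<Longrightarrow> (\<And>c. c \<in> F \<Longrightarrow> L2_on S c) \<Longrightarrow> L2_on S (\<lambda>t. \<Sum>c\<in>F. \<alpha> c * c t)"
proof (induction F rule: finite_induct)
  case empty
  then show ?case by (simp add: L2_on_def)
next
  case (insert c F)
  then show ?case by (simp add: L2_on_add L2_on_cmult)
qed

text \<open>The pairing has no conjugation, so it is \<open>cnj w\<close> that gets approximated:
  with remainder r, the squared norm I of w equals the integral of w r. The inequality 2 |w r| \<le>
  |w|^2 + |r|^2, in the role of Cauchy-Schwarz, gives \<open>I \<le> (I + e) / 2\<close> and hence
  \<open>I \<le> e\<close>.\<close>

lemma complete_orthogonal_imp_zero:
  assumes C: "complete_in_L2 S C" and w: "L2_on S w"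
    and orth: "\<And>c. c \<in> C \<Longrightarrow> (LINT t|lebesgue_on S. w t * c t) = 0"
  shows "AE t in lebesgue_on S. w t = 0"
proof -
  define I where "I = (LINT t|lebesgue_on S. (norm (w t))\<^sup>2)"
  have wi: "integrable (lebesgue_on S) (\<lambda>t. (norm (w t))\<^sup>2)" using w by (simp add: L2_on_def)
  have wc: "L2_on S (\<lambda>t. cnj (w t))"
  proof -
    have "(\<lambda>t. cnj (w t)) \<in> borel_measurable (lebesgue_on S)"
      by (rule borel_measurable_continuous_on[of cnj]) (use w in \<open>auto simp: L2_on_def intro!: continuous_intros\<close>)
    then show ?thesis using w by (simp add: L2_on_def)
  qed
  have Ie: "I \<le> e" if "e > 0" for e
  proof -
    obtain F \<alpha> where F: "finite F" "F \<subseteq> C"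
      and lt: "(LINT t|lebesgue_on S. (norm (cnj (w t) - (\<Sum>c\<in>F. \<alpha> c * c t)))\<^sup>2) < e"
      using C wc \<open>e > 0\<close> unfolding complete_in_L2_def by meson
    have cL: "L2_on S c" if "c \<in> F" for c using C F(2) that by (auto simp: complete_in_L2_def)
    define \<sigma> where "\<sigma> t = (\<Sum>c\<in>F. \<alpha> c * c t)" for t
    have sL: "L2_on S \<sigma>" unfolding \<sigma>_def[abs_def] by (rule L2_on_sum[OF F(1) cL])
    define r where "r t = cnj (w t) - \<sigma> t" for t
    have rL: "L2_on S r"
      using L2_on_add[OF wc L2_on_cmult[OF sL, of "-1"]] by (simp add: r_def[abs_def])
    have ri: "integrable (lebesgue_on S) (\<lambda>t. (norm (r t))\<^sup>2)" using rL by (simp add: L2_on_def)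
    have "(LINT t|lebesgue_on S. w t * \<sigma> t) = (\<Sum>c\<in>F. (LINT t|lebesgue_on S. \<alpha> c * (w t * c t)))"
    proof -
      have "(LINT t|lebesgue_on S. w t * \<sigma> t) = (LINT t|lebesgue_on S. (\<Sum>c\<in>F. \<alpha> c * (w t * c t)))"
        by (simp add: \<sigma>_def sum_distrib_left mult_ac)
      also have "\<dots> = (\<Sum>c\<in>F. (LINT t|lebesgue_on S. \<alpha> c * (w t * c t)))"
        by (intro Bochner_Integration.integral_sum integrable_mult_right L2_on_mult_integrable[OF w cL])
      finally show ?thesis .
    qed
    also have "\<dots> = 0" using orth F(2) by (intro sum.neutral) auto
    finally have ws: "(LINT t|lebesgue_on S. w t * \<sigma> t) = 0" .
    have "complex_of_real I = (LINT t|lebesgue_on S. complex_of_real ((norm (w t))\<^sup>2))"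
      unfolding I_def by (rule integral_complex_of_real[symmetric])
    also have "\<dots> = (LINT t|lebesgue_on S. w t * r t + w t * \<sigma> t)"
      by (intro Bochner_Integration.integral_cong refl) (simp only: complex_norm_square, simp add: r_def algebra_simps)
    also have "\<dots> = (LINT t|lebesgue_on S. w t * r t)"
      using Bochner_Integration.integral_add[OF L2_on_mult_integrable[OF w rL] L2_on_mult_integrable[OF w sL]] ws by simp
    finally have "\<bar>I\<bar> = norm (LINT t|lebesgue_on S. w t * r t)" by (metis norm_of_real real_norm_def)
    also have "\<dots> \<le> (LINT t|lebesgue_on S. ((norm (w t))\<^sup>2 + (norm (r t))\<^sup>2) / 2)"
    proof (rule Bochner_Integration.integral_norm_bound_integral[OF L2_on_mult_integrable[OF w rL]])
      show "integrable (lebesgue_on S) (\<lambda>t. ((norm (w t))\<^sup>2 + (norm (r t))\<^sup>2) / 2)" using wi ri by simp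
      show "norm (w t * r t) \<le> ((norm (w t))\<^sup>2 + (norm (r t))\<^sup>2) / 2" for t
        using sum_squares_bound[of "norm (w t)" "norm (r t)"] by (simp add: norm_mult)
    qed
    also have "\<dots> = (I + (LINT t|lebesgue_on S. (norm (r t))\<^sup>2)) / 2" using wi ri by (simp add: I_def)
    also have "\<dots> \<le> (I + e) / 2" using lt by (simp add: r_def \<sigma>_def)
    finally show "I \<le> e" by simp
  qed
  have "I \<le> 0" by (rule field_le_epsilon) (use Ie in simp)
  moreover have "I \<ge> 0" by (simp add: I_def)
  ultimately have "I = 0" by simp
  then show ?thesis
    using integral_nonneg_eq_0_iff_AE[OF wi] by (simp add: I_def)
qed

section \<open>Holomorphic end values and common zeros\<close>

lemma cosine_transform_holomorphic:
  fixes w :: "real \<Rightarrow> complex"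
  assumes w: "set_integrable lborel {a<..<b} w"
  shows "(\<lambda>lam. LINT t:{a<..<b}|lborel. w t * cosl lam t) holomorphic_on UNIV"
    and "(deriv ^^ n) (\<lambda>lam. LINT t:{a<..<b}|lborel. w t * cosl lam t) z
       = (LINT t:{a<..<b}|lborel. w t * (deriv ^^ n) (\<lambda>lam. cosl lam t) z)"
proof -
  define v where "v t = indicator {a<..<b} t *\<^sub>R w t" for t
  have v: "integrable lborel v" using w by (simp add: v_def[abs_def] set_integrable_def)
  have hol: "(\<lambda>l. v s * cosl l s) holomorphic_on UNIV" for s
    by (intro holomorphic_intros)
  have meas: "(\<lambda>s. v s * cosl l s) \<in> borel_measurable lborel" for l using v by simp
  have bound: "\<exists>g. integrable lborel g \<and> (\<forall>l s. norm l \<le> R \<longrightarrow> norm (v s * cosl l s) \<le> g s)" for R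
  proof (intro exI conjI allI impI)
    show "integrable lborel (\<lambda>s. norm (v s) * exp (sqrt R * max \<bar>a\<bar> \<bar>b\<bar>))" using v by simp
    fix l :: complex and s :: real assume l: "norm l \<le> R"
    show "norm (v s * cosl l s) \<le> norm (v s) * exp (sqrt R * max \<bar>a\<bar> \<bar>b\<bar>)"
    proof (cases "s \<in> {a<..<b}")
      case True
      then have "\<bar>s\<bar> \<le> max \<bar>a\<bar> \<bar>b\<bar>" by auto
      then show ?thesis using norm_cosl_le[OF l] by (simp add: norm_mult mult_left_mono)
    qed (simp add: v_def)
  qed
  have e: "(LINT t:{a<..<b}|lborel. w t * cosl lam t) = (LINT t|lborel. v t * cosl lam t)" for lam
    by (simp add: set_lebesgue_integral_def v_def)
  show "(\<lambda>lam. LINT t:{a<..<b}|lborel. w t * cosl lam t) holomorphic_on UNIV"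
    unfolding e by (rule parameter_integral_holomorphic[OF hol meas bound])
  have "(deriv ^^ n) (\<lambda>l. v t * cosl l t) z = v t * (deriv ^^ n) (\<lambda>lam. cosl lam t) z" for t
    by (rule higher_deriv_cmult[where A = UNIV]) (auto intro!: holomorphic_intros)
  then show "(deriv ^^ n) (\<lambda>lam. LINT t:{a<..<b}|lborel. w t * cosl lam t) z
       = (LINT t:{a<..<b}|lborel. w t * (deriv ^^ n) (\<lambda>lam. cosl lam t) z)"
    unfolding e parameter_integral_higher_deriv[OF hol meas bound]
    by (simp add: set_lebesgue_integral_def v_def)
qed

lemma kernel_sol_holomorphic:
  assumes F: "kernel_bound B c F" and c: "c \<ge> 0" and x: "0 \<le> x"
  shows "(\<lambda>lam. kernel_sol u F lam x) holomorphic_on UNIV"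
proof -
  note bs = kernel_bounded_support[OF F c x order_refl]
  have "(LINT t|lborel. F (x, t) * cosl lam t) = (LINT t:{-x<..<x}|lborel. F (x, t) * cosl lam t)" for lam
    unfolding set_lebesgue_integral_def
  proof (intro Bochner_Integration.integral_cong refl)
    fix t show "F (x, t) * cosl lam t = indicator {-x<..<x} t *\<^sub>R (F (x, t) * cosl lam t)"
      using kernel_boundD(5)[OF F, of x t] by (cases "x \<le> \<bar>t\<bar>") (auto simp: indicator_def)
  qed
  moreover have "set_integrable lborel {-x<..<x} (\<lambda>t. F (x, t))"
    unfolding set_integrable_def
    by (rule integrable_mult_indicator[OF _ bounded_support_integrable(1)[OF bs]]) simp
  ultimately show ?thesis
    unfolding kernel_sol_def
    using cosine_transform_holomorphic(1)[of "-x" x "\<lambda>t. F (x, t)"]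
    by (auto intro!: holomorphic_intros)
qed

text \<open>The integrated equation at d replaces the defining formula, because it depends on
  \<open>lam\<close> only through \<open>kernel_sol\<close> and the factor
  \<open>q s - lam\<close>.\<close>

lemma kernel_dsol_holomorphic:
  assumes q: "potential d q" and d: "d > 0" and F: "transmutation_kernel q u v F"
  shows "(\<lambda>lam. kernel_dsol q u v F lam d) holomorphic_on UNIV"
proof -
  obtain B c where c: "c \<ge> 0" and B: "kernel_bound B c F"
    using F by (auto simp: transmutation_kernel_def)
  note [measurable] = kernel_sol_measurable[OF B] potentialD(1)[OF q]
  let ?f = "\<lambda>l s. indicator {0<..<d} s *\<^sub>R ((q s - l) * kernel_sol u F l s)"
  have "kernel_dsol q u v F lam d = v + (LINT s|lborel. ?f lam s)" for lam
    using kernel_sol_ivp[OF q d F, of lam] d unfolding ivp_def set_lebesgue_integral_def by simp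
  moreover have "(\<lambda>lam. LINT s|lborel. ?f lam s) holomorphic_on UNIV"
  proof (rule parameter_integral_holomorphic)
    show "(\<lambda>l. ?f l s) holomorphic_on UNIV" for s
      by (cases "s \<in> {0<..<d}") (auto intro!: holomorphic_intros kernel_sol_holomorphic[OF B c])
    show "?f l \<in> borel_measurable lborel" for l by measurable
    show "\<exists>g. integrable lborel g \<and> (\<forall>l s. norm l \<le> R \<longrightarrow> norm (?f l s) \<le> g s)" for R
    proof (intro exI conjI allI impI)
      let ?K = "(norm u + 2 * B * exp (c * d) * d) * exp (sqrt R * d)"
      show "integrable lborel (\<lambda>s. (norm (q s) + R * indicator {0<..<d} s) * ?K)"
        using potential_integrable[OF q] by simp
      fix l :: complex and s assume l: "norm l \<le> R"
      have R: "R \<ge> 0" using l norm_ge_zero order_trans by blast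
      have K: "?K \<ge> 0" using d kernel_boundD(6)[OF B] by simp
      show "norm (?f l s) \<le> (norm (q s) + R * indicator {0<..<d} s) * ?K"
      proof (cases "s \<in> {0<..<d}")
        case True
        have "norm (q s - l) \<le> norm (q s) + R" using norm_triangle_ineq4[of "q s" l] l by linarith
        then have "norm ((q s - l) * kernel_sol u F l s) \<le> (norm (q s) + R) * ?K"
          unfolding norm_mult using kernel_sol_bound[OF B c _ _ l, of s d u] True R by (intro mult_mono) auto
        then show ?thesis using True by simp
      next
        case False
        then show ?thesis using K by simp
      qed
    qed
  qed
  ultimately show ?thesis by (auto intro!: holomorphic_intros)
qed

lemma sl_sol_transmutation:
  assumes d: "d > 0" and p: "potential d p" and qp: "AE x in lebesgue_on {0<..<d}. q x = p x"
  obtains F where "transmutation_kernel p u v F"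
    "\<And>lam. sl_sol d q lam u v d = kernel_sol u F lam d"
    "\<And>lam. sl_sol_deriv d q lam u v d = kernel_dsol p u v F lam d"
proof -
  obtain F where F: "transmutation_kernel p u v F" using transmutation_kernel_exists[OF p d] .
  show ?thesis
    using sl_sol_eq[OF d p qp kernel_sol_ivp[OF p d F]] d by (intro that[OF F]) auto
qed

lemma sl_sol_holomorphic:
  assumes d: "d > 0" and q: "L2_on {0<..<d} q"
  shows "(\<lambda>lam. sl_sol d q lam u v d) holomorphic_on UNIV"
    and "(\<lambda>lam. sl_sol_deriv d q lam u v d) holomorphic_on UNIV"
proof -
  obtain p where p: "potential d p" "AE x in lebesgue_on {0<..<d}. q x = p x"
    using L2_on_potential[OF q] .
  obtain F where F: "transmutation_kernel p u v F"
    "\<And>lam. sl_sol d q lam u v d = kernel_sol u F lam d"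
    "\<And>lam. sl_sol_deriv d q lam u v d = kernel_dsol p u v F lam d"
    by (rule sl_sol_transmutation[OF d p]) (rule that)
  obtain B c where c: "c \<ge> 0" and B: "kernel_bound B c F"
    using F(1) by (auto simp: transmutation_kernel_def)
  show "(\<lambda>lam. sl_sol d q lam u v d) holomorphic_on UNIV"
    unfolding F(2) using kernel_sol_holomorphic[OF B c] d by simp
  show "(\<lambda>lam. sl_sol_deriv d q lam u v d) holomorphic_on UNIV"
    unfolding F(3) by (rule kernel_dsol_holomorphic[OF p(1) d F(1)])
qed

text \<open>The companion solution with initial data \<open>(- cnj v, cnj u)\<close> has the
  constant Wronskian |u|^2 + |v|^2 with the given one, whereas at d the Wronskian would be 0 if both
  end values vanished.\<close>

lemma sl_sol_nonzero:
  assumes d: "d > 0" and q: "L2_on {0<..<d} q" and uv: "u \<noteq> 0 \<or> v \<noteq> 0"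
  shows "sl_sol d q lam u v d \<noteq> 0 \<or> sl_sol_deriv d q lam u v d \<noteq> 0"
proof (rule ccontr)
  assume z: "\<not> ?thesis"
  obtain p where p: "potential d p" "AE x in lebesgue_on {0<..<d}. q x = p x"
    using L2_on_potential[OF q] .
  obtain F where F: "transmutation_kernel p u v F"
    "\<And>lam. sl_sol d q lam u v d = kernel_sol u F lam d"
    "\<And>lam. sl_sol_deriv d q lam u v d = kernel_dsol p u v F lam d"
    by (rule sl_sol_transmutation[OF d p]) (rule that)
  obtain G where G: "transmutation_kernel p (- cnj v) (cnj u) G"
    using transmutation_kernel_exists[OF p(1) d] .
  have "u * cnj u - v * - cnj v = 0"
    using ivp_wronskian[OF kernel_sol_ivp[OF p(1) d F(1)] kernel_sol_ivp[OF p(1) d G], of lam] z d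
    by (simp add: F(2,3) set_lebesgue_integral_def)
  then have "complex_of_real ((norm u)\<^sup>2 + (norm v)\<^sup>2) = 0"
    by (simp only: of_real_add complex_norm_square) simp
  then have "(norm u)\<^sup>2 + (norm v)\<^sup>2 = 0" by (simp only: of_real_eq_0_iff)
  then show False using uv by (simp add: sum_power2_eq_zero_iff)
qed

text \<open>As a1 is nonzero, (g0, g1) is an invertible linear image of the end values of psi and
  its derivative, so it never vanishes. Both characteristic functions contain the same pair, which
  is what the elimination requires.\<close>

lemma wronskian_zero_of_subspectra:
  assumes d: "d1 > 0" "d2 > 0" and q: "L2_on {0<..<d1} q" "L2_on {0<..<d1} q'" and q2: "L2_on {0<..<d2} q2"
    and a1: "a1 \<noteq> 0"
    and s: "is_subspectrum N \<mu> d1 d2 q q2 h bc a1 a2" "is_subspectrum N \<mu> d1 d2 q' q2 h' bc a1 a2"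
    and k: "k < card (occurrences N \<mu> z)"
  shows "(deriv ^^ k) (\<lambda>lam. sl_sol d1 q lam 1 h d1 * sl_sol_deriv d1 q' lam 1 h' d1
      - sl_sol_deriv d1 q lam 1 h d1 * sl_sol d1 q' lam 1 h' d1) z = 0"
proof -
  let ?\<psi> = "\<lambda>lam. sl_sol d2 q2 lam (init_val bc) (init_deriv bc) d2"
  let ?\<psi>' = "\<lambda>lam. sl_sol_deriv d2 q2 lam (init_val bc) (init_deriv bc) d2"
  let ?g0 = "\<lambda>lam. - inverse (of_real a1) * ?\<psi> lam"
  let ?g1 = "\<lambda>lam. of_real a1 * ?\<psi>' lam + a2 * ?\<psi> lam"
  have c: "char_fun d1 d2 r q2 k bc a1 a2 = (\<lambda>lam. sl_sol d1 r lam 1 k d1 * ?g1 lam - sl_sol_deriv d1 r lam 1 k d1 * ?g0 lam)" for r k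
    by (simp add: char_fun_def Let_def fun_eq_iff)
  have "init_val bc \<noteq> 0 \<or> init_deriv bc \<noteq> 0" by (cases bc) auto
  then have nz: "?g0 z \<noteq> 0 \<or> ?g1 z \<noteq> 0"
    using sl_sol_nonzero[OF d(2) q2, of "init_val bc" "init_deriv bc" z] a1 by auto
  show ?thesis
  proof (rule higher_deriv_wronskian_zero[where ?g0.0 = ?g0 and ?g1.0 = ?g1, OF _ _ _ _ _ _ nz _ _ k])
    show "?g0 holomorphic_on UNIV" "?g1 holomorphic_on UNIV"
      using sl_sol_holomorphic[OF d(2) q2] by (auto intro!: holomorphic_intros)
    show "(deriv ^^ j) (\<lambda>l. sl_sol d1 q l 1 h d1 * ?g1 l - sl_sol_deriv d1 q l 1 h d1 * ?g0 l) z = 0"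
      "(deriv ^^ j) (\<lambda>l. sl_sol d1 q' l 1 h' d1 * ?g1 l - sl_sol_deriv d1 q' l 1 h' d1 * ?g0 l) z = 0"
      if "j < card (occurrences N \<mu> z)" for j
      using s that unfolding is_subspectrum_def subsequence_of_zeros_def c by blast+
  qed (rule sl_sol_holomorphic[OF d(1) q(1)] sl_sol_holomorphic[OF d(1) q(2)])+
qed

section \<open>Uniqueness of the pair (q, h)\<close>

lemma potential_diff:
  assumes p: "potential d p" and q: "potential d q"
  shows "potential d (\<lambda>x. p x - q x)"
  unfolding potential_def
proof (intro conjI allI impI)
  note [measurable] = potentialD(1)[OF p] potentialD(1)[OF q]
  show "(\<lambda>x. p x - q x) \<in> borel_measurable borel" by measurable
  show "integrable lborel (\<lambda>x. (norm (p x - q x))\<^sup>2)"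
  proof (rule integrable_norm_bound)
    show "integrable lborel (\<lambda>x. 2 * (norm (p x))\<^sup>2 + 2 * (norm (q x))\<^sup>2)"
      using potentialD(2)[OF p] potentialD(2)[OF q] by simp
    show "norm ((norm (p x - q x))\<^sup>2) \<le> 2 * (norm (p x))\<^sup>2 + 2 * (norm (q x))\<^sup>2" for x
      using norm_add_square_le[of "p x" "- q x"] by simp
  qed measurable
qed (use potentialD(3)[OF p] potentialD(3)[OF q] in simp)

lemma integral_potential:
  assumes p: "potential d p" and q: "L2_on {0<..<d} q" and qp: "AE x in lebesgue_on {0<..<d}. q x = p x"
  shows "(LINT x|lebesgue_on {0<..<d}. q x) = (LINT x|lborel. p x)"
proof -
  note [measurable] = potentialD(1)[OF p]
  have pm: "p \<in> borel_measurable (lebesgue_on {0<..<d})"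
    by (intro measurable_restrict_space1 measurable_completion) simp
  have "(LINT x|lebesgue_on {0<..<d}. q x) = (LINT x|lebesgue_on {0<..<d}. p x)"
    by (rule integral_cong_AE[OF _ pm qp]) (use q in \<open>simp add: L2_on_def\<close>)
  also have "\<dots> = (LINT x:{0<..<d}|lborel. p x)" by (rule lebesgue_on_iff_lborel) simp_all
  also have "\<dots> = (LINT x|lborel. p x)"
    unfolding set_lebesgue_integral_def
    by (intro Bochner_Integration.integral_cong refl) (use potentialD(3)[OF p] in \<open>auto simp: indicator_def\<close>)
  finally show ?thesis .
qed

lemma L2_onI:
  assumes [measurable]: "f \<in> borel_measurable borel" "S \<in> sets borel"
    and g: "integrable lborel g" and le: "\<And>x. x \<in> S \<Longrightarrow> (norm (f x))\<^sup>2 \<le> g x"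
  shows "L2_on S f"
proof -
  have "set_integrable lborel S (\<lambda>x. (norm (f x))\<^sup>2)"
    unfolding set_integrable_def
  proof (rule integrable_norm_bound)
    show "integrable lborel (\<lambda>x. norm (g x))" using g by simp
    show "norm (indicator S x *\<^sub>R (norm (f x))\<^sup>2) \<le> norm (g x)" for x
      using le[of x] by (cases "x \<in> S") auto
  qed measurable
  moreover have "f \<in> borel_measurable (lebesgue_on S)"
    by (intro measurable_restrict_space1 measurable_completion) simp
  ultimately show ?thesis by (simp add: L2_on_def lebesgue_on_iff_lborel)
qed

lemma cos_coeff_eq: "cos_coeff \<mu> \<nu> t = (deriv ^^ \<nu>) (\<lambda>lam. cosl lam t) \<mu> / fact \<nu>"
  by (simp add: cos_coeff_def cosl_def)

lemma cos_coeff_measurable [measurable]: "cos_coeff \<mu> \<nu> \<in> borel_measurable borel"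
  unfolding cos_coeff_eq[abs_def]
  by (intro borel_measurable_divide higher_deriv_measurable) (auto intro!: holomorphic_intros)

lemma inverse_problem_solutions_eq:
  assumes a: "0 < a" and b: "0 < b" and a1: "0 < a1" and q2: "L2_on {0<..<b} q2"
    and s: "inverse_problem_solution a b q2 H a1 a2 \<omega>1 N0 \<mu>0 N1 \<mu>1 q h"
    and s': "inverse_problem_solution a b q2 H a1 a2 \<omega>1 N0 \<mu>0 N1 \<mu>1 q' h'"
    and C: "complete_in_L2 {0<..<2 * a} (cos_system N0 \<mu>0 \<union> cos_system N1 \<mu>1)"
  shows "(AE x in lebesgue_on {0<..<a}. q' x = q x) \<and> h' = h"
proof -
  have q: "L2_on {0<..<a} q" and \<omega>: "h + (1/2) * (LINT x|lebesgue_on {0<..<a}. q x) = \<omega>1"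
    and q': "L2_on {0<..<a} q'" and \<omega>': "h' + (1/2) * (LINT x|lebesgue_on {0<..<a}. q' x) = \<omega>1"
    using s s' by (auto simp: inverse_problem_solution_def)
  obtain p1 where p1: "potential a p1" "AE x in lebesgue_on {0<..<a}. q x = p1 x"
    using L2_on_potential[OF q] .
  obtain p2 where p2: "potential a p2" "AE x in lebesgue_on {0<..<a}. q' x = p2 x"
    using L2_on_potential[OF q'] .
  obtain F where F: "transmutation_kernel p1 1 h F"
    "\<And>lam. sl_sol a q lam 1 h a = kernel_sol 1 F lam a"
    "\<And>lam. sl_sol_deriv a q lam 1 h a = kernel_dsol p1 1 h F lam a"
    by (rule sl_sol_transmutation[OF a p1]) (rule that)
  obtain G where G: "transmutation_kernel p2 1 h' G"
    "\<And>lam. sl_sol a q' lam 1 h' a = kernel_sol 1 G lam a"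
    "\<And>lam. sl_sol_deriv a q' lam 1 h' a = kernel_dsol p2 1 h' G lam a"
    by (rule sl_sol_transmutation[OF a p2]) (rule that)
  define p where "p x = p2 x - p1 x" for x
  have p: "potential a p" unfolding p_def[abs_def] by (rule potential_diff[OF p2(1) p1(1)])
  note [measurable] = potentialD(1)[OF p]
  have pint: "(LINT x|lborel. p x) = (LINT x|lebesgue_on {0<..<a}. q' x) - (LINT x|lebesgue_on {0<..<a}. q x)"
    unfolding integral_potential[OF p1(1) q p1(2)] integral_potential[OF p2(1) q' p2(2)] p_def
    by (rule Bochner_Integration.integral_diff[OF potential_integrable[OF p2(1)] potential_integrable[OF p1(1)]])
  \<comment> \<open>The two normalisations are subtracted. This combination is the part of the
    Wronskian without a cosine: h' - h from the initial values at 0, and half the integral of p from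
    the atom at 0.\<close>
  have const: "h' - h + (LINT x|lborel. p x) / 2 = 0"
  proof -
    have "h' - h + (LINT x|lborel. p x) / 2 = (h' + (1/2) * (LINT x|lebesgue_on {0<..<a}. q' x))
        - (h + (1/2) * (LINT x|lebesgue_on {0<..<a}. q x))"
      unfolding pint by (simp add: field_simps)
    then show ?thesis unfolding \<omega> \<omega>' by simp
  qed
  obtain B c where c: "c \<ge> 0" and B: "kernel_bound B c F"
    using F(1) by (auto simp: transmutation_kernel_def)
  obtain B' c' where c': "c' \<ge> 0" and B': "kernel_bound B' c' G"
    using G(1) by (auto simp: transmutation_kernel_def)
  obtain N L where N [measurable]: "N \<in> borel_measurable borel" and L: "L \<ge> 0"
    and Nb: "\<And>t. norm (N t) \<le> L * L1_tail p a (t / 2)"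
    and rep: "\<And>lam. (LINT x:{0<..<a}|lborel. p x * (kernel_sol 1 F lam x * kernel_sol 1 G lam x))
       = (LINT x|lborel. p x) / 2 + (LINT t:{0<..<2 * a}|lborel. (p (t / 2) / 4 + N t) * cosl lam t)"
    by (rule product_integral_cosine_transform[OF p a B c B' c']) (rule that)
  define w where "w t = p (t / 2) / 4 + N t" for t
  have [measurable]: "w \<in> borel_measurable borel" unfolding w_def[abs_def] by measurable
  let ?W = "\<lambda>lam. sl_sol a q lam 1 h a * sl_sol_deriv a q' lam 1 h' a
      - sl_sol_deriv a q lam 1 h a * sl_sol a q' lam 1 h' a"
  have W: "?W = (\<lambda>lam. LINT t:{0<..<2 * a}|lborel. w t * cosl lam t)"
  proof
    fix lam
    have "?W lam = 1 * h' - h * 1 + (LINT s:{0<..<a}|lborel. (p2 s - p1 s) * (kernel_sol 1 F lam s * kernel_sol 1 G lam s))"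
      unfolding F(2,3) G(2,3)
      by (rule ivp_wronskian[OF kernel_sol_ivp[OF p1(1) a F(1)] kernel_sol_ivp[OF p2(1) a G(1)]]) (use a in simp)
    also have "\<dots> = (h' - h + (LINT x|lborel. p x) / 2) + (LINT t:{0<..<2 * a}|lborel. w t * cosl lam t)"
      unfolding p_def[symmetric] rep w_def by simp
    finally show "?W lam = (LINT t:{0<..<2 * a}|lborel. w t * cosl lam t)" unfolding const by simp
  qed
  \<comment> \<open>Completeness concerns L2: the leading part inherits square integrability from p,
    and N is bounded by a multiple of the L1 norm of p.\<close>
  have wL: "L2_on {0<..<2 * a} w"
    unfolding w_def[abs_def]
  proof (rule L2_on_add)
    show "L2_on {0<..<2 * a} (\<lambda>t. p (t / 2) / 4)"
    proof (rule L2_onI)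
      have "integrable lborel (\<lambda>t. (norm (p (0 + (1/2) * t)))\<^sup>2)"
        by (rule lborel_integrable_real_affine[OF potentialD(2)[OF p]]) simp
      then show "integrable lborel (\<lambda>t. (norm (p (t / 2)))\<^sup>2)" by simp
      show "(norm (p (t / 2) / 4))\<^sup>2 \<le> (norm (p (t / 2)))\<^sup>2" for t
        by (intro power_mono) (auto simp: norm_divide)
    qed measurable
    show "L2_on {0<..<2 * a} N"
    proof (rule L2_onI)
      let ?P = "L * (LINT x|lborel. norm (p x))"
      show "integrable lborel (\<lambda>t. ?P\<^sup>2 * indicator {0<..<2 * a} t)" by simp
      fix t assume t: "t \<in> {0<..<2 * a}"
      have "L1_tail p a (t / 2) \<le> (LINT x|lborel. norm (p x))"
        unfolding L1_tail_def set_lebesgue_integral_def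
      proof (rule integral_mono)
        show i: "integrable lborel (\<lambda>x. norm (p x))" using potential_integrable[OF p] by simp
        show "integrable lborel (\<lambda>x. indicator {t / 2<..<a} x *\<^sub>R norm (p x))"
          by (rule integrable_mult_indicator[OF _ i]) simp
      qed (auto simp: indicator_def)
      then have "norm (N t) \<le> ?P" using Nb[of t] L by (meson mult_left_mono order_trans)
      then show "(norm (N t))\<^sup>2 \<le> ?P\<^sup>2 * indicator {0<..<2 * a} t" using t by (simp add: power_mono)
    qed measurable
  qed
  have "L2_on {0<..<2 * a} (\<lambda>_. 1)"
    by (rule L2_onI[where g = "indicator {0<..<2 * a}"]) auto
  from L2_on_mult_integrable[OF wL this] have "integrable (lebesgue_on {0<..<2 * a}) w" by simp
  then have wi: "set_integrable lborel {0<..<2 * a} w" by (simp add: lebesgue_on_iff_lborel)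
  have sub0: "is_subspectrum N0 \<mu>0 a b q q2 h Dirichlet a1 a2" "is_subspectrum N0 \<mu>0 a b q' q2 h' Dirichlet a1 a2"
    and sub1: "is_subspectrum N1 \<mu>1 a b q q2 h (Robin H) a1 a2" "is_subspectrum N1 \<mu>1 a b q' q2 h' (Robin H) a1 a2"
    using s s' by (auto simp: inverse_problem_solution_def)
  have a1': "a1 \<noteq> 0" using a1 by simp
  \<comment> \<open>Stated for any sequence whose multiplicities are respected by the zeros of
    \<open>?W\<close>, so that it serves both subspectra.\<close>
  have orth: "(LINT t|lebesgue_on {0<..<2 * a}. w t * c t) = 0"
    if c: "c \<in> cos_system M \<mu>"
      and zero: "\<And>z k. k < card (occurrences M \<mu> z) \<Longrightarrow> (deriv ^^ k) ?W z = 0" for c M \<mu>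
  proof -
    obtain n \<nu> where c: "c = cos_coeff (\<mu> n) \<nu>" and \<nu>: "\<nu> < card (occurrences M \<mu> (\<mu> n))"
      using c by (auto simp: cos_system_def)
    have "(LINT t|lebesgue_on {0<..<2 * a}. w t * c t) = (LINT t:{0<..<2 * a}|lborel. w t * cos_coeff (\<mu> n) \<nu> t)"
      unfolding c by (rule lebesgue_on_iff_lborel) simp_all
    also have "\<dots> = (LINT t:{0<..<2 * a}|lborel. w t * (deriv ^^ \<nu>) (\<lambda>lam. cosl lam t) (\<mu> n)) / fact \<nu>"
      by (simp add: cos_coeff_eq)
    \<comment> \<open>Differentiation in \<open>lam\<close> passes to the cosine under the integral,
      so the pairing with \<open>cos_coeff\<close> is a Taylor coefficient of the Wronskian.\<close>
    also have "\<dots> = (deriv ^^ \<nu>) ?W (\<mu> n) / fact \<nu>"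
      unfolding W cosine_transform_holomorphic(2)[OF wi] ..
    also have "\<dots> = 0" using zero[OF \<nu>] by simp
    finally show ?thesis .
  qed
  have w0: "AE t in lebesgue_on {0<..<2 * a}. w t = 0"
  proof (rule complete_orthogonal_imp_zero[OF C wL])
    fix c assume "c \<in> cos_system N0 \<mu>0 \<union> cos_system N1 \<mu>1"
    then show "(LINT t|lebesgue_on {0<..<2 * a}. w t * c t) = 0"
    proof
      assume c: "c \<in> cos_system N0 \<mu>0"
      show ?thesis
        by (rule orth[OF c wronskian_zero_of_subspectra[OF a b q q' q2 a1' sub0]])
    next
      assume c: "c \<in> cos_system N1 \<mu>1"
      show ?thesis
        by (rule orth[OF c wronskian_zero_of_subspectra[OF a b q q' q2 a1' sub1]])
    qed
  qed
  have "AE t in lborel. t \<in> {0<..<2 * a} \<longrightarrow> w t = 0"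
    using w0 by (simp only: AE_lebesgue_on_iff[OF borel_open[OF open_greaterThanLessThan]])
  \<comment> \<open>Putting t = 2y turns w = 0 into p(y) = -4 N(2y), and the bound on N at 2y is the
    tail of p beyond y.\<close>
  then have "AE y in lborel. 0 + 2 * y \<in> {0<..<2 * a} \<longrightarrow> w (0 + 2 * y) = 0"
    by (intro AE_borel_affine) auto
  then have "AE y in lborel. y \<in> {0<..<a} \<longrightarrow> norm (p y) \<le> (4 * L) * L1_tail p a y"
  proof eventually_elim
    case (elim y)
    show ?case
    proof
      assume "y \<in> {0<..<a}"
      then have "p y / 4 + N (2 * y) = 0" using elim by (simp add: w_def)
      then have "p y = - 4 * N (2 * y)" by (simp add: field_simps add_eq_0_iff)
      then show "norm (p y) \<le> (4 * L) * L1_tail p a y" using Nb[of "2 * y"] by (simp add: norm_mult)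
    qed
  qed
  then have p0: "AE y in lborel. p y = 0"
    by (rule volterra_zero[OF potential_integrable[OF p] potentialD(3)[OF p], rotated 2]) (use L in auto)
  \<comment> \<open>With p null, the relation \<open>const\<close> reduces to the equality of the
    two boundary coefficients.\<close>
  have "(LINT x|lborel. p x) = (LINT x::real|lborel. 0)" by (rule integral_cong_AE) (use p0 in auto)
  then have "h' = h" using const by simp
  moreover have "AE x in lebesgue_on {0<..<a}. q' x = q x"
  proof -
    have "AE x in lebesgue_on {0<..<a}. p x = 0"
      using p0 by (subst AE_lebesgue_on_iff) auto
    with p1(2) p2(2) show ?thesis by eventually_elim (simp add: p_def)
  qed
  ultimately show ?thesis by simp
qed

theorem theorem2:
  fixes a a1 :: real and a2 H \<omega>1 :: complex and q2 :: "real \<Rightarrow> complex"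
    and N0 N1 :: enat and \<mu>0 \<mu>1 :: "nat \<Rightarrow> complex"
  assumes "0 < a" and "a < 1" and "0 < a1"
    and "L2_on {0<..<1 - a} q2"
    and "ordered_seq N0 \<mu>0" and "ordered_seq N1 \<mu>1"
    and "\<exists>q1 h. inverse_problem_solution a (1 - a) q2 H a1 a2 \<omega>1 N0 \<mu>0 N1 \<mu>1 q1 h"
    and "complete_in_L2 {0<..<2 * a} (cos_system N0 \<mu>0 \<union> cos_system N1 \<mu>1)"
  shows "\<exists>q1 h. inverse_problem_solution a (1 - a) q2 H a1 a2 \<omega>1 N0 \<mu>0 N1 \<mu>1 q1 h \<and>
           (\<forall>q1' h'. inverse_problem_solution a (1 - a) q2 H a1 a2 \<omega>1 N0 \<mu>0 N1 \<mu>1 q1' h' \<longrightarrow>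
              (AE x in lebesgue_on {0<..<a}. q1' x = q1 x) \<and> h' = h)"
proof -
  obtain q1 h where s: "inverse_problem_solution a (1 - a) q2 H a1 a2 \<omega>1 N0 \<mu>0 N1 \<mu>1 q1 h"
    using assms(7) by blast
  have "0 < 1 - a" using assms(2) by simp
  then show ?thesis
    using s inverse_problem_solutions_eq[OF assms(1) _ assms(3,4) s _ assms(8)] by blast
qed

end
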